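(* Let $k,n\ge 1$ and $\mathbb{F}=\mathbb{R}$ or $\mathbb{C}$. Then the map on path-connected components $$\pi_0(\mathrm{Hom}(\mathbb{Z}^k,\widetilde{\mathrm{U}}_{n+2}(\mathbb{F})))\to H^2(\mathbb{Z}^k;A)$$ induced by forgetting the flat structure, $\rho\mapsto\tilde\rho$, is injective for every $k\ge 2$, and surjective if and only if $\lfloor k/2\rfloor\le n$. Moreover, each path-connected component parametrized by a class $\beta\in H^2(\mathbb{Z}^k;A)$ (i.e. mapping to $\beta$) is homotopy equivalent to $$V_r(D(\mathbb{F})^n)\times (S^1)^{k\dim_{\mathbb{R}}\mathbb{F}},$$ where $2r=\mathrm{rank}(\beta)$.
   Context: $\mathrm{U}_m(\mathbb{F})$ is the group of $m\times m$ upper unitriangular matrices over $\mathbb{F}$. $A\subset \mathrm{U}_m(\mathbb{F})$ is the standard central discrete subgroup of matrices whose only nonzero off-diagonal entry is the top-right corner, with value in $\mathbb{Z}$ if $\mathbb{F}=\mathbb{R}$ and in $\mathbb{Z}[i]\cong\mathbb{Z}\times\mathbb{Z}$ if $\mathbb{F}=\mathbb{C}$; we also regard $A\subset\mathbb{F}$. $\widetilde{\mathrm{U}}_m(\mathbb{F}):=\mathrm{U}_m(\mathbb{F})/A$, a connected Lie group with universal cover $\mathrm{U}_m(\mathbb{F})$ and fundamental group $A$. For a topological group $G$, $\mathrm{Hom}(\mathbb{Z}^k,G)$ is the space of group homomorphisms, topologized as the subspace of $G^k$ of commuting $k$-tuples. For an abelian group $S$, $\mathrm{Ant}_k(S)$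 is the group of antisymmetric $k\times k$ matrices over $S$; $H^2(\mathbb{Z}^k;A)\cong\mathrm{Ant}_k(A)$. For a connected Lie group $G$ with universal cover $\tilde G\to G$, the (locally constant) map $\mathrm{Hom}(\mathbb{Z}^k,G)\to H^2(\mathbb{Z}^k;\pi_1(G))\cong \mathrm{Ant}_k(\pi_1(G))$ that forgets the flat structure is $\rho\mapsto\tilde\rho$ with $\tilde\rho_{ij}=[\tilde g_i,\tilde g_j]$, where $\tilde g_i\in\tilde G$ is any lift of $\rho(e_i)$, $e_1,\dots,e_k$ is the canonical basis of $\mathbb{Z}^k$, and $[x,y]=x^{-1}y^{-1}xy$. A class $\beta\in H^2(\mathbb{Z}^k;A)$ is regarded as an antisymmetric bilinear form on $\mathbb{F}^k$, and $\mathrm{rank}(\beta)$ is the rank over $\mathbb{F}$ of its matrix in the canonical basis. $D(\mathbb{R}):=\mathbb{C}$, $D(\mathbb{C}):=\mathbb{H}$ (quaternions), and $V_q(D(\mathbb{F})^m)$ is the Stiefel manifold of orthonormal $q$-frames in $D(\mathbb{F})^m$. *)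

theory Defs
  imports
    "HOL-Analysis.Homotopy"
    "HOL-Algebra.Product_Groups"
    "HOL-Algebra.Elementary_Groups"
    "Jordan_Normal_Form.DL_Rank"
begin

section \<open>Quaternions\<close>

datatype quat = Quat (qre: real) (qi: real) (qj: real) (qk: real)

lemma quat_eqI: "qre x = qre y \<Longrightarrow> qi x = qi y \<Longrightarrow> qj x = qj y \<Longrightarrow> qk x = qk y \<Longrightarrow> x = y"
  by (cases x; cases y) simp

lemma quat_eq_iff: "x = y \<longleftrightarrow> qre x = qre y \<and> qi x = qi y \<and> qj x = qj y \<and> qk x = qk y"
  by (auto intro: quat_eqI)

instantiation quat :: "{ring_1, real_algebra_1}"
begin

definition "0 = Quat 0 0 0 0"
definition "1 = Quat 1 0 0 0"
definition "x + y = Quat (qre x + qre y) (qi x + qi y) (qj x + qj y) (qk x + qk y)"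
definition "x - y = Quat (qre x - qre y) (qi x - qi y) (qj x - qj y) (qk x - qk y)"
definition "- x = Quat (- qre x) (- qi x) (- qj x) (- qk x)"
definition "r *\<^sub>R x = Quat (r * qre x) (r * qi x) (r * qj x) (r * qk x)"
definition "x * y = Quat
  (qre x * qre y - qi x * qi y - qj x * qj y - qk x * qk y)
  (qre x * qi y + qi x * qre y + qj x * qk y - qk x * qj y)
  (qre x * qj y - qi x * qk y + qj x * qre y + qk x * qi y)
  (qre x * qk y + qi x * qj y - qj x * qi y + qk x * qre y)"

instance
  by standard
    (auto simp: quat_eq_iff zero_quat_def one_quat_def plus_quat_def minus_quat_def
      uminus_quat_def times_quat_def scaleR_quat_def algebra_simps)

end

lemma quat_sel_simps [simp]:
  "qre 0 = 0" "qi 0 = 0" "qj 0 = 0" "qk 0 = 0"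
  "qre 1 = 1" "qi 1 = 0" "qj 1 = 0" "qk 1 = 0"
  "qre (x + y) = qre x + qre y" "qi (x + y) = qi x + qi y"
  "qj (x + y) = qj x + qj y" "qk (x + y) = qk x + qk y"
  "qre (x - y) = qre x - qre y" "qi (x - y) = qi x - qi y"
  "qj (x - y) = qj x - qj y" "qk (x - y) = qk x - qk y"
  "qre (- x) = - qre x" "qi (- x) = - qi x" "qj (- x) = - qj x" "qk (- x) = - qk x"
  "qre (r *\<^sub>R x) = r * qre x" "qi (r *\<^sub>R x) = r * qi x"
  "qj (r *\<^sub>R x) = r * qj x" "qk (r *\<^sub>R x) = r * qk x"
  "qre (x * y) = qre x * qre y - qi x * qi y - qj x * qj y - qk x * qk y"
  "qi (x * y) = qre x * qi y + qi x * qre y + qj x * qk y - qk x * qj y"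
  "qj (x * y) = qre x * qj y - qi x * qk y + qj x * qre y + qk x * qi y"
  "qk (x * y) = qre x * qk y + qi x * qj y - qj x * qi y + qk x * qre y"
  by (simp_all add: zero_quat_def one_quat_def plus_quat_def minus_quat_def
      uminus_quat_def times_quat_def scaleR_quat_def)

instantiation quat :: real_inner
begin

definition inner_quat :: "quat \<Rightarrow> quat \<Rightarrow> real" where
  "inner_quat x y = qre x * qre y + qi x * qi y + qj x * qj y + qk x * qk y"
definition norm_quat :: "quat \<Rightarrow> real" where "norm_quat x = sqrt (inner x x)"
definition sgn_quat :: "quat \<Rightarrow> quat" where "sgn_quat x = x /\<^sub>R norm x"
definition dist_quat :: "quat \<Rightarrow> quat \<Rightarrow> real" where "dist_quat x y = norm (x - y)"
definition uniformity_quat :: "(quat \<times> quat) filter" where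
  "uniformity_quat = (INF e\<in>{0<..}. principal {(x, y). dist x y < e})"
definition open_quat :: "quat set \<Rightarrow> bool" where
  "open_quat U \<longleftrightarrow> (\<forall>x\<in>U. eventually (\<lambda>(x', y). x' = x \<longrightarrow> y \<in> U) uniformity)"

instance
proof
  fix x y z :: quat and r :: real and U :: "quat set"
  show "dist x y = norm (x - y)" by (rule dist_quat_def)
  show "sgn x = x /\<^sub>R norm x" by (rule sgn_quat_def)
  show "(uniformity :: (quat \<times> quat) filter) = (INF e\<in>{0<..}. principal {(x, y). dist x y < e})"
    by (rule uniformity_quat_def)
  show "open U \<longleftrightarrow> (\<forall>x\<in>U. eventually (\<lambda>(x', y). x' = x \<longrightarrow> y \<in> U) uniformity)"
    by (rule open_quat_def)
  show "inner x y = inner y x" by (simp add: inner_quat_def algebra_simps)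
  show "inner (x + y) z = inner x z + inner y z" by (simp add: inner_quat_def algebra_simps)
  show "inner (r *\<^sub>R x) y = r * inner x y" by (simp add: inner_quat_def algebra_simps)
  show "0 \<le> inner x x" by (simp add: inner_quat_def)
  show "inner x x = 0 \<longleftrightarrow> x = 0"
  proof
    assume "inner x x = 0"
    then have *: "(qre x)\<^sup>2 + (qi x)\<^sup>2 + (qj x)\<^sup>2 + (qk x)\<^sup>2 = 0"
      by (simp add: inner_quat_def power2_eq_square)
    have "(qre x)\<^sup>2 = 0" "(qi x)\<^sup>2 = 0" "(qj x)\<^sup>2 = 0" "(qk x)\<^sup>2 = 0"
      using * zero_le_power2[of "qre x"] zero_le_power2[of "qi x"]
        zero_le_power2[of "qj x"] zero_le_power2[of "qk x"] by linarith+
    then show "x = 0" by (simp add: quat_eq_iff)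
  qed (simp add: inner_quat_def)
  show "norm x = sqrt (inner x x)" by (rule norm_quat_def)
qed

end

definition qcnj :: "quat \<Rightarrow> quat" where
  "qcnj x = Quat (qre x) (- qi x) (- qj x) (- qk x)"

lemma qcnj_mult_self: "qcnj x * x = inner x x *\<^sub>R 1"
  by (simp add: quat_eq_iff qcnj_def inner_quat_def algebra_simps)


section \<open>Unitriangular groups and their central quotients\<close>

definition gaussian_ints :: "complex set" where
  "gaussian_ints = {z. Re z \<in> \<int> \<and> Im z \<in> \<int>}"

definition unitri :: "nat \<Rightarrow> 'a::comm_ring_1 mat monoid" where
  "unitri m = \<lparr>carrier = {M \<in> carrier_mat m m. upper_triangular M \<and> (\<forall>i<m. M $$ (i, i) = 1)},
    monoid.mult = (*), one = 1\<^sub>m m\<rparr>"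

definition unitri_topology :: "nat \<Rightarrow> 'a::{comm_ring_1, topological_space} mat topology" where
  "unitri_topology m =
    pullback_topology (carrier (unitri m)) (\<lambda>M. \<lambda>p\<in>{..<m} \<times> {..<m}. M $$ p)
      (product_topology (\<lambda>_. euclidean) ({..<m} \<times> {..<m}))"

definition corner_mat :: "nat \<Rightarrow> 'a::comm_ring_1 \<Rightarrow> 'a mat" where
  "corner_mat m a =
    Matrix.mat m m (\<lambda>(i, j). if i = j then 1 else if i = 0 \<and> j = m - 1 then a else 0)"

definition corner_subgroup :: "nat \<Rightarrow> 'a::comm_ring_1 set \<Rightarrow> 'a mat set" where
  "corner_subgroup m S = corner_mat m ` S"

definition unitri_quot :: "nat \<Rightarrow> 'a::comm_ring_1 set \<Rightarrow> 'a mat set monoid" where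
  "unitri_quot m S = unitri m Mod corner_subgroup m S"

definition quotient_topology :: "'a topology \<Rightarrow> ('a \<Rightarrow> 'b) \<Rightarrow> 'b topology" where
  "quotient_topology X q =
    topology (\<lambda>U. U \<subseteq> q ` topspace X \<and> openin X {x \<in> topspace X. q x \<in> U})"

lemma openin_quotient_topology:
  "openin (quotient_topology X q) U \<longleftrightarrow>
    U \<subseteq> q ` topspace X \<and> openin X {x \<in> topspace X. q x \<in> U}"
proof -
  let ?P = "\<lambda>U. U \<subseteq> q ` topspace X \<and> openin X {x \<in> topspace X. q x \<in> U}"
  have "istopology ?P"
    unfolding istopology_def
  proof (intro conjI allI impI)
    fix S T assume "?P S" "?P T"
    moreover have "{x \<in> topspace X. q x \<in> S \<inter> T} =
        {x \<in> topspace X. q x \<in> S} \<inter> {x \<in> topspace X. q x \<in> T}" by blast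
    ultimately show "S \<inter> T \<subseteq> q ` topspace X" "openin X {x \<in> topspace X. q x \<in> S \<inter> T}"
      by auto
  next
    fix \<K> assume *: "\<forall>K\<in>\<K>. ?P K"
    have "{x \<in> topspace X. q x \<in> \<Union>\<K>} = (\<Union>K\<in>\<K>. {x \<in> topspace X. q x \<in> K})" by blast
    moreover have "openin X (\<Union>K\<in>\<K>. {x \<in> topspace X. q x \<in> K})" using * by blast
    ultimately show "openin X {x \<in> topspace X. q x \<in> \<Union>\<K>}" by simp
    show "\<Union>\<K> \<subseteq> q ` topspace X" using * by blast
  qed
  then show ?thesis by (simp add: quotient_topology_def)
qed

lemma topspace_quotient_topology: "topspace (quotient_topology X q) = q ` topspace X"
proof
  have "{x \<in> topspace X. q x \<in> q ` topspace X} = topspace X" by blast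
  then have "openin (quotient_topology X q) (q ` topspace X)"
    by (simp add: openin_quotient_topology)
  then show "q ` topspace X \<subseteq> topspace (quotient_topology X q)" by (rule openin_subset)
  show "topspace (quotient_topology X q) \<subseteq> q ` topspace X"
    using openin_topspace[of "quotient_topology X q"] unfolding openin_quotient_topology by blast
qed

lemma quotient_map_quotient_topology: "quotient_map X (quotient_topology X q) q"
  by (simp add: quotient_map_def openin_quotient_topology topspace_quotient_topology)

definition unitri_quot_topology ::
  "nat \<Rightarrow> 'a::{comm_ring_1, topological_space} set \<Rightarrow> 'a mat set topology" where
  "unitri_quot_topology m S =
    quotient_topology (unitri_topology m) (\<lambda>M. corner_subgroup m S #>\<^bsub>unitri m\<^esub> M)"


section \<open>Spaces of homomorphisms\<close>

definition int_power_group :: "nat \<Rightarrow> (nat \<Rightarrow> int) monoid" where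
  "int_power_group k = product_group {..<k} (\<lambda>_. integer_group)"

definition std_gen :: "nat \<Rightarrow> nat \<Rightarrow> nat \<Rightarrow> int" where
  "std_gen k i = (\<lambda>j\<in>{..<k}. if j = i then 1 else 0)"

text \<open>Homomorphisms are taken extensional, so that each one is represented by exactly one
  function.  The topology is the one pulled back along the injection
  \<open>\<rho> \<mapsto> (\<rho> e\<^sub>1, \<dots>, \<rho> e\<^sub>k)\<close>, whose image is the set of commuting \<open>k\<close>-tuples.\<close>

definition hom_topology ::
  "nat \<Rightarrow> 'g monoid \<Rightarrow> 'g topology \<Rightarrow> ((nat \<Rightarrow> int) \<Rightarrow> 'g) topology" where
  "hom_topology k G T =
    pullback_topology
      (hom (int_power_group k) G \<inter> extensional (carrier (int_power_group k)))
      (\<lambda>\<rho>. \<lambda>i\<in>{..<k}. \<rho> (std_gen k i))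
      (product_topology (\<lambda>_. T) {..<k})"

definition unitri_flat_space ::
  "nat \<Rightarrow> nat \<Rightarrow> 'a::{comm_ring_1, topological_space} set \<Rightarrow>
    ((nat \<Rightarrow> int) \<Rightarrow> 'a mat set) topology" where
  "unitri_flat_space k m S = hom_topology k (unitri_quot m S) (unitri_quot_topology m S)"

definition group_commutator :: "('a, 'b) monoid_scheme \<Rightarrow> 'a \<Rightarrow> 'a \<Rightarrow> 'a" where
  "group_commutator G x y = inv\<^bsub>G\<^esub> x \<otimes>\<^bsub>G\<^esub> inv\<^bsub>G\<^esub> y \<otimes>\<^bsub>G\<^esub> x \<otimes>\<^bsub>G\<^esub> y"

definition antisym_mats :: "nat \<Rightarrow> 'a::comm_ring_1 set \<Rightarrow> 'a mat set" where
  "antisym_mats k S = {B \<in> carrier_mat k k. elements_mat B \<subseteq> S \<and> transpose_mat B = - B}"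

text \<open>An element of the quotient group is a coset, so its lifts are exactly its members.  The
  commutator of two lifts lies in the corner subgroup; it is identified with its top-right entry.
  Second cohomology classes of \<open>\<int>\<^sup>k\<close> are represented by antisymmetric matrices.\<close>

definition forget_flat ::
  "nat \<Rightarrow> nat \<Rightarrow> ((nat \<Rightarrow> int) \<Rightarrow> 'a::comm_ring_1 mat set) \<Rightarrow> 'a mat" where
  "forget_flat k m \<rho> =
    (let lift = (\<lambda>i. SOME g. g \<in> \<rho> (std_gen k i))
     in Matrix.mat k k (\<lambda>(i, j). group_commutator (unitri m) (lift i) (lift j) $$ (0, m - 1)))"

text \<open>The map on path components induced by \<open>f\<close>; meaningful when \<open>f\<close> is constant on \<open>C\<close>.\<close>

definition induced_on_component :: "('a \<Rightarrow> 'b) \<Rightarrow> 'a set \<Rightarrow> 'b" where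
  "induced_on_component f C = the_elem (f ` C)"


section \<open>Stiefel manifolds and tori\<close>

definition stiefel ::
  "('d::{ring_1, topological_space} \<Rightarrow> 'd) \<Rightarrow> nat \<Rightarrow> nat \<Rightarrow> (nat \<Rightarrow> nat \<Rightarrow> 'd) topology" where
  "stiefel cj q m =
    subtopology
      (product_topology (\<lambda>_. product_topology (\<lambda>_. euclidean) {..<m}) {..<q})
      {v. \<forall>i<q. \<forall>j<q. (\<Sum>l<m. cj (v i l) * v j l) = (if i = j then 1 else 0)}"

definition torus :: "nat \<Rightarrow> (nat \<Rightarrow> complex) topology" where
  "torus d = product_topology (\<lambda>_. top_of_set (sphere 0 1)) {..<d}"

end

theory Submission
  imports Defs
begin

text \<open>
  Write a lift of \<open>\<rho>(e\<^sub>i)\<close> to the unitriangular group as \<open>1 + X\<^sub>i\<close>. Since the corner matrix is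
  annihilated by all strictly upper triangular matrices, the lifts commute modulo \<open>A\<close> with class
  \<open>\<beta>\<close> iff \<open>[X\<^sub>i, X\<^sub>j]\<close> is \<open>\<beta>\<^sub>i\<^sub>j\<close> times the corner matrix unit. These
  equations are preserved when the middle \<open>n \<times> n\<close> blocks of all \<open>X\<^sub>i\<close> are multiplied by \<open>t\<close>;
  letting \<open>t\<close> tend to \<open>0\<close>, there remain the first rows and last columns, that is \<open>k\<close>
  vectors of the symplectic space \<open>F\<^sup>2\<^sup>n\<close> with Gram matrix \<open>\<beta>\<close>, and the corner entries, which give
  the torus. A rank factorization of \<open>\<beta>\<close> retracts the space of such vectors onto the space of
  symplectic frames of \<open>r\<close> hyperbolic pairs, a Gram--Schmidt process retracts the latter onto the frames
  \<open>(p, J p)\<close> with \<open>p\<close> unitary over \<open>D(F)\<close>, and transvections show that it is path-connected. As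
  \<open>\<rho> \<mapsto> \<beta>\<close> is continuous with discrete values, the nonempty fibres are the path components.
\<close>

section \<open>Alternating bilinear forms and rank\<close>

text \<open>Both fields are treated at once through a conjugation \<open>cj\<close>, the identity on
  the reals. On F^2n the bilinear form \<open>om\<close> and the sesquilinear form
  \<open>herm\<close> are the two components of the standard inner product of D(F)^n; this is how
  Stiefel manifolds over D(F) arise. The corner entries occur in no commutator, so each of the k
  generators contributes a free factor F/A, a torus of dimension dim F. A class of rank 2r is
  attained iff r hyperbolic pairs fit into F^2n, that is r \<le> n, and the standard form with k div
  2 pairs has the largest rank possible; hence the condition on k div 2. Forms are normalized over
  the field and not over A, so no elementary divisors appear. Vectors and tuples are functions on
  all naturals of which only finitely many values are constrained; the free values can be contracted
  linearly, which is why the intermediate spaces are compared up to homotopy equivalence.\<close>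

definition bform :: "nat \<Rightarrow> (nat \<Rightarrow> nat \<Rightarrow> 'a::field_char_0) \<Rightarrow> (nat \<Rightarrow> 'a) \<Rightarrow> (nat \<Rightarrow> 'a) \<Rightarrow> 'a" where
  "bform k B x y = (\<Sum>a<k. \<Sum>b<k. x a * B a b * y b)"

text \<open>The \<open>r\<close> hyperbolic pairs \<open>(p s, q s)\<close> of a symplectic basis.
  The form \<open>f\<close> is a parameter because the notion serves both for a class \<beta> on F^k
  and for \<open>om\<close> on F^2n.\<close>

definition symp_family :: "('v \<Rightarrow> 'v \<Rightarrow> 'a::field_char_0) \<Rightarrow> nat \<Rightarrow> (nat \<Rightarrow> 'v) \<Rightarrow> (nat \<Rightarrow> 'v) \<Rightarrow> bool" where
  "symp_family f r p q \<longleftrightarrow> (\<forall>s<r. \<forall>t<r.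
     f (p s) (q t) = (if s = t then 1 else 0) \<and> f (p s) (p t) = 0 \<and> f (q s) (q t) = 0)"

text \<open>If \<rho> were smaller than N, padding both factors with zeros to size N would give
  square matrices with A C = 1, hence C A = 1, although row \<rho> of C vanishes.\<close>

lemma inner_dim_bound:
  fixes F G :: "nat \<Rightarrow> nat \<Rightarrow> 'a::field"
  assumes "\<And>i j. i < N \<Longrightarrow> j < N \<Longrightarrow> (\<Sum>l<\<rho>. F i l * G l j) = (if i = j then 1 else 0)"
  shows "N \<le> \<rho>"
proof (rule ccontr)
  assume "\<not> N \<le> \<rho>"
  then have less: "\<rho> < N" by simp
  define A where "A = Matrix.mat N N (\<lambda>(i, l). if l < \<rho> then F i l else 0)"
  define C where "C = Matrix.mat N N (\<lambda>(l, j). if l < \<rho> then G l j else 0)"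
  have carr: "A \<in> carrier_mat N N" "C \<in> carrier_mat N N" by (auto simp: A_def C_def)
  have "A * C = 1\<^sub>m N"
  proof (rule eq_matI)
    fix i j assume ij: "i < dim_row (1\<^sub>m N)" "j < dim_col (1\<^sub>m N)"
    have "(A * C) $$ (i, j) = (\<Sum>l<N. if l < \<rho> then F i l * G l j else 0)"
      using ij by (simp add: A_def C_def scalar_prod_def lessThan_atLeast0 if_distrib cong: if_cong)
    also have "\<dots> = (\<Sum>l<\<rho>. F i l * G l j)"
      using less by (intro sum.mono_neutral_cong_right) auto
    finally show "(A * C) $$ (i, j) = 1\<^sub>m N $$ (i, j)" using assms ij by simp
  qed (auto simp: A_def C_def)
  then have "C * A = 1\<^sub>m N" using mat_mult_left_right_inverse[OF carr] by simp
  then have "(C * A) $$ (\<rho>, \<rho>) = 1" using less by simp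
  moreover have "(C * A) $$ (\<rho>, \<rho>) = 0"
    using less by (simp add: A_def C_def scalar_prod_def)
  ultimately show False by simp
qed

text \<open>Rank is subadditive and each summand is an outer product of rank at most one.\<close>

lemma rank_le_sum_products:
  fixes A :: "'a::field mat"
  assumes "A \<in> carrier_mat k k"
    and "\<And>a b. a < k \<Longrightarrow> b < k \<Longrightarrow> A $$ (a, b) = (\<Sum>s<N. f s a * g s b)"
  shows "vec_space.rank k A \<le> N"
  using assms
proof (induction N arbitrary: A)
  case 0
  then have "A = 0\<^sub>m k k" by (intro eq_matI) auto
  then show ?case by (simp add: vec_space.rank_0I)
next
  case (Suc N)
  define C where "C = Matrix.mat k k (\<lambda>(a, b). \<Sum>s<N. f s a * g s b)"
  define D where "D = Matrix.mat k k (\<lambda>(a, b). f N a * g N b)"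
  have carr: "C \<in> carrier_mat k k" "D \<in> carrier_mat k k" by (auto simp: C_def D_def)
  have "A = C + D" using Suc.prems by (intro eq_matI) (auto simp: C_def D_def)
  moreover have "vec_space.rank k C \<le> N" by (rule Suc.IH[OF carr(1)]) (simp add: C_def)
  moreover have "vec_space.rank k D \<le> 1"
    by (rule vec_space.rank_le_1_product_entries[OF carr(2), of "f N" "g N"]) (simp add: D_def)
  ultimately show ?case using vec_space.rank_subadditive[OF carr] by simp
qed

text \<open>The vectors \<open>f s\<close> form a maximal independent set of columns; by maximality
  every column lies in its span, and \<open>g s b\<close> are the coefficients of column
  \<open>b\<close>.\<close>

lemma rank_factorization:
  fixes A :: "'a::field mat"
  assumes A: "A \<in> carrier_mat k k"
  obtains f g where "\<And>a b. a < k \<Longrightarrow> b < k \<Longrightarrow> A $$ (a, b) = (\<Sum>s<vec_space.rank k A. f s a * g s b)"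
proof -
  interpret vec_space "TYPE('a)" k .
  have sub: "set (cols A) \<subseteq> carrier_vec k" using A cols_dim by blast
  obtain S where mx: "maximal S (\<lambda>T. T \<subseteq> set (cols A) \<and> lin_indpt T)" and finS: "finite S"
    using maximal_exists_superset[of "set (cols A)" "\<lambda>T. T \<subseteq> set (cols A) \<and> lin_indpt T" "{}"]
    by (metis (no_types, lifting) List.finite_set empty_subsetI finite_lin_indpt2 finite.emptyI
        empty_iff)
  have card: "rank A = card S" by (rule rank_card_indpt[OF A mx])
  have SV: "S \<subseteq> carrier_vec k" using mx sub by (auto simp: maximal_def)
  have "set (cols A) \<subseteq> span S"
  proof (rule ccontr)
    assume "\<not> set (cols A) \<subseteq> span S"
    then obtain v where v: "v \<in> set (cols A)" "v \<notin> span S" by blast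
    have li: "lin_indpt S" using mx by (simp add: maximal_def)
    have vS: "v \<notin> S" using v(2) in_own_span[OF SV] by blast
    have "lin_indpt (insert v S)"
      using lin_dep_iff_in_span[OF SV li _ vS] v sub by auto
    moreover have "insert v S \<subseteq> set (cols A)" using mx v by (auto simp: maximal_def)
    ultimately have "insert v S = S" using mx unfolding maximal_def by blast
    then show False using vS by blast
  qed
  then have "\<forall>b<k. \<exists>c. col A b = lincomb c S"
    using A finite_in_span[OF finS SV] by (metis cols_length cols_nth carrier_matD(2) nth_mem subsetD)
  then obtain c where c: "\<And>b. b < k \<Longrightarrow> col A b = lincomb (c b) S" by metis
  obtain h where h: "bij_betw h {..<card S} S"
    using ex_bij_betw_nat_finite[OF finS] lessThan_atLeast0 by metis
  show thesis
  proof (rule that[of "\<lambda>s a. vec_index (h s) a" "\<lambda>s b. c b (h s)"])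
    fix a b assume ab: "a < k" "b < k"
    have "A $$ (a, b) = vec_index (col A b) a" using A ab by simp
    also have "\<dots> = (\<Sum>x\<in>S. c b x * vec_index x a)"
      unfolding c[OF ab(2)] by (rule lincomb_index[OF ab(1) SV])
    also have "\<dots> = (\<Sum>s<card S. c b (h s) * vec_index (h s) a)"
      by (rule sum.reindex_bij_betw[OF h, symmetric])
    finally show "A $$ (a, b) = (\<Sum>s<rank A. vec_index (h s) a * c b (h s))"
      by (simp add: card mult.commute)
  qed
qed

text \<open>A rank factorization of \<open>A\<close> makes the identity matrix of size
  \<open>N\<close> factor through a space of dimension rank \<open>A\<close>.\<close>

lemma rank_ge_dual_families:
  fixes A :: "'a::field_char_0 mat"
  assumes A: "A \<in> carrier_mat k k"
    and d: "\<And>i j. i < N \<Longrightarrow> j < N \<Longrightarrow>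
      bform k (\<lambda>a b. A $$ (a, b)) (R i) (C j) = (if i = j then 1 else 0)"
  shows "N \<le> vec_space.rank k A"
proof -
  obtain f g where fg: "\<And>a b. a < k \<Longrightarrow> b < k \<Longrightarrow> A $$ (a, b) = (\<Sum>s<vec_space.rank k A. f s a * g s b)"
    using rank_factorization[OF A] by blast
  show ?thesis
  proof (rule inner_dim_bound)
    fix i j assume ij: "i < N" "j < N"
    have "(\<Sum>l<vec_space.rank k A. (\<Sum>a<k. R i a * f l a) * (\<Sum>b<k. g l b * C j b))
        = (\<Sum>l<vec_space.rank k A. \<Sum>a<k. \<Sum>b<k. (R i a * f l a) * (g l b * C j b))"
      by (simp add: sum_product)
    also have "\<dots> = (\<Sum>a<k. \<Sum>b<k. \<Sum>l<vec_space.rank k A. (R i a * f l a) * (g l b * C j b))"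
      by (rule trans[OF sum.swap], rule sum.cong[OF refl], rule sum.swap)
    also have "\<dots> = bform k (\<lambda>a b. A $$ (a, b)) (R i) (C j)"
      unfolding bform_def
      by (intro sum.cong refl) (simp add: fg sum_distrib_left sum_distrib_right mult_ac)
    finally show "(\<Sum>l<vec_space.rank k A. (\<Sum>a<k. R i a * f l a) * (\<Sum>b<k. g l b * C j b))
        = (if i = j then 1 else 0)" using d[OF ij] by simp
  qed
qed

lemma bform_diff_left: "bform k B (\<lambda>a. x a - y a) z = bform k B x z - bform k B y z"
  by (simp add: bform_def left_diff_distrib sum_subtractf)
lemma bform_diff_right: "bform k B z (\<lambda>a. x a - y a) = bform k B z x - bform k B z y"
  by (simp add: bform_def right_diff_distrib sum_subtractf)
lemma bform_add_left: "bform k B (\<lambda>a. x a + y a) z = bform k B x z + bform k B y z"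
  by (simp add: bform_def distrib_right sum.distrib)
lemma bform_add_right: "bform k B z (\<lambda>a. x a + y a) = bform k B z x + bform k B z y"
  by (simp add: bform_def distrib_left sum.distrib)
lemma bform_scale_left: "bform k B (\<lambda>a. c * x a) y = c * bform k B x y"
  by (simp add: bform_def sum_distrib_left mult_ac)
lemma bform_scale_right: "bform k B x (\<lambda>a. c * y a) = c * bform k B x y"
  by (simp add: bform_def sum_distrib_left mult_ac)
lemma bform_minus_left: "bform k B (\<lambda>a. - x a) y = - bform k B x y"
  by (simp add: bform_def sum_negf)
lemma bform_minus_right: "bform k B x (\<lambda>a. - y a) = - bform k B x y"
  by (simp add: bform_def sum_negf)
lemma bform_sum_left: "finite S \<Longrightarrow> bform k B (\<lambda>a. \<Sum>s\<in>S. x s a) y = (\<Sum>s\<in>S. bform k B (x s) y)"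
  by (induction S rule: finite_induct) (simp_all add: bform_add_left, simp add: bform_def)
lemma bform_sum_right: "finite S \<Longrightarrow> bform k B y (\<lambda>a. \<Sum>s\<in>S. x s a) = (\<Sum>s\<in>S. bform k B y (x s))"
  by (induction S rule: finite_induct) (simp_all add: bform_add_right, simp add: bform_def)

lemmas bform_linear = bform_diff_left bform_diff_right bform_add_left bform_add_right
  bform_scale_left bform_scale_right bform_minus_left bform_minus_right
  bform_sum_left bform_sum_right

lemma bform_antisym:
  assumes "\<And>a b. a < k \<Longrightarrow> b < k \<Longrightarrow> B b a = - B a b"
  shows "bform k B y x = - bform k B x y"
proof -
  have "bform k B y x = (\<Sum>a<k. \<Sum>b<k. y b * B b a * x a)"
    unfolding bform_def by (rule sum.swap)
  also have "\<dots> = (\<Sum>a<k. \<Sum>b<k. - (x a * B a b * y b))"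
  proof (intro sum.cong refl)
    fix a b assume "a \<in> {..<k}" "b \<in> {..<k}"
    then have "B b a = - B a b" using assms by blast
    then show "y b * B b a * x a = - (x a * B a b * y b)" by (simp only:) simp
  qed
  finally show ?thesis by (simp add: bform_def sum_negf)
qed

lemma bform_unit:
  assumes "i < k" "j < k"
  shows "bform k B (\<lambda>a. of_bool (a = i)) (\<lambda>b. of_bool (b = j)) = B i j"
proof -
  have "bform k B (\<lambda>a. of_bool (a = i)) (\<lambda>b. of_bool (b = j))
     = (\<Sum>a<k. if a = i then (\<Sum>b<k. if b = j then B a b else 0) else 0)"
    unfolding bform_def by (intro sum.cong refl) (auto intro!: sum.cong)
  then show ?thesis using assms by simp
qed

text \<open>The dual of the basis (p, q) is (q, -p); the sign absorbs the value -1 of the form on (q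
  s, p s). These dual families yield both bounds below, \<open>2 * r\<close> against the dimension
  and against the rank.\<close>

lemma symp_family_dual:
  assumes s: "symp_family (bform k B) r p q"
    and anti: "\<And>a b. a < k \<Longrightarrow> b < k \<Longrightarrow> B b a = - B a b"
    and ij: "i < 2 * r" "j < 2 * r"
  shows "bform k B (if i < r then p i else q (i - r)) (if j < r then q j else (\<lambda>a. - p (j - r) a))
    = (if i = j then 1 else 0)"
proof -
  have *: "bform k B (q a) (p b) = - (if b = a then 1 else 0)" if "a < r" "b < r" for a b
  proof -
    have "bform k B (q a) (p b) = - bform k B (p b) (q a)" by (rule bform_antisym) (rule anti)
    then show ?thesis using s that by (simp add: symp_family_def)
  qed
  show ?thesis
  proof (cases "i < r"; cases "j < r")
    assume "\<not> i < r" "\<not> j < r"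
    then show ?thesis using ij *[of "i - r" "j - r"] by (auto simp: bform_minus_right)
  qed (use s ij in \<open>auto simp: symp_family_def bform_minus_right\<close>)
qed

lemma symp_family_dim_bound:
  assumes s: "symp_family (bform k B) r p q"
    and anti: "\<And>a b. a < k \<Longrightarrow> b < k \<Longrightarrow> B b a = - B a b"
  shows "2 * r \<le> k"
proof -
  let ?R = "\<lambda>i. if i < r then p i else q (i - r)"
  let ?C = "\<lambda>j. if j < r then q j else (\<lambda>a. - p (j - r) a)"
  show ?thesis
  proof (rule inner_dim_bound[where F = ?R and G = "\<lambda>a j. \<Sum>b<k. B a b * ?C j b"])
    fix i j assume ij: "i < 2 * r" "j < 2 * r"
    have "(\<Sum>l<k. ?R i l * (\<Sum>b<k. B l b * ?C j b)) = bform k B (?R i) (?C j)"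
      by (simp only: bform_def sum_distrib_left mult.assoc)
    also have "\<dots> = (if i = j then 1 else 0)" by (rule symp_family_dual[OF s anti ij])
    finally show "(\<Sum>l<k. ?R i l * (\<Sum>b<k. B l b * ?C j b)) = (if i = j then 1 else 0)" .
  qed
qed

text \<open>The expansion formula expresses that every vector is a combination of the pairs modulo
  the radical of the form, without naming the radical or a complement.\<close>

definition symp_reduction ::
  "nat \<Rightarrow> (nat \<Rightarrow> nat \<Rightarrow> 'a::field_char_0) \<Rightarrow> nat \<Rightarrow> (nat \<Rightarrow> nat \<Rightarrow> 'a) \<Rightarrow> (nat \<Rightarrow> nat \<Rightarrow> 'a) \<Rightarrow> bool" where
  "symp_reduction k B r p q \<longleftrightarrow> symp_family (bform k B) r p q \<and>
     (\<forall>x y. bform k B x y =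
        (\<Sum>s<r. bform k B x (q s) * bform k B (p s) y - bform k B x (p s) * bform k B (q s) y))"

text \<open>A family with the largest number of pairs works: if the form did not vanish on the
  orthogonal complement of its span, one more pair could be taken from there.\<close>

lemma ex_symp_reduction:
  fixes B :: "nat \<Rightarrow> nat \<Rightarrow> 'a::field_char_0"
  assumes anti: "\<And>a b. a < k \<Longrightarrow> b < k \<Longrightarrow> B b a = - B a b"
  shows "\<exists>r p q. symp_reduction k B r p q"
proof -
  let ?f = "bform k B"
  have asym: "?f y x = - ?f x y" for x y by (rule bform_antisym) (rule anti)
  have alt0: "?f x x = 0" for x using asym[of x x] by simp
  let ?P = "\<lambda>r. \<exists>p q. symp_family ?f r p q"
  have bd: "\<forall>r. ?P r \<longrightarrow> r \<le> k" using symp_family_dim_bound[OF _ anti] by fastforce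
  have "?P 0" by (simp add: symp_family_def)
  then obtain r where r: "?P r" and mx: "\<And>r'. ?P r' \<Longrightarrow> r' \<le> r"
    using Nat.ex_has_greatest_nat[of ?P 0 k] bd by blast
  then obtain p q where pq: "symp_family ?f r p q" by blast
  have fpq: "?f (p s) (q t) = (if s = t then 1 else 0)" "?f (p s) (p t) = 0" "?f (q s) (q t) = 0"
    "?f (q s) (p t) = - (if s = t then 1 else 0)" if "s < r" "t < r" for s t
    using pq that asym[of "q s" "p t"] by (auto simp: symp_family_def)
  \<comment> \<open>The projection onto the orthogonal complement of the span: the coefficient of
    \<open>x\<close> at \<open>p s\<close> is its pairing with \<open>q s\<close>, and the one at
    \<open>q s\<close> is minus its pairing with \<open>p s\<close>.\<close>
  define \<pi> where "\<pi> x = (\<lambda>a. x a - (\<Sum>s<r. ?f x (q s) * p s a - ?f x (p s) * q s a))" for x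
  have \<pi>_left: "?f (\<pi> x) z = ?f x z - (\<Sum>s<r. ?f x (q s) * ?f (p s) z - ?f x (p s) * ?f (q s) z)" for x z
    unfolding \<pi>_def by (simp add: bform_linear sum_subtractf)
  have \<pi>p: "?f (\<pi> x) (p t) = 0" if "t < r" for x t
    unfolding \<pi>_left using that by (simp add: fpq sum_negf if_distrib[of "\<lambda>z. _ * z"] cong: if_cong)
  have \<pi>q: "?f (\<pi> x) (q t) = 0" if "t < r" for x t
    unfolding \<pi>_left using that by (simp add: fpq if_distrib[of "\<lambda>z. _ * z"] cong: if_cong)
  have p\<pi>: "?f (p t) (\<pi> x) = 0" and q\<pi>: "?f (q t) (\<pi> x) = 0" if "t < r" for x t
    using asym[of "p t" "\<pi> x"] asym[of "q t" "\<pi> x"] \<pi>p[OF that] \<pi>q[OF that] by simp_all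
  \<comment> \<open>The left argument is already orthogonal to the span, so the correction of the
    right argument contributes nothing.\<close>
  have \<pi>\<pi>: "?f (\<pi> x) (\<pi> y) = ?f (\<pi> x) y" for x y
    unfolding \<pi>_def[of y] using \<pi>p \<pi>q by (simp add: bform_linear sum_subtractf)
  have zero: "?f (\<pi> x) y = 0" for x y
  proof (rule ccontr)
    assume nz: "?f (\<pi> x) y \<noteq> 0"
    define p' where "p' = p(r := \<pi> x)"
    define q' where "q' = q(r := (\<lambda>a. inverse (?f (\<pi> x) y) * \<pi> y a))"
    have "symp_family ?f (Suc r) p' q'"
      unfolding symp_family_def
    proof (intro allI impI conjI)
      fix s t assume "s < Suc r" "t < Suc r"
      then consider "s < r" "t < r" | "s < r" "t = r" | "s = r" "t < r" | "s = r" "t = r"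
        by linarith
      then have "?f (p' s) (q' t) = (if s = t then 1 else 0) \<and> ?f (p' s) (p' t) = 0 \<and> ?f (q' s) (q' t) = 0"
      proof cases
        case 1
        then show ?thesis by (simp add: p'_def q'_def fpq)
      next
        case 2
        then show ?thesis by (simp add: p'_def q'_def p\<pi> q\<pi> bform_scale_right)
      next
        case 3
        then show ?thesis by (simp add: p'_def q'_def \<pi>p \<pi>q bform_scale_left)
      next
        case 4
        then show ?thesis using nz
          by (simp add: p'_def q'_def \<pi>\<pi> alt0 bform_scale_left bform_scale_right)
      qed
      then show "?f (p' s) (q' t) = (if s = t then 1 else 0)" "?f (p' s) (p' t) = 0" "?f (q' s) (q' t) = 0"
        by blast+
    qed
    then have "?P (Suc r)" by blast
    then show False using mx Suc_n_not_le_n by blast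
  qed
  have "symp_reduction k B r p q"
    unfolding symp_reduction_def
  proof (intro conjI allI)
    show "symp_family ?f r p q" by (fact pq)
    show "?f x y = (\<Sum>s<r. ?f x (q s) * ?f (p s) y - ?f x (p s) * ?f (q s) y)" for x y
      using zero[of x y] unfolding \<pi>_left by (simp only: right_minus_eq)
  qed
  then show ?thesis by blast
qed

lemma sum_lessThan_double: "(\<Sum>a<2 * n. f a) = (\<Sum>a<n. f a) + (\<Sum>a<n. f (n + a :: nat))"
proof -
  have "(\<Sum>a<n + n. f a) = (\<Sum>a<n. f a) + (\<Sum>a\<in>{n..<n + n}. f a)"
    by (simp only: lessThan_atLeast0 sum.atLeastLessThan_concat[symmetric] le_add1 le0)
  also have "(\<Sum>a\<in>{n..<n + n}. f a) = (\<Sum>a<n. f (n + a))"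
    using sum.shift_bounds_nat_ivl[of f 0 n n] by (simp add: lessThan_atLeast0 add.commute)
  finally show ?thesis by (simp add: mult_2)
qed

text \<open>From below by the dual families; from above because the expansion, applied to unit
  vectors, writes \<open>A\<close> as a sum of \<open>2 * r\<close> outer products.\<close>

lemma symp_reduction_rank:
  fixes A :: "'a::field_char_0 mat"
  assumes A: "A \<in> carrier_mat k k"
    and anti: "\<And>a b. a < k \<Longrightarrow> b < k \<Longrightarrow> A $$ (b, a) = - A $$ (a, b)"
    and red: "symp_reduction k (\<lambda>a b. A $$ (a, b)) r p q"
  shows "vec_space.rank k A = 2 * r"
proof (rule antisym)
  let ?f = "bform k (\<lambda>a b. A $$ (a, b))"
  let ?e = "\<lambda>i a. of_bool (a = i)"
  have fam: "symp_family ?f r p q"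
    and dec: "\<And>x y. ?f x y = (\<Sum>s<r. ?f x (q s) * ?f (p s) y - ?f x (p s) * ?f (q s) y)"
    using red unfolding symp_reduction_def by blast+
  show "2 * r \<le> vec_space.rank k A"
    by (rule rank_ge_dual_families[OF A symp_family_dual[OF fam anti]])
  show "vec_space.rank k A \<le> 2 * r"
  proof (rule rank_le_sum_products[OF A])
    fix a b assume ab: "a < k" "b < k"
    let ?F = "\<lambda>s a. if s < r then ?f (?e a) (q s) else - ?f (?e a) (p (s - r))"
    let ?G = "\<lambda>s b. if s < r then ?f (p s) (?e b) else ?f (q (s - r)) (?e b)"
    have "A $$ (a, b) = ?f (?e a) (?e b)" using bform_unit[OF ab, of "\<lambda>a b. A $$ (a, b)"] by simp
    also have "\<dots> = (\<Sum>s<r. ?F s a * ?G s b) + (\<Sum>s<r. ?F (s + r) a * ?G (s + r) b)"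
      by (subst dec) (simp add: sum_subtractf sum_negf)
    also have "\<dots> = (\<Sum>s<2 * r. ?F s a * ?G s b)"
      unfolding sum_lessThan_double by (simp only: add.commute[of _ r])
    finally show "A $$ (a, b) = (\<Sum>s<2 * r. ?F s a * ?G s b)" .
  qed
qed

section \<open>Homotopies and symplectic frames\<close>

lemma homotopic_withI:
  assumes "continuous_map (prod_topology (top_of_set {0..1::real}) X) Y h"
    and "\<And>x. x \<in> topspace X \<Longrightarrow> h (0, x) = f x" "\<And>x. x \<in> topspace X \<Longrightarrow> h (1, x) = g x"
  shows "homotopic_with (\<lambda>_. True) X Y f g"
  using assms by (subst homotopic_with) auto

lemma homotopy_equivalent_spaceI:
  assumes "continuous_map X Y f" "continuous_map Y X g"
    and "continuous_map (prod_topology (top_of_set {0..1::real}) X) X H"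
    and "continuous_map (prod_topology (top_of_set {0..1::real}) Y) Y K"
    and "\<And>x. x \<in> topspace X \<Longrightarrow> H (0, x) = g (f x)" "\<And>x. x \<in> topspace X \<Longrightarrow> H (1, x) = x"
    and "\<And>y. y \<in> topspace Y \<Longrightarrow> K (0, y) = f (g y)" "\<And>y. y \<in> topspace Y \<Longrightarrow> K (1, y) = y"
  shows "X homotopy_equivalent_space Y"
  unfolding homotopy_equivalent_space_def
proof (intro exI conjI)
  show "homotopic_with (\<lambda>_. True) X X (g \<circ> f) id"
    by (rule homotopic_withI[OF assms(3)]) (use assms in auto)
  show "homotopic_with (\<lambda>_. True) Y Y (f \<circ> g) id"
    by (rule homotopic_withI[OF assms(4)]) (use assms in auto)
qed (use assms in auto)

lemma homotopy_equivalent_setsI: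
  fixes S :: "'a::topological_space set" and T :: "'b::topological_space set"
  assumes "continuous_on S f" "\<And>x. x \<in> S \<Longrightarrow> f x \<in> T" "continuous_on T g" "\<And>y. y \<in> T \<Longrightarrow> g y \<in> S"
    and "continuous_on ({0..1::real} \<times> S) (\<lambda>z. H (fst z) (snd z))"
    and "\<And>t x. 0 \<le> t \<Longrightarrow> t \<le> 1 \<Longrightarrow> x \<in> S \<Longrightarrow> H t x \<in> S"
    and "\<And>x. x \<in> S \<Longrightarrow> H 0 x = g (f x)" "\<And>x. x \<in> S \<Longrightarrow> H 1 x = x"
    and "continuous_on ({0..1::real} \<times> T) (\<lambda>z. K (fst z) (snd z))"
    and "\<And>t y. 0 \<le> t \<Longrightarrow> t \<le> 1 \<Longrightarrow> y \<in> T \<Longrightarrow> K t y \<in> T"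
    and "\<And>y. y \<in> T \<Longrightarrow> K 0 y = f (g y)" "\<And>y. y \<in> T \<Longrightarrow> K 1 y = y"
  shows "top_of_set S homotopy_equivalent_space top_of_set T"
  by (rule homotopy_equivalent_spaceI[where f = f and g = g and H = "\<lambda>z. H (fst z) (snd z)"
        and K = "\<lambda>z. K (fst z) (snd z)"])
    (use assms in \<open>auto simp: continuous_map_in_subtopology image_subset_iff\<close>)

text \<open>Points of \<open>T\<close> may move inside \<open>T\<close>; the restriction of the
  homotopy to \<open>T\<close> then replaces the usual condition that they stay fixed. The
  Gram-Schmidt step needs this, since it alters unconstrained coordinates even on its
  target.\<close>

lemma weak_deformation_retract:
  fixes S :: "'a::topological_space set"
  assumes "T \<subseteq> S"
    and "continuous_on ({0..1::real} \<times> S) (\<lambda>z. H (fst z) (snd z))"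
    and "\<And>t x. 0 \<le> t \<Longrightarrow> t \<le> 1 \<Longrightarrow> x \<in> S \<Longrightarrow> H t x \<in> S"
    and "\<And>t x. 0 \<le> t \<Longrightarrow> t \<le> 1 \<Longrightarrow> x \<in> T \<Longrightarrow> H t x \<in> T"
    and "\<And>x. x \<in> S \<Longrightarrow> H 0 x = x" "\<And>x. x \<in> S \<Longrightarrow> H 1 x \<in> T"
  shows "top_of_set S homotopy_equivalent_space top_of_set T"
proof (rule homotopy_equivalent_setsI[where f = "H 1" and g = "\<lambda>x. x"
      and H = "\<lambda>t. H (1 - t)" and K = "\<lambda>t. H (1 - t)"])
  have "continuous_on ({0..1::real} \<times> S) (\<lambda>z. (1 - fst z, snd z))" by (intro continuous_intros)
  from continuous_on_compose2[OF assms(2) this]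
  show c: "continuous_on ({0..1::real} \<times> S) (\<lambda>z. H (1 - fst z) (snd z))" by fastforce
  show "continuous_on ({0..1::real} \<times> T) (\<lambda>z. H (1 - fst z) (snd z))"
    by (rule continuous_on_subset[OF c]) (use assms(1) in auto)
  have "continuous_on S (\<lambda>x. (1::real, x))" by (intro continuous_intros)
  from continuous_on_compose2[OF assms(2) this] show "continuous_on S (H 1)" by fastforce
qed (use assms in auto)

lemma continuous_on_coord: "continuous_on S f \<Longrightarrow> continuous_on S (\<lambda>x. f x i)"
  by (rule continuous_on_product_then_coordinatewise)

lemma continuous_on_coord2: "continuous_on S f \<Longrightarrow> continuous_on S (\<lambda>x. f x i l)"
  by (rule continuous_on_coord[OF continuous_on_coord])

lemma continuous_on_fun2I: "(\<And>i l. continuous_on S (\<lambda>x. f x i l)) \<Longrightarrow> continuous_on S f"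
  by (rule continuous_on_coordinatewise_then_product, rule continuous_on_coordinatewise_then_product)

definition lin_path :: "real \<Rightarrow> (nat \<Rightarrow> nat \<Rightarrow> 'a::real_normed_field) \<Rightarrow> (nat \<Rightarrow> nat \<Rightarrow> 'a) \<Rightarrow> nat \<Rightarrow> nat \<Rightarrow> 'a" where
  "lin_path t v w = (\<lambda>i l. of_real (1 - t) * v i l + of_real t * w i l)"

lemma lin_path_simps [simp]: "lin_path 0 v w = v" "lin_path 1 v w = w"
  by (auto simp: lin_path_def fun_eq_iff)

lemma lin_path_same: "v i = w i \<Longrightarrow> lin_path t v w i = w i"
  by (auto simp: lin_path_def fun_eq_iff algebra_simps simp flip: of_real_add)

lemma continuous_on_lin_path:
  assumes "continuous_on S a" "continuous_on S f" "continuous_on S g"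
  shows "continuous_on S (\<lambda>x. lin_path (a x) (f x) (g x))"
  unfolding lin_path_def
  by (intro continuous_on_fun2I continuous_intros assms(1) continuous_on_coord2[OF assms(2)]
      continuous_on_coord2[OF assms(3)])

section \<open>The standard symplectic form on F^2n and its frames\<close>

definition om :: "nat \<Rightarrow> (nat \<Rightarrow> 'a::comm_ring_1) \<Rightarrow> (nat \<Rightarrow> 'a) \<Rightarrow> 'a" where
  "om n x y = (\<Sum>l<n. x l * y (n + l) - x (n + l) * y l)"

lemma om_cong: "(\<And>l. l < 2 * n \<Longrightarrow> x l = x' l) \<Longrightarrow> (\<And>l. l < 2 * n \<Longrightarrow> y l = y' l) \<Longrightarrow> om n x y = om n x' y'"
  unfolding om_def by (intro sum.cong refl) simp

lemma om_linear:
  "om n (\<lambda>l. x l + y l) z = om n x z + om n y z" "om n z (\<lambda>l. x l + y l) = om n z x + om n z y"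
  "om n (\<lambda>l. x l - y l) z = om n x z - om n y z" "om n z (\<lambda>l. x l - y l) = om n z x - om n z y"
  "om n (\<lambda>l. - x l) z = - om n x z" "om n z (\<lambda>l. - x l) = - om n z x"
  "om n (\<lambda>l. c * x l) z = c * om n x z" "om n z (\<lambda>l. c * x l) = c * om n z x"
  by (simp_all add: om_def algebra_simps sum.distrib sum_subtractf sum_negf sum_distrib_left)

lemma om_sum_left: "finite S \<Longrightarrow> om n (\<lambda>l. \<Sum>s\<in>S. c s * x s l) z = (\<Sum>s\<in>S. c s * om n (x s) z)"
  by (induction S rule: finite_induct) (simp_all add: om_linear, simp add: om_def)
lemma om_sum_right: "finite S \<Longrightarrow> om n z (\<lambda>l. \<Sum>s\<in>S. c s * x s l) = (\<Sum>s\<in>S. c s * om n z (x s))"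
  by (induction S rule: finite_induct) (simp_all add: om_linear, simp add: om_def)

lemma om_antisym: "om n y x = - om n x y"
  by (simp add: om_def sum_negf[symmetric] algebra_simps)

lemma om_self [simp]: "om n x x = (0::'a::field_char_0)"
  by (simp add: om_def mult.commute)

lemma continuous_on_om:
  fixes f g :: "'b::topological_space \<Rightarrow> nat \<Rightarrow> 'a::real_normed_field"
  assumes "\<And>l. continuous_on S (\<lambda>z. f z l)" "\<And>l. continuous_on S (\<lambda>z. g z l)"
  shows "continuous_on S (\<lambda>z. om n (f z) (g z))"
  unfolding om_def by (intro continuous_intros assms)

text \<open>The Gram matrix of \<open>om\<close>, which makes the dimension bound for
  \<open>bform\<close> available for frames.\<close>

definition om_mat :: "nat \<Rightarrow> nat \<Rightarrow> nat \<Rightarrow> 'a::comm_ring_1" where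
  "om_mat n a b = (if b = n + a then 1 else if a = n + b then - 1 else 0)"

lemma om_bform: "om n x y = bform (2 * n) (om_mat n) x y"
proof (cases "n = 0")
  case False
  have 1: "(\<Sum>b<2 * n. x a * om_mat n a b * y b) = x a * y (n + a)" if "a < n" for a
  proof -
    have "(\<Sum>b<2 * n. x a * om_mat n a b * y b) = (\<Sum>b<2 * n. if b = n + a then x a * y b else 0)"
      using that by (intro sum.cong refl) (auto simp: om_mat_def)
    then show ?thesis using that by simp
  qed
  have 2: "(\<Sum>b<2 * n. x (n + a) * om_mat n (n + a) b * y b) = - (x (n + a) * y a)" if "a < n" for a
  proof -
    have "(\<Sum>b<2 * n. x (n + a) * om_mat n (n + a) b * y b)
        = (\<Sum>b<2 * n. if b = a then - (x (n + a) * y b) else 0)"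
      using that by (intro sum.cong refl) (auto simp: om_mat_def)
    then show ?thesis using that by simp
  qed
  show ?thesis
    unfolding bform_def sum_lessThan_double[of "\<lambda>a. \<Sum>b<2 * n. x a * om_mat n a b * y b"]
    by (simp add: 1 2 om_def sum_subtractf sum_negf)
qed (simp add: om_def bform_def)

type_synonym 'a frame = "(nat \<Rightarrow> nat \<Rightarrow> 'a) \<times> (nat \<Rightarrow> nat \<Rightarrow> 'a)"

text \<open>Only the vectors with index below \<open>r\<close>, and of these only the coordinates
  below \<open>2 * n\<close>, are constrained; all other values are free.\<close>

definition frames :: "nat \<Rightarrow> nat \<Rightarrow> 'a::real_normed_field frame set" where
  "frames n r = {(p, q). symp_family (om n) r p q}"

lemma frames_cong:
  assumes "(p, q) \<in> frames n r"
    and "\<And>s l. s < r \<Longrightarrow> l < 2 * n \<Longrightarrow> p' s l = p s l" "\<And>s l. s < r \<Longrightarrow> l < 2 * n \<Longrightarrow> q' s l = q s l"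
  shows "(p', q') \<in> frames n r"
proof -
  have "om n (p' s) (q' t) = om n (p s) (q t)" "om n (p' s) (p' t) = om n (p s) (p t)"
    "om n (q' s) (q' t) = om n (q s) (q t)" if "s < r" "t < r" for s t
    using that assms(2,3) by (auto intro!: om_cong)
  then show ?thesis using assms(1) by (auto simp: frames_def symp_family_def)
qed

lemma frames_om:
  assumes "(p, q) \<in> frames n r" "s < r" "t < r"
  shows "om n (p s) (q t) = (if s = t then 1 else 0)" "om n (p s) (p t) = 0" "om n (q s) (q t) = 0"
    "om n (q s) (p t) = - (if s = t then 1 else 0)"
  using assms om_antisym[of n "q s" "p t"] by (auto simp: frames_def symp_family_def)

lemma frames_bound: "(p, q) \<in> frames n r \<Longrightarrow> r \<le> n"
proof -
  assume "(p, q) \<in> frames n r"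
  then have "symp_family (bform (2 * n) (om_mat n)) r p q"
    by (simp add: frames_def symp_family_def om_bform)
  from symp_family_dim_bound[OF this] show ?thesis by (auto simp: om_mat_def)
qed

definition gram_set :: "nat \<Rightarrow> nat \<Rightarrow> (nat \<Rightarrow> nat \<Rightarrow> 'a) \<Rightarrow> (nat \<Rightarrow> nat \<Rightarrow> 'a::real_normed_field) set" where
  "gram_set k n B = {w. \<forall>i<k. \<forall>j<k. om n (w i) (w j) = B i j}"

text \<open>Combining the vectors of a tuple with the coefficients \<xi>, \<eta> gives a frame;
  conversely the expansion of the unit vectors of F^k in the pairs (\<xi>, \<eta>) prescribes a
  tuple built from a frame. Frame to tuple to frame is the identity on constrained values. Tuple to
  frame to tuple projects each vector onto the span of the frame, and this projection is undone
  along a segment.\<close>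

lemma gram_set_homotopy_equivalent_frames:
  fixes B :: "nat \<Rightarrow> nat \<Rightarrow> 'a::real_normed_field"
  assumes anti: "\<And>a b. a < k \<Longrightarrow> b < k \<Longrightarrow> B b a = - B a b"
    and red: "symp_reduction k B r \<xi> \<eta>"
  shows "top_of_set (gram_set k n B) homotopy_equivalent_space
    top_of_set (frames n r :: 'a frame set)"
proof -
  let ?f = "bform k B"
  let ?e = "\<lambda>a b. of_bool (b = a) :: 'a"
  have fam: "symp_family ?f r \<xi> \<eta>"
    and dec: "\<And>x y. ?f x y = (\<Sum>s<r. ?f x (\<eta> s) * ?f (\<xi> s) y - ?f x (\<xi> s) * ?f (\<eta> s) y)"
    using red unfolding symp_reduction_def by blast+
  define R where "R c w = (\<lambda>l. \<Sum>a<k. c a * w a l)" for c :: "nat \<Rightarrow> 'a" and w :: "nat \<Rightarrow> nat \<Rightarrow> 'a"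
  define f where "f w = ((\<lambda>s. R (\<xi> s) w), (\<lambda>s. R (\<eta> s) w))" for w
  \<comment> \<open>The unit vector \<open>?e a\<close> has, modulo the radical, the coefficient
    \<open>?f (?e a) (\<eta> s)\<close> at \<xi> s and minus \<open>?f (?e a) (\<xi> s)\<close> at
    \<eta> s.\<close>
  define g where "g P = (\<lambda>a l. (\<Sum>s<r. ?f (?e a) (\<eta> s) * fst P s l) - (\<Sum>s<r. ?f (?e a) (\<xi> s) * snd P s l))"
    for P :: "'a frame"
  have asym: "?f y x = - ?f x y" for x y by (rule bform_antisym) (rule anti)
  have R_om: "om n (R c w) (R d w) = ?f c d" if "w \<in> gram_set k n B" for c d w
  proof -
    have "om n (R c w) (R d w) = (\<Sum>a<k. c a * (\<Sum>b<k. d b * om n (w a) (w b)))"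
      unfolding R_def by (simp add: om_sum_left om_sum_right)
    also have "\<dots> = (\<Sum>a<k. c a * (\<Sum>b<k. d b * B a b))"
      using that by (intro sum.cong refl arg_cong2[where f = "(*)"]) (auto simp: gram_set_def)
    finally show ?thesis by (simp add: bform_def sum_distrib_left mult_ac)
  qed
  have R_e: "R (?e a) w = w a" if "a < k" for a w
    using that by (auto simp: R_def fun_eq_iff of_bool_def if_distrib[of "\<lambda>z. z * _"] cong: if_cong)
  have f_in: "f w \<in> frames n r" if "w \<in> gram_set k n B" for w
    using fam that by (auto simp: f_def frames_def symp_family_def R_om)
  have g_om: "om n (g (p, q) a) z = (\<Sum>s<r. ?f (?e a) (\<eta> s) * om n (p s) z - ?f (?e a) (\<xi> s) * om n (q s) z)" for p q a z
    unfolding g_def by (simp add: om_linear om_sum_left sum_subtractf)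
  have g_om': "om n z (g (p, q) a) = (\<Sum>s<r. ?f (?e a) (\<eta> s) * om n z (p s) - ?f (?e a) (\<xi> s) * om n z (q s))" for p q a z
    unfolding g_def by (simp add: om_linear om_sum_right sum_subtractf)
  have g_in: "g P \<in> gram_set k n B" if "P \<in> frames n r" for P
  proof -
    obtain p q where P: "P = (p, q)" by (cases P)
    note pq = frames_om[OF \<open>P \<in> frames n r\<close>[unfolded P]]
    have 1: "om n (p s) (g (p, q) b) = - ?f (?e b) (\<xi> s)" "om n (q s) (g (p, q) b) = - ?f (?e b) (\<eta> s)" if "s < r" for s b
      unfolding g_om' using that
      by (simp_all add: pq sum_negf if_distrib[of "\<lambda>z. _ * z"] if_distrib[of uminus] cong: if_cong)
    have "om n (g P a) (g P b) = B a b" if "a < k" "b < k" for a b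
    proof -
      have "om n (g P a) (g P b) = (\<Sum>s<r. ?f (?e a) (\<eta> s) * ?f (\<xi> s) (?e b) - ?f (?e a) (\<xi> s) * ?f (\<eta> s) (?e b))"
        unfolding P g_om by (intro sum.cong refl) (simp add: 1 asym[of "?e b"])
      also have "\<dots> = B a b" unfolding dec[symmetric] by (rule bform_unit[OF that])
      finally show ?thesis .
    qed
    then show ?thesis by (auto simp: gram_set_def)
  qed
  have gf_om: "om n (g (f w) a) (w b) = B a b" if "w \<in> gram_set k n B" "a < k" "b < k" for w a b
  proof -
    have "om n (g (f w) a) (R (?e b) w)
        = (\<Sum>s<r. ?f (?e a) (\<eta> s) * ?f (\<xi> s) (?e b) - ?f (?e a) (\<xi> s) * ?f (\<eta> s) (?e b))"
      unfolding f_def g_om by (simp add: R_om[OF that(1)])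
    also have "\<dots> = B a b" unfolding dec[symmetric] by (rule bform_unit[OF that(2,3)])
    finally show ?thesis by (simp add: R_e that)
  qed
  have fg_eq: "fst (f (g P)) s = fst P s" "snd (f (g P)) s = snd P s" if "P \<in> frames n r" "s < r" for P s
  proof -
    have R_f: "(\<Sum>a<k. c a * ?f (?e a) d) = ?f c d" for c d :: "nat \<Rightarrow> 'a"
    proof -
      have "?f (\<lambda>b. \<Sum>a<k. c a * ?e a b) d = (\<Sum>a<k. c a * ?f (?e a) d)"
        by (simp only: bform_sum_left bform_scale_left finite_lessThan)
      moreover have "?f (\<lambda>b. \<Sum>a<k. c a * ?e a b) d = ?f c d"
        unfolding bform_def
        by (intro sum.cong refl) (simp add: of_bool_def if_distrib[of "\<lambda>z. _ * z"] cong: if_cong)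
      ultimately show ?thesis by simp
    qed
    have R_g: "R c (g P) l = (\<Sum>s<r. ?f c (\<eta> s) * fst P s l) - (\<Sum>s<r. ?f c (\<xi> s) * snd P s l)" for c l
    proof -
      have "R c (g P) l = (\<Sum>a<k. \<Sum>s<r. c a * ?f (?e a) (\<eta> s) * fst P s l)
            - (\<Sum>a<k. \<Sum>s<r. c a * ?f (?e a) (\<xi> s) * snd P s l)"
        unfolding R_def g_def by (simp add: right_diff_distrib sum_subtractf sum_distrib_left mult.assoc)
      also have "\<dots> = (\<Sum>s<r. (\<Sum>a<k. c a * ?f (?e a) (\<eta> s)) * fst P s l)
            - (\<Sum>s<r. (\<Sum>a<k. c a * ?f (?e a) (\<xi> s)) * snd P s l)"
        unfolding sum_distrib_right
        by (intro arg_cong2[where f = "(-)"]; rule sum.swap)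
      finally show ?thesis by (simp only: R_f)
    qed
    have ff: "?f (\<xi> s) (\<eta> t) = (if s = t then 1 else 0)" "?f (\<xi> s) (\<xi> t) = 0" "?f (\<eta> s) (\<eta> t) = 0"
      "?f (\<eta> s) (\<xi> t) = - (if s = t then 1 else 0)" if "t < r" for t
      using fam that \<open>s < r\<close> asym[of "\<eta> s" "\<xi> t"] by (auto simp: symp_family_def)
    show "fst (f (g P)) s = fst P s" "snd (f (g P)) s = snd P s"
      using \<open>s < r\<close>
      by (auto simp: f_def fun_eq_iff R_g ff sum_negf if_distrib[of "\<lambda>z. z * _"] cong: if_cong)
  qed
  have f_cont: "continuous_on UNIV f"
    unfolding f_def R_def
    by (intro continuous_intros continuous_on_fun2I continuous_on_coord2[OF continuous_on_id])
  have g_cont: "continuous_on UNIV g"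
    unfolding g_def
    by (intro continuous_intros continuous_on_fun2I continuous_on_coord2[OF continuous_on_fst[OF continuous_on_id]]
        continuous_on_coord2[OF continuous_on_snd[OF continuous_on_id]])
  have fg_cont: "continuous_on UNIV (\<lambda>x. f (g x))" and gf_cont: "continuous_on UNIV (\<lambda>x. g (f x))"
    using continuous_on_compose2[OF f_cont g_cont] continuous_on_compose2[OF g_cont f_cont] by auto
  show ?thesis
  proof (rule homotopy_equivalent_setsI[where f = f and g = g and
      H = "\<lambda>t w. lin_path t (g (f w)) w"
      and K = "\<lambda>t P. (lin_path t (fst (f (g P))) (fst P), lin_path t (snd (f (g P))) (snd P))"])
    \<comment> \<open>Not only the two ends but also the mixed pairings have the value
      \<open>B i j\<close>, so along the segment the Gram matrix is B times ((1 - t) + t)^2 =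
      1.\<close>
    show "lin_path t (g (f w)) w \<in> gram_set k n B" if "w \<in> gram_set k n B" for t w
      unfolding gram_set_def
    proof (intro CollectI allI impI)
      fix i j assume ij: "i < k" "j < k"
      have eqs: "om n (w i) (w j) = B i j" "om n (g (f w) i) (g (f w) j) = B i j"
        "om n (g (f w) i) (w j) = B i j" "om n (w i) (g (f w) j) = B i j"
        using that g_in[OF f_in[OF that]] gf_om[OF that ij] gf_om[OF that ij(2,1)] ij anti[OF ij]
          om_antisym[of n "w i" "g (f w) j"] by (auto simp: gram_set_def)
      have "om n (lin_path t (g (f w)) w i) (lin_path t (g (f w)) w j)
         = (of_real (1 - t) * of_real (1 - t) + 2 * (of_real (1 - t) * of_real t) + of_real t * of_real t) * B i j"
        unfolding lin_path_def om_linear eqs by (simp only: distrib_left distrib_right) (simp add: algebra_simps)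
      also have "\<dots> = B i j" by (simp add: algebra_simps)
      finally show "om n (lin_path t (g (f w)) w i) (lin_path t (g (f w)) w j) = B i j" .
    qed
    show "(lin_path t (fst (f (g P))) (fst P), lin_path t (snd (f (g P))) (snd P)) \<in> frames n r"
      if "P \<in> frames n r" for t P
      by (rule frames_cong[of "fst P" "snd P"]) (use that in \<open>auto simp: lin_path_same fg_eq\<close>)
    show "continuous_on ({0..1::real} \<times> gram_set k n B) (\<lambda>z. lin_path (fst z) (g (f (snd z))) (snd z))"
      by (intro continuous_on_lin_path continuous_intros continuous_on_compose2[OF gf_cont]) auto
    show "continuous_on ({0..1::real} \<times> frames n r) (\<lambda>z. (lin_path (fst z) (fst (f (g (snd z)))) (fst (snd z)),
       lin_path (fst z) (snd (f (g (snd z)))) (snd (snd z))))"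
      by (intro continuous_on_lin_path continuous_intros continuous_on_compose2[OF fg_cont]) auto
  qed (use f_in g_in f_cont g_cont in \<open>auto intro: continuous_on_subset\<close>)
qed

section \<open>Unitary frames and path-connectedness\<close>

definition transvection :: "nat \<Rightarrow> 'a::comm_ring_1 \<Rightarrow> (nat \<Rightarrow> 'a) \<Rightarrow> (nat \<Rightarrow> 'a) \<Rightarrow> nat \<Rightarrow> 'a" where
  "transvection n c a x = (\<lambda>l. x l + c * om n a x * a l)"

lemma om_transvection:
  "om n (transvection n c a x) (transvection n c a y) = (om n x y :: 'a::field_char_0)"
proof -
  have "om n (transvection n c a x) (transvection n c a y)
     = om n x y + c * om n a y * om n x a + (c * om n a x * om n a y)"
    unfolding transvection_def om_linear by (simp add: algebra_simps)
  then show ?thesis by (simp add: om_antisym[of n x a] algebra_simps)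
qed

lemma transvection_fixes: "om n a x = 0 \<Longrightarrow> transvection n c a x = x"
  by (simp add: transvection_def)

text \<open>The path scales the coefficient \<open>c\<close> down to zero; all transvections on the
  way preserve \<open>om\<close>.\<close>

lemma transvection_frames:
  fixes p q :: "nat \<Rightarrow> nat \<Rightarrow> 'a::real_normed_field"
  assumes pq: "(p, q) \<in> frames n r"
  shows "path_component (frames n r) (p, q) (\<lambda>s. transvection n c a (p s), \<lambda>s. transvection n c a (q s))"
proof -
  define \<gamma> where "\<gamma> t = (\<lambda>s. transvection n (of_real t * c) a (p s), \<lambda>s. transvection n (of_real t * c) a (q s))" for t
  have "\<gamma> t \<in> frames n r" for t
    using pq by (auto simp: \<gamma>_def frames_def symp_family_def om_transvection)
  moreover have "continuous_on {0..1} \<gamma>"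
    unfolding \<gamma>_def transvection_def
    by (intro continuous_intros continuous_on_fun2I)
  moreover have "\<gamma> 0 = (p, q)" by (simp add: \<gamma>_def transvection_def)
  moreover have "\<gamma> 1 = (\<lambda>s. transvection n c a (p s), \<lambda>s. transvection n c a (q s))" by (simp add: \<gamma>_def)
  ultimately show ?thesis
    unfolding path_component_def path_def path_image_def pathstart_def pathfinish_def
    by (intro exI[of _ \<gamma>]) auto
qed

text \<open>Covers the identity of the reals and the conjugation of the complex numbers, so that the
  Gram-Schmidt process and the transitivity argument are carried out only once.\<close>

locale conj_field =
  fixes cj :: "'a::real_normed_field \<Rightarrow> 'a"
  assumes cj_add: "cj (x + y) = cj x + cj y"
    and cj_mult: "cj (x * y) = cj x * cj y"
    and cj_cj [simp]: "cj (cj x) = x"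
    and cj_of_real [simp]: "cj (of_real t) = of_real t"
    and cj_mult_self: "cj x * x = of_real ((norm x)\<^sup>2)"
    and cj_continuous: "continuous_on UNIV cj"
begin

lemma cj_0 [simp]: "cj 0 = 0" using cj_of_real[of 0] by simp
lemma cj_1 [simp]: "cj 1 = 1" using cj_of_real[of 1] by simp
lemma cj_minus: "cj (- x) = - cj x"
  using cj_add[of x "- x"] by (simp add: eq_neg_iff_add_eq_0 add.commute)
lemma cj_diff: "cj (x - y) = cj x - cj y"
  using cj_add[of x "- y"] by (simp add: cj_minus)
lemma cj_sum: "cj (sum f A) = (\<Sum>x\<in>A. cj (f x))"
  by (induction A rule: infinite_finite_induct) (simp_all add: cj_add)
lemma cj_divide_real: "cj (x / of_real t) = cj x / of_real t"
  unfolding divide_inverse of_real_inverse[symmetric] cj_mult cj_of_real ..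

lemma continuous_on_cj: "continuous_on S f \<Longrightarrow> continuous_on S (\<lambda>x. cj (f x))"
  by (rule continuous_on_compose2[OF cj_continuous]) auto

text \<open>Identify \<open>x\<close> with the vector of D(F)^n whose entry \<open>l\<close> is x_l
  + u x_(n+l), where u is the imaginary unit for F real and the quaternion j for F complex. Then
  \<open>J\<close> is right multiplication by u.\<close>

definition J :: "nat \<Rightarrow> (nat \<Rightarrow> 'a) \<Rightarrow> nat \<Rightarrow> 'a" where
  "J n x = (\<lambda>l. if l < n then - cj (x (n + l)) else cj (x (l - n)))"

definition herm :: "nat \<Rightarrow> (nat \<Rightarrow> 'a) \<Rightarrow> (nat \<Rightarrow> 'a) \<Rightarrow> 'a" where
  "herm n x y = (\<Sum>l<n. cj (x l) * y l + cj (x (n + l)) * y (n + l))"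

definition sqn :: "nat \<Rightarrow> (nat \<Rightarrow> 'a) \<Rightarrow> real" where
  "sqn n x = (\<Sum>l<n. (norm (x l))\<^sup>2 + (norm (x (n + l)))\<^sup>2)"

lemma om_J: "om n x (J n y) = herm n y x"
  by (simp add: om_def herm_def J_def algebra_simps)

lemma om_J_J: "om n (J n x) (J n y) = cj (om n x y)"
  by (simp add: om_def J_def cj_sum cj_diff cj_mult algebra_simps)

lemma herm_commute: "herm n y x = cj (herm n x y)"
  by (simp add: herm_def cj_sum cj_add cj_mult mult.commute)

lemma herm_self: "herm n x x = of_real (sqn n x)"
  by (simp add: herm_def sqn_def cj_mult_self)

lemma sqn_nonneg: "sqn n x \<ge> 0"
  unfolding sqn_def by (intro sum_nonneg) simp

lemma sqn_pos:
  assumes "om n x y \<noteq> 0"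
  shows "sqn n x > 0"
proof (rule ccontr)
  assume "\<not> ?thesis"
  then have "sqn n x = 0" using sqn_nonneg[of n x] by simp
  then have "x l = 0 \<and> x (n + l) = 0" if "l < n" for l
    using that unfolding sqn_def
    by (subst (asm) sum_nonneg_eq_0_iff) (auto simp: add_nonneg_eq_0_iff)
  then have "om n x y = 0" by (simp add: om_def)
  then show False using assms by simp
qed

lemma continuous_on_J:
  assumes "\<And>l. continuous_on S (\<lambda>z. f z l)"
  shows "continuous_on S (\<lambda>z. J n (f z) l)"
  unfolding J_def by (cases "l < n") (auto intro!: continuous_intros continuous_on_cj assms)

lemma continuous_on_sqn:
  assumes "\<And>l. continuous_on S (\<lambda>z. f z l)"
  shows "continuous_on S (\<lambda>z. sqn n (f z))"
  unfolding sqn_def by (intro continuous_intros assms)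

text \<open>These are the orthonormal frames of D(F)^n in coordinates over F: the D(F)-valued inner
  product has \<open>herm\<close> and \<open>om\<close> as its two components.\<close>

definition isotropic_frames :: "nat \<Rightarrow> nat \<Rightarrow> (nat \<Rightarrow> nat \<Rightarrow> 'a) set" where
  "isotropic_frames n r = {p. \<forall>s<r. \<forall>t<r. herm n (p s) (p t) = (if s = t then 1 else 0) \<and> om n (p s) (p t) = 0}"

text \<open>Passing from \<open>j\<close> to \<open>j + 1\<close> is one step of a Gram--Schmidt process, carried out along a homotopy.\<close>

definition partly_unitary :: "nat \<Rightarrow> nat \<Rightarrow> nat \<Rightarrow> 'a frame set" where
  "partly_unitary n r j = {(p, q) \<in> frames n r. \<forall>s<j. sqn n (p s) = 1 \<and> (\<forall>l<2 * n. q s l = J n (p s) l)}"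

text \<open>The new partner \<open>Q\<close> of \<open>p j\<close> need not be orthogonal to the
  other vectors. Subtracting multiples of \<open>p j\<close> corrects this, and it leaves their
  mutual pairings alone because they are all orthogonal to \<open>p j\<close>. Dividing
  \<open>p j\<close> by \<open>c\<close> is balanced by multiplying \<open>Q\<close> by
  \<open>c\<close>.\<close>

lemma frames_shear:
  fixes p q :: "nat \<Rightarrow> nat \<Rightarrow> 'a"
  assumes fam: "(p, q) \<in> frames n r" and j: "j < r" and Q: "om n (p j) Q = 1" and c: "c \<noteq> 0"
  shows "(\<lambda>s. if s = j then (\<lambda>l. p j l / c) else (\<lambda>l. p s l - om n (p s) Q * p j l),
    \<lambda>s. if s = j then (\<lambda>l. c * Q l) else (\<lambda>l. q s l - om n (q s) Q * p j l)) \<in> frames n r"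
proof -
  note f = frames_om[OF fam]
  have d: "(\<lambda>l. x l / c) = (\<lambda>l. inverse c * x l)" for x :: "nat \<Rightarrow> 'a"
    by (simp add: divide_inverse mult.commute)
  have Q': "om n Q (p j) = - 1" using Q om_antisym[of n Q "p j"] by simp
  have pQ: "om n Q x = - om n x Q" for x by (rule om_antisym)
  show ?thesis
    unfolding frames_def symp_family_def d
  proof (intro CollectI case_prodI allI impI)
    fix s t assume st: "s < r" "t < r"
    consider "s = j" "t = j" | "s = j" "t \<noteq> j" | "s \<noteq> j" "t = j" | "s \<noteq> j" "t \<noteq> j" by blast
    then show "om n (if s = j then \<lambda>l. inverse c * p j l else (\<lambda>l. p s l - om n (p s) Q * p j l))
          (if t = j then \<lambda>l. c * Q l else (\<lambda>l. q t l - om n (q t) Q * p j l)) = (if s = t then 1 else 0) \<and>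
        om n (if s = j then \<lambda>l. inverse c * p j l else (\<lambda>l. p s l - om n (p s) Q * p j l))
          (if t = j then \<lambda>l. inverse c * p j l else (\<lambda>l. p t l - om n (p t) Q * p j l)) = 0 \<and>
        om n (if s = j then \<lambda>l. c * Q l else (\<lambda>l. q s l - om n (q s) Q * p j l))
          (if t = j then \<lambda>l. c * Q l else (\<lambda>l. q t l - om n (q t) Q * p j l)) = 0"
    proof cases
      case 1
      then show ?thesis using c Q by (simp add: om_linear)
    next
      case 2
      then show ?thesis using c j st Q Q' by (simp add: om_linear f pQ)
    next
      case 3
      then show ?thesis using c j st Q Q' by (simp add: om_linear f pQ)
    next
      case 4
      then show ?thesis using j st by (simp add: om_linear f)
    qed
  qed
qed

lemma partly_unitary_step:
  assumes j: "j < r"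
  shows "top_of_set (partly_unitary n r j) homotopy_equivalent_space top_of_set (partly_unitary n r (Suc j))"
proof -
  define c where "c t P = (of_real ((1 - t) + t * sqrt (sqn n (fst P j))) :: 'a)"
    for t and P :: "'a frame"
  \<comment> \<open>The segment from \<open>q j\<close> to J (p j) / |p j|^2. Both ends pair to 1
    with \<open>p j\<close>, hence so does every point between them; the factor \<open>c\<close>
    meanwhile normalizes \<open>p j\<close>, so that time 1 yields the pair (p j / |p j|, J (p j /
    |p j|)).\<close>
  define Q where "Q t P = (\<lambda>l. of_real (1 - t) * snd P j l + of_real (t / sqn n (fst P j)) * J n (fst P j) l)"
    for t and P :: "'a frame"
  define H1 where "H1 t P = (\<lambda>s. if s = j then (\<lambda>l. fst P j l / c t P)
      else if s < r then (\<lambda>l. fst P s l - om n (fst P s) (Q t P) * fst P j l) else fst P s)" for t P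
  define H2 where "H2 t P = (\<lambda>s. if s = j then (\<lambda>l. c t P * Q t P l)
      else if s < r then (\<lambda>l. snd P s l - om n (snd P s) (Q t P) * fst P j l) else snd P s)" for t P
  note f = frames_om
  have pos: "sqn n (p j) > 0" if "(p, q) \<in> frames n r" for p q
    by (rule sqn_pos[of _ _ "q j"]) (use f[OF that j j] in simp)
  have om_Q: "om n x (Q t P) = of_real (1 - t) * om n x (snd P j)
      + of_real (t / sqn n (fst P j)) * om n x (J n (fst P j))" for x t P
    unfolding Q_def by (simp only: om_linear)
  have Qone: "om n (p j) (Q t (p, q)) = 1" if "(p, q) \<in> frames n r" for p q t
    using f(1)[OF that j j] pos[OF that]
    by (simp add: om_Q om_J herm_self)
  have cpos: "(1 - t) + t * sqrt (sqn n (p j)) > 0" if "(p, q) \<in> frames n r" "0 \<le> t" "t \<le> 1" for p q t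
    using pos[OF that(1)] that(2,3)
    by (cases "t = 1") (auto intro: add_pos_nonneg)
  have cnz: "c t (p, q) \<noteq> 0" if "(p, q) \<in> frames n r" "0 \<le> t" "t \<le> 1" for p q t
    using cpos[OF that] by (simp add: c_def del: of_real_add of_real_mult of_real_diff)
  have inF: "(H1 t (p, q), H2 t (p, q)) \<in> frames n r" if "(p, q) \<in> frames n r" "0 \<le> t" "t \<le> 1" for t p q
  by (rule frames_cong[OF frames_shear[OF that(1) j Qone[OF that(1), of t] cnz[OF that]]])
      (simp_all add: H1_def H2_def)
  \<comment> \<open>Pairs that are already unitary do not move. As \<open>q s\<close> is J (p s)
    there, orthogonality of \<open>p j\<close> to \<open>q s\<close> says that \<open>herm\<close>
    vanishes on (p s, p j), so \<open>p s\<close> is orthogonal to J (p j) as well; for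
    \<open>q s\<close> the same follows from \<open>om_J_J\<close>.\<close>
  have keep: "H1 t (p, q) s = p s" "H2 t (p, q) s = q s"
    if pq: "(p, q) \<in> partly_unitary n r j" and s: "s < j" for t p q s
  proof -
    have F: "(p, q) \<in> frames n r" and Jq: "\<And>l. l < 2 * n \<Longrightarrow> q s l = J n (p s) l"
      using pq s by (auto simp: partly_unitary_def)
    have sr: "s < r" using s j by simp
    have "om n (p j) (J n (p s)) = om n (p j) (q s)" using Jq by (auto intro: om_cong)
    then have "herm n (p s) (p j) = 0" using f(1)[OF F j sr] s by (simp add: om_J)
    then have "herm n (p j) (p s) = 0" by (simp add: herm_commute[of n "p j"])
    then have 1: "om n (p s) (Q t (p, q)) = 0"
      using f(1)[OF F sr j] s by (simp add: om_Q om_J)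
    have "om n (q s) (J n (p j)) = om n (J n (p s)) (J n (p j))" using Jq by (auto intro: om_cong)
    then have 2: "om n (q s) (Q t (p, q)) = 0"
      using f(2)[OF F sr j] f(3)[OF F sr j] by (simp add: om_Q om_J_J)
    show "H1 t (p, q) s = p s" "H2 t (p, q) s = q s"
      using s by (simp_all add: H1_def H2_def 1 2)
  qed
  have inU: "(H1 t (p, q), H2 t (p, q)) \<in> partly_unitary n r j"
    if "(p, q) \<in> partly_unitary n r j" "0 \<le> t" "t \<le> 1" for t p q
    using that keep[OF that(1)] inF[of p q t] by (auto simp: partly_unitary_def)
  have Suc_iff: "(p, q) \<in> partly_unitary n r (Suc j) \<longleftrightarrow>
     (p, q) \<in> partly_unitary n r j \<and> sqn n (p j) = 1 \<and> (\<forall>l<2 * n. q j l = J n (p j) l)" for p q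
    by (auto simp: partly_unitary_def less_Suc_eq)
  show ?thesis
  proof (rule weak_deformation_retract[where H = "\<lambda>t P. (H1 t P, H2 t P)"])
    show "partly_unitary n r (Suc j) \<subseteq> partly_unitary n r j"
      by (auto simp: partly_unitary_def)
    show "(H1 0 P, H2 0 P) = P" if "P \<in> partly_unitary n r j" for P
    proof -
      obtain p q where P: "P = (p, q)" by (cases P)
      have F: "(p, q) \<in> frames n r" using that by (auto simp: P partly_unitary_def)
      have c0: "c 0 P = 1" by (simp add: c_def)
      have Q0: "Q 0 P = q j" by (simp add: Q_def P)
      have "H1 0 P s = p s" "H2 0 P s = q s" for s
        using f[OF F _ j, of s] c0 Q0 by (auto simp: H1_def H2_def P)
      then show ?thesis by (simp add: P fun_eq_iff)
    qed
    show "(H1 1 P, H2 1 P) \<in> partly_unitary n r (Suc j)" if "P \<in> partly_unitary n r j" for P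
    proof -
      obtain p q where P: "P = (p, q)" by (cases P)
      let ?d = "sqn n (p j)"
      have F: "(p, q) \<in> frames n r" using that by (auto simp: P partly_unitary_def)
      have d: "?d > 0" by (rule pos[OF F])
      have "sqn n (H1 1 P j) = (\<Sum>l<n. ((norm (p j l))\<^sup>2 + (norm (p j (n + l)))\<^sup>2) / ?d)"
        using d unfolding sqn_def[of n "H1 1 P j"]
        by (intro sum.cong refl) (simp add: H1_def P c_def norm_divide power_divide add_divide_distrib)
      also have "\<dots> = ?d / ?d" by (simp only: sqn_def sum_divide_distrib)
      finally have 1: "sqn n (H1 1 P j) = 1" using d by simp
      have e: "sqrt ?d * inverse ?d = inverse (sqrt ?d)"
        using d by (simp add: field_simps)
      have "H2 1 P j l = J n (H1 1 P j) l" for l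
      proof -
        have "H2 1 P j l = of_real (sqrt ?d * inverse ?d) * J n (p j) l"
          by (simp add: H2_def P c_def Q_def divide_inverse)
        also have "\<dots> = J n (H1 1 P j) l"
          unfolding e by (simp add: J_def H1_def P c_def cj_divide_real mult.commute) (simp add: divide_inverse)
        finally show ?thesis .
      qed
      then show ?thesis using 1 inU[of p q 1] that by (simp add: P Suc_iff)
    qed
    show "(H1 t P, H2 t P) \<in> partly_unitary n r j" if "0 \<le> t" "t \<le> 1" "P \<in> partly_unitary n r j" for t P
      using inU that by (cases P) auto
    show "(H1 t P, H2 t P) \<in> partly_unitary n r (Suc j)" if t: "0 \<le> t" "t \<le> 1" and PS: "P \<in> partly_unitary n r (Suc j)" for t P
    proof -
      obtain p q where P: "P = (p, q)" by (cases P)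
      have S: "(p, q) \<in> partly_unitary n r j" "sqn n (p j) = 1" "\<And>l. l < 2 * n \<Longrightarrow> q j l = J n (p j) l"
        using PS by (auto simp: P Suc_iff)
      have c1: "c t (p, q) = 1" using S(2) by (simp add: c_def)
      have p: "H1 t P j = p j" by (simp add: H1_def c1 P)
      have q: "H2 t P j l = J n (p j) l" if "l < 2 * n" for l
        using S(3)[OF that] S(2) c1 by (simp add: H2_def P Q_def algebra_simps)
      show ?thesis using inU[OF S(1) t] p q S(2) by (simp add: P Suc_iff)
    qed
    show "continuous_on ({0..1::real} \<times> partly_unitary n r j) (\<lambda>z. (H1 (fst z) (snd z), H2 (fst z) (snd z)))"
    proof -
      let ?D = "{0..1::real} \<times> partly_unitary n r j"
      note ci = continuous_on_fst[OF continuous_on_snd[OF continuous_on_id]]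
        continuous_on_snd[OF continuous_on_snd[OF continuous_on_id]]
      have p: "continuous_on ?D (\<lambda>z. fst (snd z) s l)" for s l by (rule continuous_on_coord2[OF ci(1)])
      have q: "continuous_on ?D (\<lambda>z. snd (snd z) s l)" for s l by (rule continuous_on_coord2[OF ci(2)])
      have dnz: "sqn n (fst (snd z) j) \<noteq> 0" if "z \<in> ?D" for z
        using that pos[of "fst (snd z)" "snd (snd z)"] by (auto simp: partly_unitary_def)
      have cnz': False if "c t P = 0" "P \<in> partly_unitary n r j" "0 \<le> t" "t \<le> 1" for t P
        using that cnz[of "fst P" "snd P" t] by (auto simp: partly_unitary_def)
      have cc: "continuous_on ?D (\<lambda>z. c (fst z) (snd z))"
        unfolding c_def by (intro continuous_intros continuous_on_sqn p)
      have Qc: "continuous_on ?D (\<lambda>z. Q (fst z) (snd z) l)" for l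
        unfolding Q_def by (intro continuous_intros continuous_on_sqn continuous_on_J p q) (use dnz in auto)
      have 1: "continuous_on ?D (\<lambda>z. H1 (fst z) (snd z) s l)" for s l
        unfolding H1_def
        by (cases "s = j"; cases "s < r") (auto intro!: continuous_intros p cc continuous_on_om Qc dest: cnz')
      have 2: "continuous_on ?D (\<lambda>z. H2 (fst z) (snd z) s l)" for s l
        unfolding H2_def
        by (cases "s = j"; cases "s < r") (auto intro!: continuous_intros p q cc continuous_on_om Qc)
      show ?thesis by (intro continuous_intros continuous_on_fun2I 1 2)
    qed
  qed
qed

text \<open>On constrained coordinates \<open>q\<close> is determined by \<open>p\<close>, so
  forgetting \<open>q\<close> loses only free values, which a straight line adjusts. In the other
  direction, \<open>om_J\<close> and \<open>om_J_J\<close> turn the conditions on \<open>p\<close>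
  into those on (p, J p).\<close>

lemma partly_unitary_isotropic_frames:
  "top_of_set (partly_unitary n r r) homotopy_equivalent_space top_of_set (isotropic_frames n r)"
proof -
  define g where "g p = (p, \<lambda>s. J n (p s))" for p :: "nat \<Rightarrow> nat \<Rightarrow> 'a"
  have in1: "p \<in> isotropic_frames n r" if "(p, q) \<in> partly_unitary n r r" for p q
  proof -
    have F: "symp_family (om n) r p q" and Jq: "\<And>s l. s < r \<Longrightarrow> l < 2 * n \<Longrightarrow> q s l = J n (p s) l"
      using that by (auto simp: partly_unitary_def frames_def)
    have "herm n (p s) (p t) = om n (p t) (q s)" if "s < r" for s t
      unfolding om_J[symmetric] using Jq[OF that] by (auto intro: om_cong)
    then show ?thesis using F by (auto simp: isotropic_frames_def symp_family_def)
  qed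
  have in2: "g p \<in> partly_unitary n r r" if "p \<in> isotropic_frames n r" for p
  proof -
    have "sqn n (p s) = 1" if "s < r" for s
      using \<open>p \<in> _\<close> that herm_self[of n "p s"] by (auto simp: isotropic_frames_def)
    moreover have "herm n (p t) (J n (p s)) = 0" if "s < r" "t < r" for s t
      using \<open>p \<in> _\<close> that om_J_J[of n "p s" "p t"] by (simp add: om_J isotropic_frames_def)
    ultimately show ?thesis
      using that by (auto simp: g_def partly_unitary_def frames_def symp_family_def
          isotropic_frames_def om_J)
  qed
  have g_cont: "continuous_on UNIV g"
    unfolding g_def
    by (intro continuous_intros continuous_on_fun2I continuous_on_J continuous_on_coord2[OF continuous_on_id])
  have g1: "continuous_on UNIV (\<lambda>p. \<lambda>s. J n (p s))"
    by (intro continuous_intros continuous_on_fun2I continuous_on_J continuous_on_coord2[OF continuous_on_id])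
  show ?thesis
  proof (rule homotopy_equivalent_setsI[where f = fst and g = g
        and H = "\<lambda>t P. (fst P, lin_path t (\<lambda>s. J n (fst P s)) (snd P))" and K = "\<lambda>t p. p"])
    show "(fst P, lin_path t (\<lambda>s. J n (fst P s)) (snd P)) \<in> partly_unitary n r r"
      if "P \<in> partly_unitary n r r" for t P
    proof -
      obtain p q where P: "P = (p, q)" by (cases P)
      have Jq: "\<And>s l. s < r \<Longrightarrow> l < 2 * n \<Longrightarrow> J n (p s) l = q s l" and F: "(p, q) \<in> frames n r"
        using that by (auto simp: P partly_unitary_def)
      have eq: "lin_path t (\<lambda>s. J n (p s)) q s l = q s l" if "s < r" "l < 2 * n" for s l
        using Jq[OF that] by (simp add: lin_path_def algebra_simps)
      have "(p, lin_path t (\<lambda>s. J n (p s)) q) \<in> frames n r"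
        by (rule frames_cong[OF F]) (simp_all add: eq)
      then show ?thesis using that eq by (auto simp: P partly_unitary_def)
    qed
    show "continuous_on ({0..1::real} \<times> partly_unitary n r r)
       (\<lambda>z. (fst (snd z), lin_path (fst z) (\<lambda>s. J n (fst (snd z) s)) (snd (snd z))))"
      by (intro continuous_intros continuous_on_lin_path continuous_on_compose2[OF g1]) auto
    show "continuous_on (partly_unitary n r r) fst" by (rule continuous_on_fst[OF continuous_on_id])
    show "continuous_on ({0..1::real} \<times> isotropic_frames n r) (\<lambda>z. snd z)"
      by (rule continuous_on_snd[OF continuous_on_id])
    show "continuous_on (isotropic_frames n r) g" by (rule continuous_on_subset[OF g_cont]) simp
  qed (use in1 in2 in \<open>auto simp: g_def\<close>)
qed

lemma frames_homotopy_equivalent_isotropic_frames: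
  "top_of_set (frames n r :: 'a frame set)
     homotopy_equivalent_space top_of_set (isotropic_frames n r)"
proof -
  let ?F = "frames n r :: 'a frame set"
  have "top_of_set ?F homotopy_equivalent_space top_of_set (partly_unitary n r j)" if "j \<le> r" for j
    using that
  proof (induction j)
    case 0
    have "partly_unitary n r 0 = frames n r" by (auto simp: partly_unitary_def)
    then show ?case by (simp add: homotopy_equivalent_space_refl)
  next
    case (Suc j)
    then show ?case using partly_unitary_step[of j r n] homotopy_eqv_trans by auto
  qed
  then show ?thesis using partly_unitary_isotropic_frames homotopy_eqv_trans by blast
qed

end

section \<open>Transvections act transitively on symplectic frames\<close>

definition unit_vec_at :: "nat \<Rightarrow> nat \<Rightarrow> 'a::zero_neq_one" where
  "unit_vec_at s = (\<lambda>l. of_bool (l = s))"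

lemma om_unit_vec_at:
  assumes "s < n"
  shows "om n x (unit_vec_at s) = - (x (n + s) :: 'a::comm_ring_1)"
    and "om n x (unit_vec_at (n + s)) = (x s :: 'a)"
proof -
  have "om n x (unit_vec_at s) = (\<Sum>l<n. if l = s then - x (n + l) else 0)"
    unfolding om_def using assms by (intro sum.cong refl) (auto simp: unit_vec_at_def)
  then show "om n x (unit_vec_at s) = - x (n + s)" using assms by simp
  have "om n x (unit_vec_at (n + s)) = (\<Sum>l<n. if l = s then x l else 0)"
    unfolding om_def using assms by (intro sum.cong refl) (auto simp: unit_vec_at_def)
  then show "om n x (unit_vec_at (n + s)) = x s" using assms by simp
qed

definition std_frame :: "nat \<Rightarrow> (nat \<Rightarrow> nat \<Rightarrow> 'a::real_normed_field) \<times> (nat \<Rightarrow> nat \<Rightarrow> 'a)" where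
  "std_frame n = (unit_vec_at, \<lambda>s. unit_vec_at (n + s))"

lemma std_frame_in_frames: "r \<le> n \<Longrightarrow> std_frame n \<in> frames n r"
  by (auto simp: std_frame_def frames_def symp_family_def om_unit_vec_at)
    (auto simp: unit_vec_at_def)

text \<open>The orthogonal complement of the first \<open>j\<close> standard pairs: transvections
  along its vectors fix these pairs.\<close>

definition tail_space :: "nat \<Rightarrow> nat \<Rightarrow> (nat \<Rightarrow> 'a::zero) set" where
  "tail_space n j = {x. \<forall>s<j. x s = 0 \<and> x (n + s) = 0}"

definition moves :: "nat \<Rightarrow> ('a::comm_ring_1 \<times> (nat \<Rightarrow> 'a)) list \<Rightarrow> (nat \<Rightarrow> 'a) \<Rightarrow> nat \<Rightarrow> 'a" where
  "moves n as = foldr (\<lambda>(c, a). transvection n c a) as"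

lemma moves_simps [simp]:
  "moves n [] x = x" "moves n ((c, a) # as) x = transvection n c a (moves n as x)"
  by (simp_all add: moves_def)

lemma moves_append: "moves n (as @ bs) x = moves n as (moves n bs x)"
  by (simp add: moves_def)

lemma moves_fixes: "(\<And>c a. (c, a) \<in> set as \<Longrightarrow> om n a x = 0) \<Longrightarrow> moves n as x = x"
proof (induction as)
  case (Cons ca as)
  obtain c a where ca: "ca = (c, a)" by (cases ca)
  have "moves n as x = x" by (rule Cons.IH) (use Cons.prems in auto)
  moreover have "om n a x = 0" using Cons.prems[of c a] by (simp add: ca)
  ultimately show ?case by (simp add: ca transvection_fixes)
qed simp

lemma moves_frames:
  fixes p q :: "nat \<Rightarrow> nat \<Rightarrow> 'a::real_normed_field"
  assumes "(p, q) \<in> frames n r"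
  shows "path_component (frames n r) (p, q) (\<lambda>s. moves n as (p s), \<lambda>s. moves n as (q s))"
proof (induction as)
  case Nil
  then show ?case using assms by (simp add: path_component_refl)
next
  case (Cons ca as)
  obtain c a where ca: "ca = (c, a)" by (cases ca)
  have "(\<lambda>s. moves n as (p s), \<lambda>s. moves n as (q s)) \<in> frames n r"
    using Cons.IH path_component_mem(2) by blast
  from path_component_trans[OF Cons.IH transvection_frames[OF this, of c a]]
  show ?case by (simp add: ca)
qed

text \<open>As om (y - x) x = om y x, the transvection along y - x with the inverse of this number
  as coefficient adds exactly y - x to x.\<close>

lemma moves_along:
  fixes x y z :: "nat \<Rightarrow> 'a::field_char_0"
  assumes "om n y x \<noteq> 0"
  shows "moves n [(inverse (om n y x), \<lambda>l. y l - x l)] x = y"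
  using assms by (simp add: transvection_def om_linear)

context conj_field
begin

text \<open>One transvection suffices if \<open>x\<close> and \<open>y\<close> are not orthogonal;
  otherwise two do, through a vector orthogonal to neither. All directions stay in the tail space,
  so the part of a frame that is already standard is left in place.\<close>

lemma moves_transitive:
  assumes "x \<in> tail_space n j" "y \<in> tail_space n j" "sqn n x > 0" "sqn n y > 0" and j: "j \<le> n"
  shows "\<exists>as. moves n as x = y \<and> (\<forall>(c, a) \<in> set as. a \<in> tail_space n j)"
proof (cases "om n y x = 0")
  case False
  then show ?thesis using assms moves_along[OF False]
    by (intro exI[of _ "[(inverse (om n y x), \<lambda>l. y l - x l)]"]) (auto simp: tail_space_def simp del: moves_simps)
next
  case True
  have Jt: "J n v \<in> tail_space n j" if "v \<in> tail_space n j" for v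
    using that j by (auto simp: tail_space_def J_def)
  \<comment> \<open>The intermediate vector is J x if \<open>herm\<close> does not vanish on (x, y).
    Otherwise J x + J y works, its pairings with \<open>x\<close> and \<open>y\<close> being, up to
    sign, their squared lengths.\<close>
  have "\<exists>z. z \<in> tail_space n j \<and> om n z x \<noteq> 0 \<and> om n y z \<noteq> 0"
  proof (cases "herm n x y = 0")
    case False
    then show ?thesis
      using assms om_antisym[of n "J n x" x]
      by (intro exI[of _ "J n x"]) (auto simp: Jt om_J herm_self)
  next
    case 2: True
    then have "herm n y x = 0" by (simp add: herm_commute[of n y])
    then show ?thesis
      using assms 2 Jt[OF assms(1)] Jt[OF assms(2)] om_antisym[of n "\<lambda>l. J n x l + J n y l" x]
      by (intro exI[of _ "\<lambda>l. J n x l + J n y l"]) (auto simp: om_linear om_J herm_self tail_space_def)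
  qed
  then obtain z where z: "z \<in> tail_space n j" "om n z x \<noteq> 0" "om n y z \<noteq> 0" by blast
  let ?as = "[(inverse (om n y z), \<lambda>l. y l - z l)] @ [(inverse (om n z x), \<lambda>l. z l - x l)]"
  have "moves n ?as x = y" unfolding moves_append moves_along[OF z(2)] moves_along[OF z(3)] ..
  moreover have "\<forall>(c, a) \<in> set ?as. a \<in> tail_space n j" using z assms by (auto simp: tail_space_def)
  ultimately show ?thesis by blast
qed

text \<open>All directions can be taken orthogonal to \<open>e\<close>: differences of two partners
  of \<open>e\<close> are, and so is \<open>e\<close> itself. The moves therefore replace the
  partner of \<open>e\<close> while fixing \<open>e\<close>.\<close>

lemma moves_transitive_hyperbolic:
  fixes e :: "nat \<Rightarrow> 'a"
  assumes "x \<in> tail_space n j" "y \<in> tail_space n j" "e \<in> tail_space n j" "om n e x = 1" "om n e y = 1"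
  shows "\<exists>as. moves n as x = y \<and> (\<forall>(c, a) \<in> set as. a \<in> tail_space n j \<and> om n a e = 0)"
proof (cases "om n y x = 0")
  case False
  then show ?thesis using assms moves_along[OF False] om_antisym[of n x e] om_antisym[of n y e]
    by (intro exI[of _ "[(inverse (om n y x), \<lambda>l. y l - x l)]"])
      (auto simp: tail_space_def om_linear simp del: moves_simps)
next
  case True
  \<comment> \<open>Again a partner of \<open>e\<close>; it pairs to 1 with \<open>x\<close>, and
    \<open>y\<close> pairs to -1 with it because om y x = 0.\<close>
  let ?z = "\<lambda>l. e l + x l"
  have z: "om n ?z x \<noteq> 0" "om n y ?z \<noteq> 0"
    using assms True om_antisym[of n y e] by (auto simp: om_linear)
  let ?as = "[(inverse (om n y ?z), \<lambda>l. y l - ?z l)] @ [(inverse (om n ?z x), \<lambda>l. ?z l - x l)]"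
  have "moves n ?as x = y" unfolding moves_append moves_along[OF z(1)] moves_along[OF z(2)] ..
  moreover have "\<forall>(c, a) \<in> set ?as. a \<in> tail_space n j \<and> om n a e = 0"
    using assms om_antisym[of n y e] om_antisym[of n x e] by (auto simp: tail_space_def om_linear)
  ultimately show ?thesis by blast
qed

text \<open>Induction on the number of standard pairs. Orthogonality to these pairs puts the next
  \<open>p j\<close> and \<open>q j\<close> into the tail space; first \<open>p j\<close> is moved
  to its standard position, then \<open>q j\<close> by moves that fix the new
  \<open>p j\<close>.\<close>

lemma frames_path_to_std:
  assumes F: "(p, q) \<in> frames n r" and "j \<le> r"
  shows "\<exists>p' q'. path_component (frames n r) (p, q) (p', q') \<and>
    (\<forall>s<j. p' s = unit_vec_at s \<and> q' s = (unit_vec_at (n + s) :: nat \<Rightarrow> 'a))"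
  using assms(2)
proof (induction j)
  case 0
  then show ?case using path_component_refl[OF F] by blast
next
  case (Suc j)
  then obtain p1 q1 where c1: "path_component (frames n r) (p, q) (p1, q1)"
    and std: "\<And>s. s < j \<Longrightarrow> p1 s = unit_vec_at s" "\<And>s. s < j \<Longrightarrow> q1 s = unit_vec_at (n + s)" by force
  have F1: "(p1, q1) \<in> frames n r" using c1 path_component_mem(2) by blast
  have jr: "j < r" "j < n" using Suc.prems frames_bound[OF F] by auto
  let ?P = "unit_vec_at j :: nat \<Rightarrow> 'a" and ?Q = "unit_vec_at (n + j) :: nat \<Rightarrow> 'a"
  note f = frames_om[OF F1]
  have tails: "?P \<in> tail_space n j" "?Q \<in> tail_space n j"
    using jr by (auto simp: tail_space_def unit_vec_at_def)
  have PQ: "om n ?P ?Q = 1" using jr by (simp add: om_unit_vec_at) (simp add: unit_vec_at_def)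
  have tailI: "x \<in> tail_space n j" if "\<And>s. s < j \<Longrightarrow> om n x (p1 s) = 0" "\<And>s. s < j \<Longrightarrow> om n x (q1 s) = 0" for x
    using that jr by (auto simp: tail_space_def std om_unit_vec_at)
  have tail_std: "om n a (unit_vec_at s) = 0" "om n a (unit_vec_at (n + s)) = 0"
    if "a \<in> tail_space n j" "s < j" for a :: "nat \<Rightarrow> 'a" and s
    using that jr by (auto simp: tail_space_def om_unit_vec_at)
  have "p1 j \<in> tail_space n j" "sqn n (p1 j) > 0" "sqn n ?P > 0"
    using jr f PQ by (auto intro!: tailI sqn_pos[of n "p1 j" "q1 j"] sqn_pos[of n ?P ?Q])
  from moves_transitive[OF this(1) tails(1) this(2,3)] jr
  obtain as where as: "moves n as (p1 j) = ?P" "\<And>c a. (c, a) \<in> set as \<Longrightarrow> a \<in> tail_space n j" by fastforce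
  define p2 where "p2 = (\<lambda>s. moves n as (p1 s))"
  define q2 where "q2 = (\<lambda>s. moves n as (q1 s))"
  have c2: "path_component (frames n r) (p1, q1) (p2, q2)"
    unfolding p2_def q2_def by (rule moves_frames[OF F1])
  have F2: "(p2, q2) \<in> frames n r" using c2 path_component_mem(2) by blast
  have std2: "p2 s = unit_vec_at s" "q2 s = unit_vec_at (n + s)" if "s < j" for s
    using as(2) tail_std that by (auto simp: p2_def q2_def std intro!: moves_fixes)
  have f2: "om n (q2 j) (p2 s) = 0" "om n (q2 j) (q2 s) = 0" if "s < j" for s
    using F2 that jr om_antisym[of n "q2 j" "p2 s"] by (auto simp: frames_def symp_family_def)
  have q2: "q2 j \<in> tail_space n j"
    using f2 jr by (auto simp: tail_space_def std2 om_unit_vec_at)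
  have "om n ?P (q2 j) = 1"
    using F2 jr as(1) by (auto simp: frames_def symp_family_def p2_def)
  from moves_transitive_hyperbolic[OF q2 tails(2,1) this PQ]
  obtain bs where bs: "moves n bs (q2 j) = ?Q"
    "\<And>c a. (c, a) \<in> set bs \<Longrightarrow> a \<in> tail_space n j" "\<And>c a. (c, a) \<in> set bs \<Longrightarrow> om n a ?P = 0" by fastforce
  have c3: "path_component (frames n r) (p2, q2) (\<lambda>s. moves n bs (p2 s), \<lambda>s. moves n bs (q2 s))"
    by (rule moves_frames[OF F2])
  have "moves n bs (p2 s) = unit_vec_at s \<and> moves n bs (q2 s) = unit_vec_at (n + s)" if "s < Suc j" for s
  proof (cases "s = j")
    case True
    have "moves n bs ?P = ?P" using bs(3) by (rule moves_fixes)
    then show ?thesis using True as(1) bs(1) by (simp add: p2_def)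
  next
    case False
    then have "s < j" using that by simp
    then show ?thesis using bs(2) tail_std by (auto simp: std2 intro!: moves_fixes)
  qed
  moreover have "path_component (frames n r) (p, q) (\<lambda>s. moves n bs (p2 s), \<lambda>s. moves n bs (q2 s))"
    using path_component_trans[OF path_component_trans[OF c1 c2] c3] .
  ultimately show ?case by blast
qed

lemma path_connected_frames:
  "path_connected (frames n r :: 'a frame set)"
proof -
  have "path_component (frames n r) P (std_frame n)" if PF: "P \<in> frames n r" for P :: "'a frame"
  proof -
    obtain p q where P: "P = (p, q)" by (cases P)
    obtain p' q' where c: "path_component (frames n r) (p, q) (p', q')"
      and std: "\<And>s. s < r \<Longrightarrow> p' s = unit_vec_at s" "\<And>s. s < r \<Longrightarrow> q' s = unit_vec_at (n + s)"
      using frames_path_to_std[OF PF[unfolded P] order_refl] by blast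
    have F: "(p', q') \<in> frames n r" using c path_component_mem(2) by blast
    \<comment> \<open>The vectors with index from \<open>r\<close> on are unconstrained and can be
      brought to the standard frame along straight lines.\<close>
    define \<gamma> where "\<gamma> t = (lin_path t p' unit_vec_at, lin_path t q' (\<lambda>s. unit_vec_at (n + s)))" for t
    have "\<gamma> t \<in> frames n r" for t
      unfolding \<gamma>_def by (rule frames_cong[OF F]) (simp_all add: lin_path_same std)
    moreover have "continuous_on {0..1} \<gamma>"
      unfolding \<gamma>_def by (intro continuous_intros continuous_on_lin_path)
    ultimately have "path_component (frames n r) (p', q') (std_frame n)"
      unfolding path_component_def path_def path_image_def pathstart_def pathfinish_def
      by (intro exI[of _ \<gamma>]) (auto simp: \<gamma>_def std_frame_def)
    then show ?thesis using c path_component_trans by (simp add: P) blast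
  qed
  then show ?thesis
    unfolding path_connected_component by (meson path_component_sym path_component_trans)
qed

end

section \<open>Stiefel manifolds\<close>

lemma homotopy_equivalent_space_prod_left:
  assumes "X homotopy_equivalent_space X'"
  shows "prod_topology X Y homotopy_equivalent_space prod_topology X' Y"
proof -
  obtain f g where fg: "continuous_map X X' f" "continuous_map X' X g"
    "homotopic_with (\<lambda>x. True) X X (g \<circ> f) id" "homotopic_with (\<lambda>x. True) X' X' (f \<circ> g) id"
    using assms by (auto simp: homotopy_equivalent_space_def)
  have id: "homotopic_with (\<lambda>x. True) Y Y id id" by simp
  have "homotopic_with (\<lambda>x. True) (prod_topology X Y) (prod_topology X Y)
      (\<lambda>z. ((g \<circ> f) (fst z), id (snd z))) (\<lambda>z. (id (fst z), id (snd z)))"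
    by (rule homotopic_with_prod_topology[OF fg(3) id]) simp
  moreover have "homotopic_with (\<lambda>x. True) (prod_topology X' Y) (prod_topology X' Y)
      (\<lambda>z. ((f \<circ> g) (fst z), id (snd z))) (\<lambda>z. (id (fst z), id (snd z)))"
    by (rule homotopic_with_prod_topology[OF fg(4) id]) simp
  ultimately show ?thesis
    unfolding homotopy_equivalent_space_def
    using fg(1,2)
    by (intro exI[of _ "\<lambda>z. (f (fst z), snd z)"] exI[of _ "\<lambda>z. (g (fst z), snd z)"] conjI)
      (auto simp: o_def id_def intro!: continuous_intros continuous_map_compose[OF continuous_map_fst, unfolded o_def])
qed

text \<open>Each \<open>x\<close> is joined to g (f x) by the homotopy, and the points g (f x) are
  joined to each other by images of paths in \<open>Y\<close>.\<close>

lemma path_connected_space_homotopy_equivalent: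
  assumes XY: "X homotopy_equivalent_space Y" and Y: "path_connected_space Y"
  shows "path_connected_space X"
proof -
  obtain f g where f: "continuous_map X Y f" and g: "continuous_map Y X g"
    and h: "homotopic_with (\<lambda>x. True) X X (g \<circ> f) id"
    using XY by (auto simp: homotopy_equivalent_space_def)
  obtain k where k: "continuous_map (prod_topology (top_of_set {0..1::real}) X) X k"
    "\<And>x. k (0, x) = g (f x)" "\<And>x. k (1, x) = x"
    using h unfolding homotopic_with_def by auto
  have 1: "path_component_of X (g (f x)) x" if "x \<in> topspace X" for x
  proof -
    have "continuous_map (top_of_set {0..1::real}) X (k \<circ> (\<lambda>t. (t, x)))"
      by (rule continuous_map_compose[OF _ k(1)]) (use that in \<open>auto intro!: continuous_intros\<close>)
    then show ?thesis
      unfolding path_component_of_def pathin_def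
      by (intro exI[of _ "k \<circ> (\<lambda>t. (t, x))"]) (simp add: k)
  qed
  have 2: "path_component_of X (g (f x)) (g (f y))" if "x \<in> topspace X" "y \<in> topspace X" for x y
  proof -
    have "f x \<in> topspace Y" "f y \<in> topspace Y" using f that by (auto simp: continuous_map_def)
    then have "path_component_of Y (f x) (f y)"
      using Y by (simp add: path_connected_space_iff_path_component)
    then show ?thesis by (rule path_component_of_continuous_image[OF g])
  qed
  show ?thesis
    unfolding path_connected_space_iff_path_component
    using 1 2 by (meson path_component_of_sym path_component_of_trans)
qed

lemma continuous_map_fun2I:
  fixes f :: "'c \<Rightarrow> nat \<Rightarrow> nat \<Rightarrow> 'a::topological_space"
  assumes "\<And>i l. continuous_map X euclidean (\<lambda>x. f x i l)"
  shows "continuous_map X euclidean f"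
  unfolding euclidean_product_topology continuous_map_componentwise_UNIV
  using assms unfolding euclidean_product_topology[symmetric] by blast

text \<open>Read \<phi> a b as a + u b with u as for \<open>J\<close>. The hypothesis
  \<open>mult\<close> is the product of conj (a + u b) and c + u d; summed over the coordinates it
  yields \<open>herm\<close> in the first and \<open>om\<close> in the second component. The
  equivalence is no homeomorphism, because frames have free coordinates where elements of
  \<open>stiefel\<close> are fixed by extensionality.\<close>

lemma (in conj_field) isotropic_frames_homotopy_equivalent_stiefel:
  fixes \<phi> :: "'a \<Rightarrow> 'a \<Rightarrow> 'd::{ring_1, topological_space}" and \<psi> \<theta> :: "'d \<Rightarrow> 'a" and cjd :: "'d \<Rightarrow> 'd"
  assumes add: "\<And>a b c d. \<phi> (a + c) (b + d) = \<phi> a b + \<phi> c d"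
    and mult: "\<And>a b c d. cjd (\<phi> a b) * \<phi> c d = \<phi> (cj a * c + cj b * d) (a * d - b * c)"
    and one: "\<phi> 1 0 = 1" and inv: "\<And>a b. \<psi> (\<phi> a b) = a" "\<And>a b. \<theta> (\<phi> a b) = b" "\<And>v. \<phi> (\<psi> v) (\<theta> v) = v"
    and cont: "continuous_on UNIV (\<lambda>z. \<phi> (fst z) (snd z))" "continuous_on UNIV \<psi>" "continuous_on UNIV \<theta>"
  shows "top_of_set (isotropic_frames n r) homotopy_equivalent_space stiefel cjd r n"
proof -
  define f where "f p = (\<lambda>s\<in>{..<r}. \<lambda>l\<in>{..<n}. \<phi> (p s l) (p s (n + l)))" for p :: "nat \<Rightarrow> nat \<Rightarrow> 'a"
  define g where "g v = (\<lambda>s l. if s < r \<and> l < 2 * n then (if l < n then \<psi> (v s l) else \<theta> (v s (l - n))) else 0)"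
    for v :: "nat \<Rightarrow> nat \<Rightarrow> 'd"
  let ?P = "product_topology (\<lambda>_. product_topology (\<lambda>_. euclidean :: 'd topology) {..<n}) {..<r}"
  have zero: "\<phi> 0 0 = 0" using add[of 0 0 0 0] by simp
  have sum: "\<phi> (sum a S) (sum b S) = (\<Sum>l\<in>S. \<phi> (a l) (b l))" for a b and S :: "nat set"
    by (induction S rule: infinite_finite_induct) (simp_all add: add zero)
  have gram: "(\<Sum>l<n. cjd (\<phi> (x l) (x (n + l))) * \<phi> (y l) (y (n + l))) = \<phi> (herm n x y) (om n x y)" for x y
    unfolding herm_def om_def sum by (simp add: mult)
  have phi_eq: "\<phi> a b = \<phi> c d \<longleftrightarrow> a = c \<and> b = d" for a b c d using inv by metis
  have phi_delta: "\<phi> a b = (if P then 1 else 0) \<longleftrightarrow> a = (if P then 1 else 0) \<and> b = 0" for a b P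
    using phi_eq[of a b 1 0] phi_eq[of a b 0 0] by (simp add: one zero)
  have in_stiefel: "v \<in> topspace (stiefel cjd r n) \<longleftrightarrow> v \<in> topspace ?P \<and>
      (\<forall>i<r. \<forall>j<r. (\<Sum>l<n. cjd (v i l) * v j l) = (if i = j then 1 else 0))" for v
    by (simp add: stiefel_def)
  have f_in: "f p \<in> topspace (stiefel cjd r n)" if "p \<in> isotropic_frames n r" for p
    unfolding in_stiefel
  proof (intro conjI allI impI)
    show "f p \<in> topspace ?P" by (simp add: f_def PiE_iff extensional_def)
    fix i j assume ij: "i < r" "j < r"
    have "(\<Sum>l<n. cjd (f p i l) * f p j l) = (\<Sum>l<n. cjd (\<phi> (p i l) (p i (n + l))) * \<phi> (p j l) (p j (n + l)))"
      using ij by (intro sum.cong refl) (simp add: f_def)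
    then show "(\<Sum>l<n. cjd (f p i l) * f p j l) = (if i = j then 1 else 0)"
      using that ij by (simp add: gram phi_delta isotropic_frames_def del: if_split)
  qed
  have fg: "f (g v) = v" if "v \<in> topspace ?P" for v
  proof (intro ext)
    fix s l show "f (g v) s l = v s l"
      using that by (auto simp: f_def g_def inv PiE_iff extensional_def restrict_def)
  qed
  have gf: "g (f p) s l = p s l" if "s < r" "l < 2 * n" for p s l
    using that by (cases "l < n") (auto simp: g_def f_def inv less_diff_conv2)
  have g_in: "g v \<in> isotropic_frames n r" if v: "v \<in> topspace (stiefel cjd r n)" for v
    unfolding isotropic_frames_def
  proof (intro CollectI allI impI)
    fix i j assume ij: "i < r" "j < r"
    have vi: "v s l = \<phi> (g v s l) (g v s (n + l))" if "s < r" "l < n" for s l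
      using that by (simp add: g_def inv)
    have "(if i = j then 1 else 0) = (\<Sum>l<n. cjd (v i l) * v j l)" using v ij by (simp add: in_stiefel)
    also have "\<dots> = \<phi> (herm n (g v i) (g v j)) (om n (g v i) (g v j))"
      unfolding gram[symmetric] using ij vi by (intro sum.cong refl) simp
    finally show "herm n (g v i) (g v j) = (if i = j then 1 else 0) \<and> om n (g v i) (g v j) = 0"
      using phi_delta by metis
  qed
  have f_cont: "continuous_map euclidean ?P f"
    unfolding continuous_map_componentwise
  proof (intro conjI ballI)
    fix s l assume "s \<in> {..<r}" "l \<in> {..<n}"
    then show "continuous_map euclidean euclidean (\<lambda>p. f p s l)"
      by (auto simp: f_def intro!: continuous_on_compose2[OF cont(1), of _ "\<lambda>p. (p s l, p s (n + l))", simplified]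
          continuous_intros continuous_on_coord2[OF continuous_on_id])
  qed (auto simp: f_def extensional_def)
  have g_cont: "continuous_map ?P euclidean g"
  proof (rule continuous_map_fun2I)
    fix s l
    have pr: "continuous_map ?P euclidean (\<lambda>v. v s m)" if "s < r" "m < n" for m
      using continuous_map_compose[OF continuous_map_product_projection[of s "{..<r}" "\<lambda>_. product_topology (\<lambda>_. euclidean :: 'd topology) {..<n}"]
          continuous_map_product_projection[of m "{..<n}" "\<lambda>_. euclidean :: 'd topology"]] that by (simp add: o_def)
    have c: "continuous_map euclidean euclidean \<psi>" "continuous_map euclidean euclidean \<theta>"
      using cont by auto
    show "continuous_map ?P euclidean (\<lambda>v. g v s l)"
      using continuous_map_compose[OF pr c(1), of l] continuous_map_compose[OF pr c(2), of "l - n"]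
      by (cases "s < r \<and> l < 2 * n"; cases "l < n") (auto simp: g_def o_def)
  qed
  show ?thesis
  proof (rule homotopy_equivalent_spaceI[where f = f and g = g
        and H = "\<lambda>z. lin_path (fst z) (g (f (snd z))) (snd z)" and K = snd])
    show "continuous_map (top_of_set (isotropic_frames n r)) (stiefel cjd r n) f"
      using continuous_map_from_subtopology[OF f_cont] f_in
      by (auto simp: stiefel_def continuous_map_in_subtopology)
    show "continuous_map (stiefel cjd r n) (top_of_set (isotropic_frames n r)) g"
      using continuous_map_from_subtopology[OF g_cont] g_in
      by (auto simp: stiefel_def continuous_map_in_subtopology)
    have gf_cont: "continuous_on UNIV (\<lambda>p. g (f p))"
      using continuous_map_compose[OF f_cont g_cont] by (simp add: o_def)
    have lp: "lin_path t (g (f p)) p \<in> isotropic_frames n r" if "p \<in> isotropic_frames n r" for t p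
    proof -
      have eq: "lin_path t (g (f p)) p s l = p s l" if "s < r" "l < 2 * n" for s l
        using gf[OF that] by (simp add: lin_path_def algebra_simps)
      have "om n (lin_path t (g (f p)) p s) (lin_path t (g (f p)) p t') = om n (p s) (p t')"
        "herm n (lin_path t (g (f p)) p s) (lin_path t (g (f p)) p t') = herm n (p s) (p t')"
        if "s < r" "t' < r" for s t'
        using that by (auto simp: eq herm_def intro!: om_cong)
      then show ?thesis using that by (simp add: isotropic_frames_def)
    qed
    have "continuous_on ({0..1::real} \<times> isotropic_frames n r) (\<lambda>z. lin_path (fst z) (g (f (snd z))) (snd z))"
      by (intro continuous_on_lin_path continuous_on_compose2[OF gf_cont]
          continuous_on_fst continuous_on_snd continuous_on_id) auto
    then show "continuous_map (prod_topology (top_of_set {0..1}) (top_of_set (isotropic_frames n r)))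
        (top_of_set (isotropic_frames n r)) (\<lambda>z. lin_path (fst z) (g (f (snd z))) (snd z))"
      using lp by (auto simp: continuous_map_in_subtopology)
  qed (use fg in \<open>auto simp: in_stiefel continuous_map_snd\<close>)
qed

section \<open>The two cases: frames over the complex numbers and over the quaternions\<close>

interpretation real_conj: conj_field "id :: real \<Rightarrow> real"
  by unfold_locales (auto simp: power2_eq_square id_def)

interpretation complex_conj: conj_field cnj
  by unfold_locales (auto simp: complex_norm_square mult.commute simp del: of_real_power intro!: continuous_intros)

lemma real_isotropic_frames_stiefel:
  "top_of_set (real_conj.isotropic_frames n r) homotopy_equivalent_space stiefel cnj r n"
proof (rule real_conj.isotropic_frames_homotopy_equivalent_stiefel[where \<phi> = Complex and \<psi> = Re and \<theta> = Im])
  show "continuous_on UNIV (\<lambda>z. Complex (fst z) (snd z))"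
    unfolding Complex_eq by (intro continuous_intros)
  show "continuous_on UNIV Re" by (intro continuous_intros)
  show "continuous_on UNIV Im" by (intro continuous_intros)
qed (simp_all add: complex_eq_iff)

lemma bounded_linear_quat_sel:
  "bounded_linear qre" "bounded_linear qi" "bounded_linear qj" "bounded_linear qk"
proof -
  have le: "\<bar>a\<bar> \<le> norm x" if "a\<^sup>2 \<le> inner x x" for a and x :: quat
    using that by (metis norm_quat_def real_sqrt_abs real_sqrt_le_iff)
  have *: "norm (qre x) \<le> norm x * 1" "norm (qi x) \<le> norm x * 1" "norm (qj x) \<le> norm x * 1" "norm (qk x) \<le> norm x * 1" for x
    by (auto intro!: le simp: inner_quat_def power2_eq_square)
  show "bounded_linear qre" "bounded_linear qi" "bounded_linear qj" "bounded_linear qk"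
    by (rule bounded_linear_intro[where K = 1]; simp add: *[simplified])+
qed

lemmas continuous_on_quat_sel =
  bounded_linear_quat_sel[THEN bounded_linear.continuous_on]

text \<open>The quaternion \<open>a + j b\<close>.\<close>

definition quat_of_complex_pair :: "complex \<Rightarrow> complex \<Rightarrow> quat" where
  "quat_of_complex_pair a b = Quat (Re a) (Im a) (Re b) (- Im b)"

lemma complex_isotropic_frames_stiefel:
  "top_of_set (complex_conj.isotropic_frames n r) homotopy_equivalent_space stiefel qcnj r n"
proof (rule complex_conj.isotropic_frames_homotopy_equivalent_stiefel[where \<phi> = quat_of_complex_pair
      and \<psi> = "\<lambda>v. Complex (qre v) (qi v)" and \<theta> = "\<lambda>v. Complex (qj v) (- qk v)"])
  \<comment> \<open>Written with real coefficients and fixed quaternions, the map is visibly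
    continuous.\<close>
  have "quat_of_complex_pair a b = Re a *\<^sub>R 1 + Im a *\<^sub>R Quat 0 1 0 0 + Re b *\<^sub>R Quat 0 0 1 0
      - Im b *\<^sub>R Quat 0 0 0 1" for a b
    by (simp add: quat_eq_iff quat_of_complex_pair_def)
  then show "continuous_on UNIV (\<lambda>z. quat_of_complex_pair (fst z) (snd z))"
    by (auto intro!: continuous_intros)
  show "continuous_on UNIV (\<lambda>v. Complex (qre v) (qi v))" "continuous_on UNIV (\<lambda>v. Complex (qj v) (- qk v))"
    unfolding Complex_eq by (intro continuous_intros continuous_on_quat_sel continuous_on_id)+
qed (auto simp: quat_of_complex_pair_def quat_eq_iff complex_eq_iff qcnj_def algebra_simps)

section \<open>Homomorphisms from a free abelian group\<close>

text \<open>The factors are multiplied in the order of their indices, which makes the word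
  meaningful before the tuple is known to commute; for commuting tuples it is additive in the
  exponents.\<close>

primrec tuple_word :: "('g, 'h) monoid_scheme \<Rightarrow> (nat \<Rightarrow> 'g) \<Rightarrow> nat \<Rightarrow> (nat \<Rightarrow> int) \<Rightarrow> 'g" where
  "tuple_word G g 0 x = \<one>\<^bsub>G\<^esub>"
| "tuple_word G g (Suc i) x = tuple_word G g i x \<otimes>\<^bsub>G\<^esub> g i [^]\<^bsub>G\<^esub> x i"

lemma tuple_word_cong:
  "(\<And>j. j < N \<Longrightarrow> g j = g' j) \<Longrightarrow> (\<And>j. j < N \<Longrightarrow> x j = y j) \<Longrightarrow> tuple_word G g N x = tuple_word G g' N y"
  by (induction N) auto

context group
begin

lemma int_pow_commute:
  assumes "x \<otimes> y = y \<otimes> x" "x \<in> carrier G" "y \<in> carrier G"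
  shows "x \<otimes> y [^] (i::int) = y [^] i \<otimes> x"
proof (cases i rule: int_cases2)
  case (nonneg n)
  then show ?thesis using group_commutes_pow[of y x n] assms by (simp add: int_pow_int)
next
  case (nonpos n)
  have c: "x \<otimes> y [^] n = y [^] n \<otimes> x" using group_commutes_pow[of y x n] assms by simp
  have cl: "y [^] n \<in> carrier G" using assms by simp
  have "inv (y [^] n) \<otimes> x = inv (y [^] n) \<otimes> (x \<otimes> y [^] n) \<otimes> inv (y [^] n)"
    using assms cl by (simp add: m_assoc)
  also have "\<dots> = inv (y [^] n) \<otimes> (y [^] n \<otimes> x) \<otimes> inv (y [^] n)" by (simp only: c)
  also have "\<dots> = inv (y [^] n) \<otimes> y [^] n \<otimes> x \<otimes> inv (y [^] n)"
    using assms cl by (simp only: m_assoc inv_closed m_closed)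
  also have "\<dots> = x \<otimes> inv (y [^] n)" using assms cl by simp
  finally have "inv (y [^] n) \<otimes> x = x \<otimes> inv (y [^] n)" .
  then show ?thesis using assms by (simp add: nonpos int_pow_neg_int)
qed

lemma tuple_word_closed: "(\<And>i. i < N \<Longrightarrow> g i \<in> carrier G) \<Longrightarrow> tuple_word G g N x \<in> carrier G"
  by (induction N) auto

lemma tuple_word_commute:
  assumes "\<And>i. i < N \<Longrightarrow> g i \<in> carrier G" "\<And>i. i < N \<Longrightarrow> h \<otimes> g i = g i \<otimes> h" "h \<in> carrier G"
  shows "h \<otimes> tuple_word G g N x = tuple_word G g N x \<otimes> h"
  using assms
proof (induction N)
  case (Suc N)
  have IH: "h \<otimes> tuple_word G g N x = tuple_word G g N x \<otimes> h" using Suc by simp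
  have w: "tuple_word G g N x \<in> carrier G" using Suc.prems by (intro tuple_word_closed) simp
  have gN: "g N \<in> carrier G" and c: "h \<otimes> g N [^] x N = g N [^] x N \<otimes> h"
    using Suc.prems int_pow_commute[of h "g N"] by auto
  have "h \<otimes> (tuple_word G g N x \<otimes> g N [^] x N) = tuple_word G g N x \<otimes> (h \<otimes> g N [^] x N)"
    using w gN Suc.prems(3) by (simp add: m_assoc[symmetric] IH)
  also have "\<dots> = tuple_word G g N x \<otimes> g N [^] x N \<otimes> h"
    using w gN Suc.prems(3) by (simp add: c m_assoc)
  finally show ?case by simp
qed simp

lemma tuple_word_add:
  assumes "\<And>i. i < N \<Longrightarrow> g i \<in> carrier G"
    and "\<And>i j. i < N \<Longrightarrow> j < N \<Longrightarrow> g i \<otimes> g j = g j \<otimes> g i"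
  shows "tuple_word G g N (\<lambda>i. x i + y i) = tuple_word G g N x \<otimes> tuple_word G g N y"
  using assms
proof (induction N)
  case (Suc N)
  have cl: "g N \<in> carrier G" "tuple_word G g N x \<in> carrier G" "tuple_word G g N y \<in> carrier G"
    using Suc.prems by (auto intro: tuple_word_closed)
  have c: "tuple_word G g N y \<otimes> g N [^] x N = g N [^] x N \<otimes> tuple_word G g N y"
    using Suc.prems cl by (intro int_pow_commute tuple_word_commute[symmetric]) auto
  have "tuple_word G g (Suc N) (\<lambda>i. x i + y i)
      = tuple_word G g N x \<otimes> tuple_word G g N y \<otimes> (g N [^] x N \<otimes> g N [^] y N)"
    using Suc cl by (simp add: int_pow_mult)
  also have "\<dots> = tuple_word G g N x \<otimes> (tuple_word G g N y \<otimes> g N [^] x N) \<otimes> g N [^] y N"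
    using cl by (simp add: m_assoc)
  also have "\<dots> = tuple_word G g (Suc N) x \<otimes> tuple_word G g (Suc N) y"
    unfolding c using cl by (simp add: m_assoc)
  finally show ?case .
qed simp

lemma tuple_word_unit:
  assumes "\<And>i. i < N \<Longrightarrow> g i \<in> carrier G"
  shows "tuple_word G g N (\<lambda>j. if j = i then 1 else 0) = (if i < N then g i else \<one>)"
  using assms by (induction N) (auto simp: less_Suc_eq tuple_word_closed)

end

lemma carrier_int_power_group: "carrier (int_power_group k) = {..<k} \<rightarrow>\<^sub>E UNIV"
  by (simp add: int_power_group_def)

lemma mult_int_power_group: "x \<otimes>\<^bsub>int_power_group k\<^esub> y = (\<lambda>i\<in>{..<k}. x i + y i)"
  by (simp add: int_power_group_def)

lemma std_gen_carrier: "std_gen k i \<in> carrier (int_power_group k)"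
  by (simp add: std_gen_def carrier_int_power_group)

definition hom_of_tuple :: "nat \<Rightarrow> ('g, 'h) monoid_scheme \<Rightarrow> (nat \<Rightarrow> 'g) \<Rightarrow> (nat \<Rightarrow> int) \<Rightarrow> 'g" where
  "hom_of_tuple k G g = (\<lambda>x\<in>carrier (int_power_group k). tuple_word G g k x)"

lemma (in group) hom_of_tuple:
  assumes "\<And>i. i < k \<Longrightarrow> g i \<in> carrier G"
    and "\<And>i j. i < k \<Longrightarrow> j < k \<Longrightarrow> g i \<otimes> g j = g j \<otimes> g i"
  shows "hom_of_tuple k G g \<in> hom (int_power_group k) G \<inter> extensional (carrier (int_power_group k))"
    and "i < k \<Longrightarrow> hom_of_tuple k G g (std_gen k i) = g i"
proof -
  have m: "x \<otimes>\<^bsub>int_power_group k\<^esub> y \<in> carrier (int_power_group k)" for x y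
    by (simp add: mult_int_power_group carrier_int_power_group)
  have "tuple_word G g k (\<lambda>i\<in>{..<k}. x i + y i) = tuple_word G g k x \<otimes> tuple_word G g k y" for x y
  proof -
    have "tuple_word G g k (\<lambda>i\<in>{..<k}. x i + y i) = tuple_word G g k (\<lambda>i. x i + y i)"
      by (rule tuple_word_cong) auto
    also have "\<dots> = tuple_word G g k x \<otimes> tuple_word G g k y"
      by (rule tuple_word_add) (use assms in auto)
    finally show ?thesis .
  qed
  then show "hom_of_tuple k G g \<in> hom (int_power_group k) G \<inter> extensional (carrier (int_power_group k))"
    using m tuple_word_closed[of k g] assms(1)
    by (auto simp: hom_def hom_of_tuple_def mult_int_power_group)
  show "hom_of_tuple k G g (std_gen k i) = g i" if "i < k"
  proof -
    have "tuple_word G g k (std_gen k i) = tuple_word G g k (\<lambda>j. if j = i then 1 else 0)"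
      by (rule tuple_word_cong) (auto simp: std_gen_def)
    then show ?thesis
      using tuple_word_unit[of k g i] assms(1) that std_gen_carrier[of k i]
      by (simp add: hom_of_tuple_def)
  qed
qed

text \<open>Induction on the number of coordinates of \<open>x\<close> that are kept, the others
  being replaced by 0.\<close>

lemma (in group) hom_int_power_group_eq_tuple_word:
  assumes h: "\<rho> \<in> hom (int_power_group k) G" and x: "x \<in> carrier (int_power_group k)"
  shows "\<rho> x = tuple_word G (\<lambda>i. \<rho> (std_gen k i)) k x"
proof -
  let ?Z = "int_power_group k"
  have cl: "\<rho> v \<in> carrier G" if "v \<in> carrier ?Z" for v using h that by (auto simp: hom_def)
  have mul: "\<rho> (\<lambda>i\<in>{..<k}. v i + w i) = \<rho> v \<otimes> \<rho> w" if "v \<in> carrier ?Z" "w \<in> carrier ?Z" for v w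
    using h that by (auto simp: hom_def mult_int_power_group)
  have Zc: "(\<lambda>i\<in>{..<k}. f i) \<in> carrier ?Z" for f by (simp add: carrier_int_power_group)
  \<comment> \<open>The inclusion of the N-th coordinate axis. Composed with \<rho> it is a
    homomorphism on the integers, hence a power of the image of 1, which is the N-th
    generator.\<close>
  define \<iota> where "\<iota> N z = (\<lambda>j\<in>{..<k}. if j = N then z else 0)" for N and z :: int
  have pow: "\<rho> (\<iota> N z) = \<rho> (std_gen k N) [^] z" for N z
  proof -
    have "(\<lambda>z. \<rho> (\<iota> N z)) \<in> hom integer_group G"
    proof (rule homI)
      fix a b :: int
      have "\<iota> N (a + b) = (\<lambda>i\<in>{..<k}. \<iota> N a i + \<iota> N b i)" by (auto simp: \<iota>_def)
      then show "\<rho> (\<iota> N (a \<otimes>\<^bsub>integer_group\<^esub> b)) = \<rho> (\<iota> N a) \<otimes> \<rho> (\<iota> N b)"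
        using mul[of "\<iota> N a" "\<iota> N b"] by (simp add: \<iota>_def Zc)
    qed (simp add: \<iota>_def Zc cl)
    from hom_int_pow[OF this, of "1::int" z] show ?thesis
      by (simp add: \<iota>_def std_gen_def is_group)
  qed
  have "\<rho> (\<lambda>j\<in>{..<k}. if j < N then x j else 0) = tuple_word G (\<lambda>i. \<rho> (std_gen k i)) N x" if "N \<le> k" for N
    using that
  proof (induction N)
    case 0
    define z :: "nat \<Rightarrow> int" where "z = (\<lambda>j\<in>{..<k}. 0)"
    have z: "z \<in> carrier ?Z" "(\<lambda>i\<in>{..<k}. z i + z i) = z" unfolding z_def by (rule Zc) auto
    have "\<rho> z \<otimes> \<rho> z = \<rho> z" using mul[OF z(1) z(1)] z(2) by simp
    then have "\<rho> z = \<one>" using cl[OF z(1)] l_cancel_one by blast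
    then show ?case by (simp only: z_def not_less0 if_False tuple_word.simps)
  next
    case (Suc N)
    have eq: "(\<lambda>j\<in>{..<k}. if j < Suc N then x j else 0)
       = (\<lambda>j\<in>{..<k}. (\<lambda>j\<in>{..<k}. if j < N then x j else 0) j + \<iota> N (x N) j)"
      by (auto simp: \<iota>_def)
    have "\<rho> (\<lambda>j\<in>{..<k}. if j < Suc N then x j else 0)
        = \<rho> (\<lambda>j\<in>{..<k}. if j < N then x j else 0) \<otimes> \<rho> (\<iota> N (x N))"
      unfolding eq by (rule mul) (simp_all only: \<iota>_def Zc)
    then show ?case using Suc by (simp only: pow tuple_word.simps)
  qed
  from this[OF order_refl] have "\<rho> (\<lambda>j\<in>{..<k}. if j < k then x j else 0) = tuple_word G (\<lambda>i. \<rho> (std_gen k i)) k x" .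
  moreover have "(\<lambda>j\<in>{..<k}. if j < k then x j else 0) = x"
    using x by (auto simp: carrier_int_power_group PiE_iff extensional_def)
  ultimately show ?thesis by simp
qed

lemma (in group) hom_int_power_group_commute:
  assumes "\<rho> \<in> hom (int_power_group k) G"
  shows "\<rho> (std_gen k i) \<otimes> \<rho> (std_gen k j) = \<rho> (std_gen k j) \<otimes> \<rho> (std_gen k i)"
proof -
  have "std_gen k i \<otimes>\<^bsub>int_power_group k\<^esub> std_gen k j = std_gen k j \<otimes>\<^bsub>int_power_group k\<^esub> std_gen k i"
    by (simp add: mult_int_power_group add.commute)
  then show ?thesis using assms std_gen_carrier[of k] by (metis hom_mult)
qed

section \<open>Unitriangular matrices and the corner subgroup\<close>

lemma mat_mult_entry:
  assumes "M \<in> carrier_mat m m" "N \<in> carrier_mat m m" "a < m" "b < m"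
  shows "(M * N) $$ (a, b) = (\<Sum>l<m. M $$ (a, l) * N $$ (l, b))"
  using assms by (simp add: scalar_prod_def lessThan_atLeast0)

lemma in_unitri_iff:
  "M \<in> carrier (unitri m) \<longleftrightarrow>
     M \<in> carrier_mat m m \<and> (\<forall>i<m. \<forall>j<i. M $$ (i, j) = 0) \<and> (\<forall>i<m. M $$ (i, i) = 1)"
  by (auto simp: unitri_def)

lemma mult_unitri [simp]: "M \<otimes>\<^bsub>unitri m\<^esub> N = M * N"
  and one_unitri [simp]: "\<one>\<^bsub>unitri m\<^esub> = 1\<^sub>m m"
  by (simp_all add: unitri_def)

lemma unitri_mult_entry:
  assumes M: "M \<in> carrier (unitri m)" and N: "N \<in> carrier (unitri m)" and ab: "a < m" "b < m"
  shows "(M * N) $$ (a, b) = (\<Sum>l\<in>{a..b}. M $$ (a, l) * N $$ (l, b))"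
proof -
  have "(M * N) $$ (a, b) = (\<Sum>l<m. M $$ (a, l) * N $$ (l, b))"
    using assms by (intro mat_mult_entry) (auto simp: in_unitri_iff)
  also have "\<dots> = (\<Sum>l\<in>{a..b}. M $$ (a, l) * N $$ (l, b))"
  proof (rule sum.mono_neutral_right)
    show "\<forall>l\<in>{..<m} - {a..b}. M $$ (a, l) * N $$ (l, b) = 0"
    proof
      fix l assume l: "l \<in> {..<m} - {a..b}"
      then have "M $$ (a, l) = 0 \<or> N $$ (l, b) = 0"
        using M N ab by (cases "l < a") (auto simp: in_unitri_iff)
      then show "M $$ (a, l) * N $$ (l, b) = 0" by auto
    qed
  qed (use ab in auto)
  finally show ?thesis .
qed

lemma unitri_mult_closed:
  assumes M: "M \<in> carrier (unitri m)" and N: "N \<in> carrier (unitri m)"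
  shows "M * N \<in> carrier (unitri m)"
proof -
  have "(M * N) $$ (i, j) = 0" if "i < m" "j < i" for i j
    using that by (subst unitri_mult_entry[OF M N]) auto
  moreover have "(M * N) $$ (i, i) = 1" if "i < m" for i
    using that M N by (subst unitri_mult_entry[OF M N]) (auto simp: in_unitri_iff)
  ultimately show ?thesis using M N by (auto simp: in_unitri_iff)
qed

lemma one_in_unitri: "1\<^sub>m m \<in> carrier (unitri m)"
  by (auto simp: in_unitri_iff)

lemma one_smult_mat: "(1::'a::comm_ring_1) \<cdot>\<^sub>m M = M"
  by (intro eq_matI) auto

text \<open>The determinant is 1, so the adjugate is a left inverse over any commutative ring; that
  it is unitriangular is read off from the entries of the product.\<close>

lemma unitri_left_inverse:
  fixes M :: "'a::comm_ring_1 mat"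
  assumes M: "M \<in> carrier (unitri m)"
  shows "\<exists>A\<in>carrier (unitri m). A * M = 1\<^sub>m m"
proof -
  have Mc: "M \<in> carrier_mat m m" and M0: "\<And>i j. i < m \<Longrightarrow> j < i \<Longrightarrow> M $$ (i, j) = 0"
    and M1: "\<And>i. i < m \<Longrightarrow> M $$ (i, i) = 1" using M by (auto simp: in_unitri_iff)
  have "upper_triangular M" using M0 Mc by auto
  then have "det M = prod_list (diag_mat M)" using Mc by (rule det_upper_triangular)
  also have "diag_mat M = map (\<lambda>_. 1) [0..<m]" using Mc M1 by (auto simp: diag_mat_def)
  also have "prod_list \<dots> = (1::'a)" by (induction m) auto
  finally have "det M = 1" .
  then obtain A where A: "A \<in> carrier_mat m m" "A * M = 1\<^sub>m m"
    using adj_mat[OF Mc] by (metis one_smult_mat)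
  have e: "(\<Sum>l<m. A $$ (a, l) * M $$ (l, b)) = (if a = b then 1 else 0)" if "a < m" "b < m" for a b
    using mat_mult_entry[OF A(1) Mc that] A(2) that by simp
  \<comment> \<open>Induction on the column: in the equation for entry (a, b) the terms with l < b
    vanish by induction and those with l > b since \<open>M\<close> is triangular, so only A_ab M_bb
    remains.\<close>
  have low: "A $$ (a, b) = 0" if "a < m" "b < a" for a b
    using that
  proof (induction b rule: less_induct)
    case (less b)
    have "A $$ (a, l) * M $$ (l, b) = 0" if "l < m" "l \<noteq> b" for l
      using less that M0[of l b] by (cases "l < b") auto
    then have "(\<Sum>l<m. A $$ (a, l) * M $$ (l, b)) = (\<Sum>l<m. if l = b then A $$ (a, b) * M $$ (b, b) else 0)"
      by (intro sum.cong refl) auto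
    then show ?case using e[of a b] less.prems M1[of b] by simp
  qed
  have "A $$ (a, a) = 1" if "a < m" for a
  proof -
    have "A $$ (a, l) * M $$ (l, a) = 0" if "l < m" "l \<noteq> a" for l
      using low[OF \<open>a < m\<close>, of l] that M0[of l a] by (cases "l < a") auto
    then have "(\<Sum>l<m. A $$ (a, l) * M $$ (l, a)) = (\<Sum>l<m. if l = a then A $$ (a, a) * M $$ (a, a) else 0)"
      by (intro sum.cong refl) auto
    then show ?thesis using e[of a a] that M1[of a] by simp
  qed
  then show ?thesis using A low by (auto simp: in_unitri_iff)
qed

lemma group_unitri: "group (unitri m :: 'a::comm_ring_1 mat monoid)"
proof (rule groupI)
  show "x \<otimes>\<^bsub>unitri m\<^esub> y \<otimes>\<^bsub>unitri m\<^esub> z = x \<otimes>\<^bsub>unitri m\<^esub> (y \<otimes>\<^bsub>unitri m\<^esub> z)"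
    if "x \<in> carrier (unitri m)" "y \<in> carrier (unitri m)" "z \<in> carrier (unitri m)" for x y z :: "'a mat"
    using that by (auto simp: in_unitri_iff intro: assoc_mult_mat)
  show "\<exists>y\<in>carrier (unitri m). y \<otimes>\<^bsub>unitri m\<^esub> x = \<one>\<^bsub>unitri m\<^esub>" if "x \<in> carrier (unitri m)" for x :: "'a mat"
    using unitri_left_inverse[OF that] by simp
qed (auto simp: unitri_mult_closed one_in_unitri, auto simp: in_unitri_iff)

definition shift_corner :: "nat \<Rightarrow> 'a::comm_ring_1 \<Rightarrow> 'a mat \<Rightarrow> 'a mat" where
  "shift_corner m a M = Matrix.mat m m (\<lambda>(i, j). M $$ (i, j) + (if i = 0 \<and> j = m - 1 then a else 0))"

lemma corner_mat_in_unitri: "2 \<le> m \<Longrightarrow> corner_mat m a \<in> carrier (unitri m)"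
  by (auto simp: in_unitri_iff corner_mat_def)

text \<open>The last row and the first column of \<open>M\<close> are those of the identity, so
  either product changes only the corner. In particular corner matrices are central.\<close>

lemma corner_mat_mult:
  assumes m: "2 \<le> m" and M: "M \<in> carrier (unitri m)"
  shows "corner_mat m a * M = shift_corner m a M" and "M * corner_mat m a = shift_corner m a M"
proof -
  have Mc: "M \<in> carrier_mat m m" and M0: "\<And>i j. i < m \<Longrightarrow> j < i \<Longrightarrow> M $$ (i, j) = 0"
    and M1: "\<And>i. i < m \<Longrightarrow> M $$ (i, i) = 1" using M by (auto simp: in_unitri_iff)
  have C: "corner_mat m a \<in> carrier_mat m m" by (simp add: corner_mat_def)
  show "corner_mat m a * M = shift_corner m a M"
  proof (rule eq_matI)
    fix i j assume "i < dim_row (shift_corner m a M)" "j < dim_col (shift_corner m a M)"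
    then have ij: "i < m" "j < m" by (auto simp: shift_corner_def)
    have "(corner_mat m a * M) $$ (i, j) = (\<Sum>l<m. corner_mat m a $$ (i, l) * M $$ (l, j))"
      by (rule mat_mult_entry[OF C Mc ij])
    also have "\<dots> = (\<Sum>l<m. (if l = i then M $$ (i, j) else 0) + (if l = m - 1 then (if i = 0 then a * M $$ (m - 1, j) else 0) else 0))"
      using ij m by (intro sum.cong refl) (auto simp: corner_mat_def)
    also have "\<dots> = M $$ (i, j) + (if i = 0 then a * M $$ (m - 1, j) else 0)"
      using ij m by (simp add: sum.distrib)
    also have "\<dots> = shift_corner m a M $$ (i, j)"
      using ij m M0[of "m - 1" j] M1[of "m - 1"] by (cases "j = m - 1") (auto simp: shift_corner_def)
    finally show "(corner_mat m a * M) $$ (i, j) = shift_corner m a M $$ (i, j)" .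
  qed (use Mc in \<open>auto simp: shift_corner_def corner_mat_def\<close>)
  show "M * corner_mat m a = shift_corner m a M"
  proof (rule eq_matI)
    fix i j assume "i < dim_row (shift_corner m a M)" "j < dim_col (shift_corner m a M)"
    then have ij: "i < m" "j < m" by (auto simp: shift_corner_def)
    have "(M * corner_mat m a) $$ (i, j) = (\<Sum>l<m. M $$ (i, l) * corner_mat m a $$ (l, j))"
      by (rule mat_mult_entry[OF Mc C ij])
    also have "\<dots> = (\<Sum>l<m. (if l = j then M $$ (i, j) else 0) + (if l = 0 then (if j = m - 1 then M $$ (i, 0) * a else 0) else 0))"
      using ij m by (intro sum.cong refl) (auto simp: corner_mat_def)
    also have "\<dots> = M $$ (i, j) + (if j = m - 1 then M $$ (i, 0) * a else 0)"
      using ij m by (simp add: sum.distrib)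
    also have "\<dots> = shift_corner m a M $$ (i, j)"
      using ij m M0[of i 0] M1[of 0] by (cases "i = 0") (auto simp: shift_corner_def)
    finally show "(M * corner_mat m a) $$ (i, j) = shift_corner m a M $$ (i, j)" .
  qed (use Mc in \<open>auto simp: shift_corner_def corner_mat_def\<close>)
qed

lemma corner_mat_add: "2 \<le> m \<Longrightarrow> corner_mat m a * corner_mat m b = corner_mat m (a + b)"
  by (simp add: corner_mat_mult corner_mat_in_unitri)
    (auto simp: shift_corner_def corner_mat_def intro!: eq_matI)

lemma corner_mat_0: "2 \<le> m \<Longrightarrow> corner_mat m 0 = 1\<^sub>m m"
  by (auto simp: corner_mat_def intro!: eq_matI)

lemma shift_corner_in_unitri: "2 \<le> m \<Longrightarrow> M \<in> carrier (unitri m) \<Longrightarrow> shift_corner m a M \<in> carrier (unitri m)"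
  using unitri_mult_closed[OF corner_mat_in_unitri, of m M a] by (simp add: corner_mat_mult)

text \<open>An additive subgroup of the ring; containing 1, it also contains the entries of the
  standard symplectic matrix that tests surjectivity.\<close>

locale corner_quotient =
  fixes S :: "'a::comm_ring_1 set" and m :: nat
  assumes zero_in: "0 \<in> S" and one_in: "1 \<in> S" and diff_in: "x \<in> S \<Longrightarrow> y \<in> S \<Longrightarrow> x - y \<in> S"
    and m2: "2 \<le> m"
begin

lemma uminus_in: "x \<in> S \<Longrightarrow> - x \<in> S" using diff_in[OF zero_in] by simp
lemma add_in: "x \<in> S \<Longrightarrow> y \<in> S \<Longrightarrow> x + y \<in> S" using diff_in[OF _ uminus_in, of x y] by simp

abbreviation "U \<equiv> unitri m :: 'a mat monoid"
abbreviation "C \<equiv> corner_subgroup m S"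

definition coset_of :: "'a mat \<Rightarrow> 'a mat set" where "coset_of M = C #>\<^bsub>U\<^esub> M"

sublocale U: group U by (rule group_unitri)

lemma normal_corner: "C \<lhd> U"
proof (rule U.normalI)
  show "subgroup C U"
  proof (rule U.subgroupI)
    show "C \<subseteq> carrier U" using corner_mat_in_unitri[OF m2] by (auto simp: corner_subgroup_def)
    show "C \<noteq> {}" using zero_in by (auto simp: corner_subgroup_def)
    show "inv\<^bsub>U\<^esub> x \<in> C" if "x \<in> C" for x
    proof -
      obtain a where a: "a \<in> S" "x = corner_mat m a"
        using \<open>x \<in> C\<close> by (auto simp: corner_subgroup_def)
      have "inv\<^bsub>U\<^esub> x = corner_mat m (- a)"
        using a corner_mat_in_unitri[OF m2]
        by (intro U.inv_equality) (auto simp: corner_mat_add[OF m2] corner_mat_0[OF m2])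
      then show ?thesis using uminus_in[OF a(1)] by (auto simp: corner_subgroup_def)
    qed
    show "x \<otimes>\<^bsub>U\<^esub> y \<in> C" if "x \<in> C" "y \<in> C" for x y
      using that add_in by (auto simp: corner_subgroup_def corner_mat_add[OF m2])
  qed
  show "\<forall>x\<in>carrier U. C #>\<^bsub>U\<^esub> x = x <#\<^bsub>U\<^esub> C"
    by (auto simp: r_coset_def l_coset_def corner_subgroup_def corner_mat_mult[OF m2])
qed

sublocale N: normal C U by (rule normal_corner)

lemma coset_eq_image: "M \<in> carrier U \<Longrightarrow> coset_of M = (\<lambda>a. shift_corner m a M) ` S"
  by (auto simp: coset_of_def r_coset_def corner_subgroup_def corner_mat_mult[OF m2])

lemma in_coset_iff:
  assumes M: "M \<in> carrier U"
  shows "N \<in> coset_of M \<longleftrightarrow> N \<in> carrier U \<and> (\<forall>i<m. \<forall>j<m. (i, j) \<noteq> (0, m - 1) \<longrightarrow> N $$ (i, j) = M $$ (i, j))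
     \<and> N $$ (0, m - 1) - M $$ (0, m - 1) \<in> S"
proof
  assume "N \<in> coset_of M"
  then obtain a where a: "a \<in> S" "N = shift_corner m a M" by (auto simp: coset_eq_image[OF M])
  then show "N \<in> carrier U \<and> (\<forall>i<m. \<forall>j<m. (i, j) \<noteq> (0, m - 1) \<longrightarrow> N $$ (i, j) = M $$ (i, j))
     \<and> N $$ (0, m - 1) - M $$ (0, m - 1) \<in> S"
    using shift_corner_in_unitri[OF m2 M] m2 by (auto simp: shift_corner_def)
next
  assume *: "N \<in> carrier U \<and> (\<forall>i<m. \<forall>j<m. (i, j) \<noteq> (0, m - 1) \<longrightarrow> N $$ (i, j) = M $$ (i, j))
     \<and> N $$ (0, m - 1) - M $$ (0, m - 1) \<in> S"
  have "N = shift_corner m (N $$ (0, m - 1) - M $$ (0, m - 1)) M"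
    using * by (intro eq_matI) (auto simp: shift_corner_def in_unitri_iff)
  then show "N \<in> coset_of M" using * by (auto simp: coset_eq_image[OF M])
qed

lemma coset_self: "M \<in> carrier U \<Longrightarrow> M \<in> coset_of M"
  by (simp add: in_coset_iff zero_in)

lemma coset_eq_iff:
  assumes M: "M \<in> carrier U" and N: "N \<in> carrier U"
  shows "coset_of N = coset_of M \<longleftrightarrow> (\<forall>i<m. \<forall>j<m. (i, j) \<noteq> (0, m - 1) \<longrightarrow> N $$ (i, j) = M $$ (i, j))
     \<and> N $$ (0, m - 1) - M $$ (0, m - 1) \<in> S"
proof -
  have "coset_of N = coset_of M \<longleftrightarrow> N \<in> coset_of M"
    using U.repr_independence[of N C M] N.subgroup_axioms M N coset_self[OF N] unfolding coset_of_def by auto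
  then show ?thesis using in_coset_iff[OF M] N by simp
qed

abbreviation "Q \<equiv> unitri_quot m S"

lemma group_Q: "group Q"
  unfolding unitri_quot_def by (rule N.factorgroup_is_group)

lemma carrier_Q: "carrier Q = coset_of ` carrier U"
  by (simp add: unitri_quot_def carrier_FactGroup coset_of_def[abs_def])

lemma mult_Q: "M \<in> carrier U \<Longrightarrow> N \<in> carrier U \<Longrightarrow> coset_of M \<otimes>\<^bsub>Q\<^esub> coset_of N = coset_of (M * N)"
  using N.rcos_sum[of M N] by (simp add: unitri_quot_def coset_of_def)

text \<open>The commutator of the strictly upper triangular parts. The arguments are functions of
  index pairs, so that it applies to matrices and to their chart coordinates alike.\<close>

definition bracket :: "(nat \<times> nat \<Rightarrow> 'a) \<Rightarrow> (nat \<times> nat \<Rightarrow> 'a) \<Rightarrow> nat \<Rightarrow> nat \<Rightarrow> 'a" where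
  "bracket M N a b = (\<Sum>l\<in>{a<..<b}. M (a, l) * N (l, b) - N (a, l) * M (l, b))"

text \<open>Because the diagonals are 1, the terms with l = a and l = b give the sum of the two (a,
  b) entries in either product and cancel.\<close>

lemma commutator_entry:
  assumes M: "M \<in> carrier U" and N: "N \<in> carrier U" and ab: "a < m" "b < m"
  shows "(M * N) $$ (a, b) - (N * M) $$ (a, b) = bracket (($$) M) (($$) N) a b"
proof -
  consider "b < a" | "a = b" | "a < b" by linarith
  then show ?thesis
  proof cases
    case 3
    have "{a..b} = insert a (insert b {a<..<b})" using 3 by auto
    then have "(\<Sum>l\<in>{a..b}. f l) = f a + (f b + (\<Sum>l\<in>{a<..<b}. f l))" for f :: "nat \<Rightarrow> 'a"
      using 3 by simp
    then show ?thesis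
      using 3 M N ab
      by (simp add: unitri_mult_entry bracket_def sum_subtractf in_unitri_iff)
  qed (use M N ab in \<open>auto simp: unitri_mult_entry bracket_def\<close>)
qed

lemma commute_Q_iff:
  assumes M: "M \<in> carrier U" and N: "N \<in> carrier U"
  shows "coset_of M \<otimes>\<^bsub>Q\<^esub> coset_of N = coset_of N \<otimes>\<^bsub>Q\<^esub> coset_of M \<longleftrightarrow>
    (\<forall>a<m. \<forall>b<m. (a, b) \<noteq> (0, m - 1) \<longrightarrow> bracket (($$) M) (($$) N) a b = 0)
     \<and> bracket (($$) M) (($$) N) 0 (m - 1) \<in> S"
proof -
  have "0 < m" "m - 1 < m" using m2 by auto
  then show ?thesis
    unfolding mult_Q[OF M N] mult_Q[OF N M] coset_eq_iff[OF unitri_mult_closed[OF N M] unitri_mult_closed[OF M N]]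
    by (auto simp: commutator_entry[OF M N, symmetric])
qed

text \<open>Here MN is NM times a corner matrix, and the group commutator is the inverse of NM times
  MN.\<close>

lemma group_commutator_corner:
  assumes M: "M \<in> carrier U" and N: "N \<in> carrier U"
    and com: "\<And>a b. a < m \<Longrightarrow> b < m \<Longrightarrow> (a, b) \<noteq> (0, m - 1) \<Longrightarrow> bracket (($$) M) (($$) N) a b = 0"
  shows "group_commutator U M N $$ (0, m - 1) = bracket (($$) M) (($$) N) 0 (m - 1)"
proof -
  let ?\<beta> = "bracket (($$) M) (($$) N) 0 (m - 1)"
  have MN: "M * N \<in> carrier U" "N * M \<in> carrier U" using M N by (auto intro: unitri_mult_closed)
  have "M * N = shift_corner m ?\<beta> (N * M)"
  proof (rule eq_matI)
    fix i j assume "i < dim_row (shift_corner m ?\<beta> (N * M))" "j < dim_col (shift_corner m ?\<beta> (N * M))"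
    then have ij: "i < m" "j < m" by (auto simp: shift_corner_def)
    show "(M * N) $$ (i, j) = shift_corner m ?\<beta> (N * M) $$ (i, j)"
      using commutator_entry[OF M N ij] com[OF ij] ij
      by (cases "(i, j) = (0, m - 1)") (auto simp: shift_corner_def algebra_simps)
  qed (use M N in \<open>auto simp: shift_corner_def in_unitri_iff\<close>)
  then have eq: "M \<otimes>\<^bsub>U\<^esub> N = N \<otimes>\<^bsub>U\<^esub> M \<otimes>\<^bsub>U\<^esub> corner_mat m ?\<beta>"
    using corner_mat_mult(2)[OF m2 MN(2)] by simp
  have c: "corner_mat m ?\<beta> \<in> carrier U" by (rule corner_mat_in_unitri[OF m2])
  have "group_commutator U M N = inv\<^bsub>U\<^esub> (N \<otimes>\<^bsub>U\<^esub> M) \<otimes>\<^bsub>U\<^esub> (M \<otimes>\<^bsub>U\<^esub> N)"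
    unfolding group_commutator_def using M N
    by (simp only: U.inv_mult_group U.m_assoc U.inv_closed U.m_closed)
  also have "\<dots> = corner_mat m ?\<beta>"
  proof -
    have NM: "N \<otimes>\<^bsub>U\<^esub> M \<in> carrier U" using M N by (rule_tac U.m_closed)
    show ?thesis
      unfolding eq U.m_assoc[OF U.inv_closed[OF NM] NM c, symmetric] U.l_inv[OF NM] U.l_one[OF c] ..
  qed
  finally show ?thesis using m2 by (simp add: corner_mat_def)
qed

end

section \<open>Charts on the quotient group\<close>

lemma open_map_prod_top:
  assumes f: "open_map X X' f" and g: "open_map Y Y' g"
  shows "open_map (prod_topology X Y) (prod_topology X' Y') (\<lambda>z. (f (fst z), g (snd z)))"
  unfolding open_map_def
proof (intro allI impI)
  fix W assume W: "openin (prod_topology X Y) W"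
  show "openin (prod_topology X' Y') ((\<lambda>z. (f (fst z), g (snd z))) ` W)"
    unfolding openin_prod_topology_alt
  proof (intro allI impI)
    fix x' y' assume "(x', y') \<in> (\<lambda>z. (f (fst z), g (snd z))) ` W"
    then obtain x y where xy: "(x, y) \<in> W" "x' = f x" "y' = g y" by auto
    then obtain A B where AB: "openin X A" "openin Y B" "x \<in> A" "y \<in> B" "A \<times> B \<subseteq> W"
      using W unfolding openin_prod_topology_alt by meson
    have "openin X' (f ` A)" "openin Y' (g ` B)" using AB f g by (auto simp: open_map_def)
    moreover have "f ` A \<times> g ` B \<subseteq> (\<lambda>z. (f (fst z), g (snd z))) ` W" using AB(5) by force
    ultimately show "\<exists>U V. openin X' U \<and> openin Y' V \<and> x' \<in> U \<and> y' \<in> V \<and>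
        U \<times> V \<subseteq> (\<lambda>z. (f (fst z), g (snd z))) ` W"
      using AB xy by blast
  qed
qed

type_synonym 'a coords = "(nat \<times> nat \<Rightarrow> 'a) \<times> (nat \<Rightarrow> complex)"

text \<open>The map \<open>\<epsilon>\<close> realizes the quotient of the additive group of the field by \<open>S\<close> as a torus of dimension \<open>d\<close>.\<close>

locale unitri_circle = corner_quotient S m for S :: "'a::real_normed_field set" and m :: nat +
  fixes d :: nat and \<epsilon> :: "'a \<Rightarrow> nat \<Rightarrow> complex"
  assumes discrete: "x \<in> S \<Longrightarrow> norm x < 1 \<Longrightarrow> x = 0"
    and \<epsilon>_cont: "continuous_map euclidean (torus d) \<epsilon>"
    and \<epsilon>_open: "open_map euclidean (torus d) \<epsilon>"
    and \<epsilon>_surj: "range \<epsilon> = topspace (torus d)"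
    and \<epsilon>_eq: "\<epsilon> x = \<epsilon> y \<longleftrightarrow> x - y \<in> S"
begin

definition I :: "(nat \<times> nat) set" where "I = {(a, b). a < b \<and> b < m \<and> (a, b) \<noteq> (0, m - 1)}"

definition Off :: "(nat \<times> nat \<Rightarrow> 'a) topology" where "Off = product_topology (\<lambda>_. euclidean) I"

definition Y :: "'a coords topology" where "Y = prod_topology Off (torus d)"

text \<open>Coordinates on the quotient group: the corner entry is known only modulo
  \<open>S\<close> and is recorded by its image under \<epsilon>.\<close>

definition chart :: "'a mat \<Rightarrow> 'a coords" where
  "chart M = ((\<lambda>p\<in>I. M $$ p), \<epsilon> (M $$ (0, m - 1)))"

definition mat_of :: "(nat \<times> nat \<Rightarrow> 'a) \<Rightarrow> 'a \<Rightarrow> 'a mat" where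
  "mat_of f c = Matrix.mat m m (\<lambda>p. if fst p = snd p then 1 else if p = (0, m - 1) then c
     else if fst p < snd p then f p else 0)"

lemma mat_of_in_U: "mat_of f c \<in> carrier U"
  using m2 by (auto simp: in_unitri_iff mat_of_def)

lemma topspace_Off: "topspace Off = extensional I"
  by (auto simp: Off_def PiE_def)

lemma chart_mat_of: "f \<in> extensional I \<Longrightarrow> chart (mat_of f c) = (f, \<epsilon> c)"
  using m2 by (auto simp: chart_def mat_of_def I_def extensional_def restrict_def fun_eq_iff)

lemma topspace_unitri_topology: "topspace (unitri_topology m :: 'a mat topology) = carrier U"
  by (auto simp: unitri_topology_def topspace_pullback_topology)

lemma continuous_map_entry:
  assumes "p \<in> {..<m} \<times> {..<m}"
  shows "continuous_map (unitri_topology m) euclidean (\<lambda>M. M $$ p :: 'a)"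
proof -
  have "continuous_map (unitri_topology m :: 'a mat topology) euclidean ((\<lambda>x. x p) \<circ> (\<lambda>M. \<lambda>p\<in>{..<m} \<times> {..<m}. M $$ p))"
    unfolding unitri_topology_def
    by (rule continuous_map_pullback) (rule continuous_map_product_projection[OF assms])
  then show ?thesis using assms by (simp add: o_def)
qed

lemma continuous_map_chart: "continuous_map (unitri_topology m) Y chart"
  unfolding Y_def chart_def
proof (rule continuous_map_pairedI)
  show "continuous_map (unitri_topology m) Off (\<lambda>M. \<lambda>p\<in>I. M $$ p)"
    unfolding Off_def continuous_map_componentwise
    using continuous_map_entry by (auto simp: I_def)
  have "(0, m - 1) \<in> {..<m} \<times> {..<m}" using m2 by auto
  from continuous_map_compose[OF continuous_map_entry[OF this] \<epsilon>_cont]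
  show "continuous_map (unitri_topology m) (torus d) (\<lambda>M. \<epsilon> (M $$ (0, m - 1)))" by (simp add: o_def)
qed

lemma continuous_map_mat_of:
  "continuous_map (prod_topology Off euclidean) (unitri_topology m) (\<lambda>z. mat_of (fst z) (snd z))"
  unfolding unitri_topology_def
proof (rule continuous_map_pullback')
  show "continuous_map (prod_topology Off euclidean)
     (product_topology (\<lambda>_. euclidean) ({..<m} \<times> {..<m}))
     ((\<lambda>M. \<lambda>p\<in>{..<m} \<times> {..<m}. M $$ p) \<circ> (\<lambda>z. mat_of (fst z) (snd z)))"
    unfolding continuous_map_componentwise
  proof (intro conjI ballI)
    fix p assume p: "p \<in> {..<m} \<times> {..<m}"
    show "continuous_map (prod_topology Off euclidean) euclidean
      (\<lambda>x. ((\<lambda>M. \<lambda>p\<in>{..<m} \<times> {..<m}. M $$ p) \<circ> (\<lambda>z. mat_of (fst z) (snd z))) x p)"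
    proof (cases "p \<in> I")
      case True
      then have "continuous_map (prod_topology Off euclidean) euclidean ((\<lambda>f. f p) \<circ> (fst :: _ \<times> 'a \<Rightarrow> _))"
        unfolding Off_def by (intro continuous_map_compose[OF continuous_map_fst] continuous_map_product_projection)
      moreover have "mat_of f c $$ p = f p" for f c
        using True p by (auto simp: mat_of_def I_def)
      ultimately show ?thesis using p by (simp add: o_def)
    next
      case False
      obtain a b where ab: "p = (a, b)" "a < m" "b < m" using p by auto
      consider "p = (0, m - 1)" | "p \<noteq> (0, m - 1)" "\<not> a < b" using False ab unfolding I_def by blast
      then show ?thesis
      proof cases
        case 1
        then have "mat_of f c $$ p = c" for f c using m2 by (simp add: mat_of_def)
        then show ?thesis using p by (simp add: o_def continuous_map_snd)
      next
        case 2
        then have "mat_of f c $$ p = (if a = b then 1 else 0)" for f c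
          unfolding ab(1) using ab(2,3) by (simp add: mat_of_def)
        then show ?thesis using p by (simp add: o_def)
      qed
    qed
  qed auto
qed (use mat_of_in_U in auto)

text \<open>On matrices written by their entries, \<open>chart\<close> becomes the identity times
  \<epsilon>, which is an open surjection; \<open>mat_of\<close> is the continuous map that writes
  them so.\<close>

lemma quotient_map_chart: "quotient_map (unitri_topology m) Y chart"
proof (rule quotient_map_from_composition[OF continuous_map_mat_of continuous_map_chart])
  have id: "open_map Off Off (\<lambda>x. x)" by (simp add: open_map_def)
  have "quotient_map (prod_topology Off euclidean) Y (\<lambda>z. (fst z, \<epsilon> (snd z)))"
    unfolding Y_def
  proof (rule continuous_open_imp_quotient_map)
    show "continuous_map (prod_topology Off euclidean) (prod_topology Off (torus d)) (\<lambda>z. (fst z, \<epsilon> (snd z)))"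
      using continuous_map_compose[OF continuous_map_snd[of Off euclidean] \<epsilon>_cont]
      by (intro continuous_map_pairedI) (auto simp: o_def continuous_map_fst)
    show "open_map (prod_topology Off euclidean) (prod_topology Off (torus d)) (\<lambda>z. (fst z, \<epsilon> (snd z)))"
      by (rule open_map_prod_top[OF id \<epsilon>_open])
    show "(\<lambda>z. (fst z, \<epsilon> (snd z))) ` topspace (prod_topology Off euclidean) = topspace (prod_topology Off (torus d))"
      unfolding topspace_prod_topology \<epsilon>_surj[symmetric] by force
  qed
  then show "quotient_map (prod_topology Off euclidean) Y (chart \<circ> (\<lambda>z. mat_of (fst z) (snd z)))"
    by (rule quotient_map_eq) (auto simp: chart_mat_of topspace_Off)
qed

abbreviation "T \<equiv> unitri_quot_topology m S"

lemma quotient_map_coset: "quotient_map (unitri_topology m) T coset_of"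
  using quotient_map_quotient_topology[of "unitri_topology m" coset_of]
  by (simp add: unitri_quot_topology_def coset_of_def[abs_def])

lemma topspace_T: "topspace T = carrier Q"
  using quotient_imp_surjective_map[OF quotient_map_coset] by (simp add: carrier_Q topspace_unitri_topology)

lemma chart_eq_iff:
  assumes M: "M \<in> carrier U" and N: "N \<in> carrier U"
  shows "chart N = chart M \<longleftrightarrow> coset_of N = coset_of M"
proof -
  have "(\<forall>i<m. \<forall>j<m. (i, j) \<noteq> (0, m - 1) \<longrightarrow> N $$ (i, j) = M $$ (i, j)) \<longleftrightarrow> (\<forall>p\<in>I. N $$ p = M $$ p)"
  proof
    assume *: "\<forall>p\<in>I. N $$ p = M $$ p"
    show "\<forall>i<m. \<forall>j<m. (i, j) \<noteq> (0, m - 1) \<longrightarrow> N $$ (i, j) = M $$ (i, j)"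
    proof (intro allI impI)
      fix i j assume ij: "i < m" "j < m" "(i, j) \<noteq> (0, m - 1)"
      consider "j < i" | "i = j" | "i < j" by linarith
      then show "N $$ (i, j) = M $$ (i, j)"
        using * ij M N by cases (auto simp: in_unitri_iff I_def)
    qed
  qed (auto simp: I_def)
  then show ?thesis
    unfolding coset_eq_iff[OF M N] chart_def prod.inject \<epsilon>_eq by (auto simp: restrict_def fun_eq_iff)
qed

definition h :: "'a mat set \<Rightarrow> 'a coords" where
  "h K = chart (SOME M. M \<in> K)"

lemma some_in_coset:
  assumes M: "M \<in> carrier U"
  shows "(SOME N. N \<in> coset_of M) \<in> carrier U" "coset_of (SOME N. N \<in> coset_of M) = coset_of M"
proof -
  have "(SOME N. N \<in> coset_of M) \<in> coset_of M" using coset_self[OF M] by (rule someI)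
  then show "(SOME N. N \<in> coset_of M) \<in> carrier U" "coset_of (SOME N. N \<in> coset_of M) = coset_of M"
    using in_coset_iff[OF M] coset_eq_iff[OF M] by auto
qed

lemma h_coset: "M \<in> carrier U \<Longrightarrow> h (coset_of M) = chart M"
  using some_in_coset[of M] chart_eq_iff[of M] by (simp add: h_def)

text \<open>Both \<open>coset_of\<close> and \<open>chart\<close> are quotient maps on the
  unitriangular group, and they have the same fibres.\<close>

lemma homeomorphic_map_h: "homeomorphic_map T Y h"
  unfolding homeomorphic_map_def
proof
  have "quotient_map (unitri_topology m) Y (h \<circ> coset_of)"
    by (rule quotient_map_eq[OF quotient_map_chart]) (simp add: topspace_unitri_topology h_coset)
  then show "quotient_map T Y h" using quotient_map_compose_eq[OF quotient_map_coset] by blast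
  show "inj_on h (topspace T)"
    unfolding topspace_T carrier_Q by (auto simp: inj_on_def h_coset chart_eq_iff)
qed

definition h' :: "'a coords \<Rightarrow> 'a mat set" where
  "h' = (SOME g. homeomorphic_maps T Y h g)"

lemma homeomorphic_maps_h: "homeomorphic_maps T Y h h'"
  unfolding h'_def using homeomorphic_map_h[unfolded homeomorphic_map_maps] by (rule someI_ex)

section \<open>Homomorphisms as commuting tuples in chart coordinates\<close>

definition PY :: "nat \<Rightarrow> (nat \<Rightarrow> 'a coords) topology" where
  "PY k = product_topology (\<lambda>_. Y) {..<k}"

definition comm_tuples :: "nat \<Rightarrow> (nat \<Rightarrow> 'a coords) set" where
  "comm_tuples k = {y \<in> topspace (PY k). \<forall>i<k. \<forall>j<k.
      (\<forall>(a, b)\<in>I. bracket (fst (y i)) (fst (y j)) a b = 0) \<and>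
      bracket (fst (y i)) (fst (y j)) 0 (m - 1) \<in> S}"

text \<open>No bracket sees the corner entry: for a < l < b neither (a, l) nor (l, b) is the
  corner.\<close>

lemma bracket_cong:
  assumes "\<And>p. p \<in> I \<Longrightarrow> M p = M' p" "\<And>p. p \<in> I \<Longrightarrow> N p = N' p" "b < m"
  shows "bracket M N a b = bracket M' N' a b"
  unfolding bracket_def
proof (rule sum.cong[OF refl])
  fix l assume "l \<in> {a<..<b}"
  then have "(a, l) \<in> I" "(l, b) \<in> I" using assms(3) by (auto simp: I_def)
  then show "M (a, l) * N (l, b) - N (a, l) * M (l, b) = M' (a, l) * N' (l, b) - N' (a, l) * M' (l, b)"
    using assms by simp
qed

lemma bracket_zero: "b \<le> a \<Longrightarrow> bracket M N a b = 0"
  by (simp add: bracket_def)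

lemma bracket_chart:
  "b < m \<Longrightarrow> bracket (fst (chart M)) (fst (chart N)) a b = bracket (($$) M) (($$) N) a b"
  by (rule bracket_cong) (auto simp: chart_def)

lemma commute_Q_chart_iff:
  assumes M: "M \<in> carrier U" and N: "N \<in> carrier U"
  shows "coset_of M \<otimes>\<^bsub>Q\<^esub> coset_of N = coset_of N \<otimes>\<^bsub>Q\<^esub> coset_of M \<longleftrightarrow>
    (\<forall>(a, b)\<in>I. bracket (fst (chart M)) (fst (chart N)) a b = 0) \<and>
      bracket (fst (chart M)) (fst (chart N)) 0 (m - 1) \<in> S"
proof -
  have "m - 1 < m" using m2 by simp
  moreover have "(\<forall>a<m. \<forall>b<m. (a, b) \<noteq> (0, m - 1) \<longrightarrow> bracket (($$) M) (($$) N) a b = 0) \<longleftrightarrow>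
     (\<forall>(a, b)\<in>I. bracket (fst (chart M)) (fst (chart N)) a b = 0)" (is "?l \<longleftrightarrow> ?r")
  proof
    assume ?l then show ?r by (auto simp: I_def bracket_chart)
  next
    assume r: ?r
    show ?l
    proof (intro allI impI)
      fix a b assume ab: "a < m" "b < m" "(a, b) \<noteq> (0, m - 1)"
      show "bracket (($$) M) (($$) N) a b = 0"
      proof (cases "a < b")
        case True
        then have "(a, b) \<in> I" using ab by (simp add: I_def)
        then show ?thesis using r ab by (auto simp: bracket_chart)
      qed (simp add: bracket_zero)
    qed
  qed
  ultimately show ?thesis by (simp add: commute_Q_iff[OF M N] bracket_chart)
qed

definition Xs :: "nat \<Rightarrow> ((nat \<Rightarrow> int) \<Rightarrow> 'a mat set) topology" where
  "Xs k = unitri_flat_space k m S"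

lemma topspace_Xs: "topspace (Xs k) = hom (int_power_group k) Q \<inter> extensional (carrier (int_power_group k))"
  using std_gen_carrier
  by (auto simp: Xs_def unitri_flat_space_def hom_topology_def topspace_pullback_topology topspace_T hom_def Pi_iff)

definition \<Phi> :: "nat \<Rightarrow> ((nat \<Rightarrow> int) \<Rightarrow> 'a mat set) \<Rightarrow> nat \<Rightarrow> 'a coords" where
  "\<Phi> k \<rho> = (\<lambda>i\<in>{..<k}. h (\<rho> (std_gen k i)))"

definition \<Psi> :: "nat \<Rightarrow> (nat \<Rightarrow> 'a coords) \<Rightarrow> (nat \<Rightarrow> int) \<Rightarrow> 'a mat set" where
  "\<Psi> k y = hom_of_tuple k Q (\<lambda>i. h' (y i))"

lemma gen_in_topspace: "\<rho> \<in> topspace (Xs k) \<Longrightarrow> \<rho> (std_gen k i) \<in> topspace T"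
  using std_gen_carrier[of k i] by (auto simp: topspace_T topspace_Xs hom_def)

lemma lift_exists:
  assumes "\<rho> \<in> topspace (Xs k)"
  obtains M where "M \<in> carrier U" "\<rho> (std_gen k i) = coset_of M"
  using gen_in_topspace[OF assms, of i] that by (auto simp: topspace_T carrier_Q)

lemma \<Phi>_in: "\<rho> \<in> topspace (Xs k) \<Longrightarrow> \<Phi> k \<rho> \<in> comm_tuples k"
proof -
  assume \<rho>: "\<rho> \<in> topspace (Xs k)"
  interpret Q: group Q by (rule group_Q)
  have hY: "h (\<rho> (std_gen k i)) \<in> topspace Y" for i
    using gen_in_topspace[OF \<rho>] homeomorphic_imp_surjective_map[OF homeomorphic_map_h] by blast
  have "(\<forall>(a, b)\<in>I. bracket (fst (\<Phi> k \<rho> i)) (fst (\<Phi> k \<rho> j)) a b = 0) \<and>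
      bracket (fst (\<Phi> k \<rho> i)) (fst (\<Phi> k \<rho> j)) 0 (m - 1) \<in> S" if ij: "i < k" "j < k" for i j
  proof -
    obtain M where M: "M \<in> carrier U" "\<rho> (std_gen k i) = coset_of M" using lift_exists[OF \<rho>] .
    obtain N where N: "N \<in> carrier U" "\<rho> (std_gen k j) = coset_of N" using lift_exists[OF \<rho>] .
    have "coset_of M \<otimes>\<^bsub>Q\<^esub> coset_of N = coset_of N \<otimes>\<^bsub>Q\<^esub> coset_of M"
      using Q.hom_int_power_group_commute[of \<rho> k i j] \<rho> M N by (simp add: topspace_Xs)
    then show ?thesis using commute_Q_chart_iff[OF M(1) N(1)] ij M N by (simp add: \<Phi>_def h_coset)
  qed
  then show ?thesis using hY by (auto simp: comm_tuples_def PY_def \<Phi>_def)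
qed

lemma h'_lift:
  assumes "y \<in> topspace Y"
  obtains M where "M \<in> carrier U" "h' y = coset_of M" "chart M = y"
proof -
  have "h' y \<in> carrier Q" "h (h' y) = y"
    using homeomorphic_maps_h assms unfolding homeomorphic_maps_def topspace_T[symmetric]
    by (auto simp: continuous_map_def)
  then show thesis using that h_coset by (auto simp: carrier_Q)
qed

lemma \<Psi>_props:
  assumes y: "y \<in> comm_tuples k"
  shows "\<Psi> k y \<in> topspace (Xs k)" and "\<And>i. i < k \<Longrightarrow> \<Psi> k y (std_gen k i) = h' (y i)"
proof -
  interpret Q: group Q by (rule group_Q)
  have yY: "y i \<in> topspace Y" if "i < k" for i using y that by (auto simp: comm_tuples_def PY_def)
  have cl: "h' (y i) \<in> carrier Q" if "i < k" for i
    using h'_lift[OF yY[OF that]] by (auto simp: carrier_Q)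
  have com: "h' (y i) \<otimes>\<^bsub>Q\<^esub> h' (y j) = h' (y j) \<otimes>\<^bsub>Q\<^esub> h' (y i)" if "i < k" "j < k" for i j
  proof -
    note yij = yY[OF that(1)] yY[OF that(2)]
    obtain M where M: "M \<in> carrier U" "h' (y i) = coset_of M" "chart M = y i" using h'_lift[OF yij(1)] .
    obtain N where N: "N \<in> carrier U" "h' (y j) = coset_of N" "chart N = y j" using h'_lift[OF yij(2)] .
    show ?thesis using commute_Q_chart_iff[OF M(1) N(1)] M N y that by (simp add: comm_tuples_def)
  qed
  show "\<Psi> k y \<in> topspace (Xs k)" "\<And>i. i < k \<Longrightarrow> \<Psi> k y (std_gen k i) = h' (y i)"
    using Q.hom_of_tuple[of k "\<lambda>i. h' (y i)", OF cl com] unfolding \<Psi>_def topspace_Xs by auto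
qed

text \<open>The topology of the space of homomorphisms is pulled back from the values at the
  generators, so continuity is checked there; the words in these values recover the
  homomorphism.\<close>

lemma homeomorphic_maps_\<Phi>:
  "homeomorphic_maps (Xs k) (subtopology (PY k) (comm_tuples k)) (\<Phi> k) (\<Psi> k)"
  unfolding homeomorphic_maps_def
proof (intro conjI ballI)
  interpret Q: group Q by (rule group_Q)
  have hc: "continuous_map T Y h" and h'c: "continuous_map Y T h'"
    and hh': "\<And>y. y \<in> topspace Y \<Longrightarrow> h (h' y) = y" and h'h: "\<And>K. K \<in> topspace T \<Longrightarrow> h' (h K) = K"
    using homeomorphic_maps_h by (auto simp: homeomorphic_maps_def)
  have "continuous_map (product_topology (\<lambda>_. T) {..<k}) (PY k) (\<lambda>x. \<lambda>i\<in>{..<k}. h (x i))"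
    unfolding PY_def continuous_map_componentwise
    using continuous_map_compose[OF continuous_map_product_projection[of _ "{..<k}" "\<lambda>_. T"] hc] by (auto simp: o_def)
  then have "continuous_map (Xs k) (PY k) ((\<lambda>x. \<lambda>i\<in>{..<k}. h (x i)) \<circ> (\<lambda>\<rho>. \<lambda>i\<in>{..<k}. \<rho> (std_gen k i)))"
    unfolding Xs_def unitri_flat_space_def hom_topology_def by (rule continuous_map_pullback)
  then have "continuous_map (Xs k) (PY k) (\<Phi> k)"
    by (rule continuous_map_eq) (auto simp: \<Phi>_def)
  then show "continuous_map (Xs k) (subtopology (PY k) (comm_tuples k)) (\<Phi> k)"
    using \<Phi>_in by (auto simp: continuous_map_in_subtopology)
  let ?Z = "subtopology (PY k) (comm_tuples k)"
  have tZ: "topspace ?Z = comm_tuples k" by (auto simp: comm_tuples_def)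
  show "continuous_map ?Z (Xs k) (\<Psi> k)"
    unfolding Xs_def unitri_flat_space_def hom_topology_def
  proof (rule continuous_map_pullback')
    have "continuous_map ?Z T (\<lambda>y. h' (y i))" if "i < k" for i
      using continuous_map_compose[OF continuous_map_product_projection[of i "{..<k}" "\<lambda>_. Y"] h'c] that
      by (simp add: PY_def continuous_map_from_subtopology o_def)
    then have "continuous_map ?Z (product_topology (\<lambda>_. T) {..<k}) (\<lambda>y. \<lambda>i\<in>{..<k}. h' (y i))"
      unfolding continuous_map_componentwise by auto
    then show "continuous_map ?Z (product_topology (\<lambda>_. T) {..<k}) ((\<lambda>\<rho>. \<lambda>i\<in>{..<k}. \<rho> (std_gen k i)) \<circ> \<Psi> k)"
      by (rule continuous_map_eq) (use \<Psi>_props(2) tZ in \<open>auto simp: fun_eq_iff\<close>)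
    show "topspace ?Z \<subseteq> \<Psi> k -` (hom (int_power_group k) Q \<inter> extensional (carrier (int_power_group k)))"
      using \<Psi>_props(1) tZ unfolding topspace_Xs by blast
  qed
  show "\<Phi> k (\<Psi> k y) = y" if "y \<in> topspace ?Z" for y
  proof
    fix i
    have y: "y \<in> comm_tuples k" using that tZ by simp
    show "\<Phi> k (\<Psi> k y) i = y i"
      using y \<Psi>_props(2)[OF y] hh' by (cases "i < k") (auto simp: \<Phi>_def comm_tuples_def PY_def PiE_iff extensional_def)
  qed
  show "\<Psi> k (\<Phi> k \<rho>) = \<rho>" if \<rho>: "\<rho> \<in> topspace (Xs k)" for \<rho>
  proof
    fix x
    have P: "\<Psi> k (\<Phi> k \<rho>) \<in> topspace (Xs k)" by (rule \<Psi>_props(1)[OF \<Phi>_in[OF \<rho>]])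
    have gen: "\<Psi> k (\<Phi> k \<rho>) (std_gen k i) = \<rho> (std_gen k i)" if "i < k" for i
      using \<Psi>_props(2)[OF \<Phi>_in[OF \<rho>] that] that h'h[OF gen_in_topspace[OF \<rho>]] by (simp add: \<Phi>_def)
    show "\<Psi> k (\<Phi> k \<rho>) x = \<rho> x"
    proof (cases "x \<in> carrier (int_power_group k)")
      case True
      have "\<Psi> k (\<Phi> k \<rho>) x = tuple_word Q (\<lambda>i. \<Psi> k (\<Phi> k \<rho>) (std_gen k i)) k x"
        using P True by (intro Q.hom_int_power_group_eq_tuple_word) (auto simp: topspace_Xs)
      also have "\<dots> = tuple_word Q (\<lambda>i. \<rho> (std_gen k i)) k x"
        by (rule tuple_word_cong) (auto simp: gen)
      also have "\<dots> = \<rho> x"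
        using \<rho> True by (intro Q.hom_int_power_group_eq_tuple_word[symmetric]) (auto simp: topspace_Xs)
      finally show ?thesis .
    next
      case False
      then show ?thesis using P \<rho> by (auto simp: topspace_Xs extensional_def)
    qed
  qed
qed

lemma forget_flat_eq:
  assumes \<rho>: "\<rho> \<in> topspace (Xs k)"
  shows "forget_flat k m \<rho> = Matrix.mat k k (\<lambda>(i, j). bracket (fst (\<Phi> k \<rho> i)) (fst (\<Phi> k \<rho> j)) 0 (m - 1))"
proof (rule eq_matI)
  fix i j assume "i < dim_row (Matrix.mat k k (\<lambda>(i, j). bracket (fst (\<Phi> k \<rho> i)) (fst (\<Phi> k \<rho> j)) 0 (m - 1)))"
    "j < dim_col (Matrix.mat k k (\<lambda>(i, j). bracket (fst (\<Phi> k \<rho> i)) (fst (\<Phi> k \<rho> j)) 0 (m - 1)))"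
  then have ij: "i < k" "j < k" by auto
  \<comment> \<open>The same choice of a lift as in \<open>h\<close>, hence the charts of these
    lifts are the coordinates \<open>\<Phi> k \<rho> i\<close> by definition.\<close>
  define M where "M i = (SOME g. g \<in> \<rho> (std_gen k i))" for i
  have M: "M i \<in> carrier U" "\<Phi> k \<rho> i = chart (M i)" if "i < k" for i
  proof -
    obtain N where N: "N \<in> carrier U" "\<rho> (std_gen k i) = coset_of N" using lift_exists[OF \<rho>] .
    show "M i \<in> carrier U" using some_in_coset[OF N(1)] N by (simp add: M_def)
    show "\<Phi> k \<rho> i = chart (M i)" using that by (simp add: M_def \<Phi>_def h_def)
  qed
  have c: "(\<forall>(a, b)\<in>I. bracket (fst (\<Phi> k \<rho> i)) (fst (\<Phi> k \<rho> j)) a b = 0)"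
    using \<Phi>_in[OF \<rho>] ij by (auto simp: comm_tuples_def)
  have com: "bracket (($$) (M i)) (($$) (M j)) a b = 0" if "a < m" "b < m" "(a, b) \<noteq> (0, m - 1)" for a b
  proof (cases "a < b")
    case True
    then have "(a, b) \<in> I" using that by (simp add: I_def)
    then show ?thesis using c that by (auto simp: M(2)[OF ij(1)] M(2)[OF ij(2)] bracket_chart)
  qed (simp add: bracket_zero)
  have "forget_flat k m \<rho> $$ (i, j) = group_commutator U (M i) (M j) $$ (0, m - 1)"
    using ij by (simp add: forget_flat_def M_def Let_def)
  also have "\<dots> = bracket (($$) (M i)) (($$) (M j)) 0 (m - 1)"
    by (rule group_commutator_corner[OF M(1)[OF ij(1)] M(1)[OF ij(2)] com])
  also have "\<dots> = bracket (fst (\<Phi> k \<rho> i)) (fst (\<Phi> k \<rho> j)) 0 (m - 1)"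
    using m2 by (simp add: M(2)[OF ij(1)] M(2)[OF ij(2)] bracket_chart)
  finally show "forget_flat k m \<rho> $$ (i, j) = Matrix.mat k k (\<lambda>(i, j). bracket (fst (\<Phi> k \<rho> i)) (fst (\<Phi> k \<rho> j)) 0 (m - 1)) $$ (i, j)"
    using ij by simp
qed (auto simp: forget_flat_def Let_def)

end

section \<open>Contracting the middle block\<close>

lemma homotopy_equivalent_space_empty:
  assumes "X homotopy_equivalent_space Y"
  shows "topspace X = {} \<longleftrightarrow> topspace Y = {}"
  using assms unfolding homotopy_equivalent_space_def continuous_map_def by blast

lemma continuous_map_euclidean_mult:
  fixes f g :: "'b \<Rightarrow> 'a::real_normed_algebra"
  assumes "continuous_map X euclidean f" "continuous_map X euclidean g"
  shows "continuous_map X euclidean (\<lambda>x. f x * g x)"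
proof -
  have "continuous_map X (prod_topology euclidean euclidean) (\<lambda>x. (f x, g x))"
    using assms by (rule continuous_map_pairedI)
  then have "continuous_map X euclidean (\<lambda>x. (f x, g x))" by simp
  moreover have "continuous_map euclidean euclidean (\<lambda>z. fst z * snd z :: 'a)"
    by (auto intro!: continuous_intros)
  ultimately have "continuous_map X euclidean ((\<lambda>z. fst z * snd z) \<circ> (\<lambda>x. (f x, g x)))"
    by (rule continuous_map_compose)
  then show ?thesis by (simp add: o_def)
qed

lemma path_connected_space_torus: "path_connected_space (torus d)"
proof -
  have "path_connected (sphere 0 1 :: complex set)" by (rule path_connected_sphere) simp
  then show ?thesis
    unfolding torus_def path_connected_space_product_topology by simp
qed

lemma topspace_torus: "topspace (torus d) = {..<d} \<rightarrow>\<^sub>E sphere 0 1"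
  by (simp add: torus_def)

lemma topspace_torus_nonempty: "topspace (torus d) \<noteq> {}"
  unfolding topspace_torus PiE_eq_empty_iff by (auto intro!: exI[of _ 1])

lemma div_mod_lt:
  assumes "e < k * (d::nat)"
  shows "e div d < k" "e mod d < d"
  using assms by (auto simp: less_mult_imp_div_less intro!: mod_less_divisor Nat.gr0I)

lemma block_lt: "i < k \<Longrightarrow> s < d \<Longrightarrow> i * d + s < k * (d::nat)"
proof -
  assume "i < k" "s < d"
  then have "i * d + s < (i + 1) * d" "(i + 1) * d \<le> k * d" using mult_le_mono1[of "i + 1" k d] by auto
  then show ?thesis by linarith
qed

locale unitri_flat = conj_field cj + unitri_circle S m d \<epsilon>
  for cj :: "'a::real_normed_field \<Rightarrow> 'a" and S :: "'a set" and m d :: nat and \<epsilon> :: "'a \<Rightarrow> nat \<Rightarrow> complex" +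
  fixes n :: nat
  assumes m_eq: "m = n + 2"
begin

lemma I_iff: "(a, b) \<in> I \<longleftrightarrow> a < b \<and> b \<le> n + 1 \<and> \<not> (a = 0 \<and> b = n + 1)"
  unfolding I_def using m_eq by auto

lemma bracket_corner: "bracket M N 0 (n + 1) =
  (\<Sum>l<n. M (0, l + 1) * N (l + 1, n + 1) - N (0, l + 1) * M (l + 1, n + 1))"
proof -
  have "{0<..<n + 1} = Suc ` {..<n}"
    by (auto simp: image_iff) (metis Suc_less_eq Suc_pred lessThan_iff)
  then show ?thesis unfolding bracket_def by (simp add: sum.reindex)
qed

text \<open>The fibre over the class with matrix \<open>B\<close>, in chart coordinates.\<close>

definition Zs :: "nat \<Rightarrow> (nat \<Rightarrow> nat \<Rightarrow> 'a) \<Rightarrow> (nat \<Rightarrow> 'a coords) set" where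
  "Zs k B = {y \<in> topspace (PY k). \<forall>i<k. \<forall>j<k.
      (\<forall>a b. (a, b) \<in> I \<longrightarrow> bracket (fst (y i)) (fst (y j)) a b = 0) \<and>
      bracket (fst (y i)) (fst (y j)) 0 (n + 1) = B i j}"

text \<open>The first row supplies the coordinates below \<open>n\<close>, the last column the
  remaining ones, both shifted by one because the middle indices of the matrix run from 1 to
  \<open>n\<close>. With this arrangement the corner bracket is \<open>om\<close>.\<close>

definition border :: "nat \<Rightarrow> (nat \<Rightarrow> 'a coords) \<Rightarrow> nat \<Rightarrow> nat \<Rightarrow> 'a" where
  "border k y = (\<lambda>i l. if i < k \<and> l < 2 * n
     then (if l < n then fst (y i) (0, l + 1) else fst (y i) (l - n + 1, n + 1)) else 0)"

text \<open>The \<open>k\<close> tori of dimension \<open>d\<close> are laid out as one torus, with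
  angle \<open>s\<close> of generator \<open>i\<close> at position \<open>i * d + s\<close>.\<close>

definition angles :: "nat \<Rightarrow> (nat \<Rightarrow> 'a coords) \<Rightarrow> nat \<Rightarrow> complex" where
  "angles k y = (\<lambda>e\<in>{..<k * d}. snd (y (e div d)) (e mod d))"

definition tuple_of :: "nat \<Rightarrow> (nat \<Rightarrow> nat \<Rightarrow> 'a) \<Rightarrow> (nat \<Rightarrow> complex) \<Rightarrow> nat \<Rightarrow> 'a coords" where
  "tuple_of k w z = (\<lambda>i\<in>{..<k}.
     (\<lambda>p\<in>I. if fst p = 0 then w i (snd p - 1) else if snd p = n + 1 then w i (n + fst p - 1) else 0,
      \<lambda>s\<in>{..<d}. z (i * d + s)))"

text \<open>Multiplies by \<open>t\<close> the middle block alone; first row, last column and corner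
  stay as they are.\<close>

definition shrink :: "nat \<Rightarrow> real \<Rightarrow> (nat \<Rightarrow> 'a coords)
    \<Rightarrow> nat \<Rightarrow> 'a coords" where
  "shrink k t y = (\<lambda>i\<in>{..<k}.
     (\<lambda>p\<in>I. if fst p = 0 \<or> snd p = n + 1 then fst (y i) p else of_real t * fst (y i) p, snd (y i)))"

lemma topspace_PY: "y \<in> topspace (PY k) \<longleftrightarrow> y \<in> extensional {..<k} \<and>
   (\<forall>i<k. fst (y i) \<in> extensional I \<and> snd (y i) \<in> topspace (torus d))"
  by (auto simp: PY_def Y_def PiE_iff topspace_Off mem_Times_iff)

lemma om_border:
  assumes "i < k" "j < k"
  shows "om n (border k y i) (border k y j) = bracket (fst (y i)) (fst (y j)) 0 (n + 1)"
  unfolding bracket_corner om_def using assms by (intro sum.cong refl) (simp add: border_def mult.commute)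

lemma border_in: "y \<in> Zs k B \<Longrightarrow> border k y \<in> gram_set k n B"
  by (auto simp: gram_set_def om_border Zs_def)

lemma tuple_of_in:
  assumes w: "w \<in> gram_set k n B" and z: "z \<in> topspace (torus (k * d))"
  shows "tuple_of k w z \<in> Zs k B"
proof -
  have "tuple_of k w z \<in> topspace (PY k)"
    using z block_lt by (auto simp: topspace_PY tuple_of_def topspace_torus PiE_iff)
  moreover have "bracket (fst (tuple_of k w z i)) (fst (tuple_of k w z j)) a b = 0"
    if "i < k" "j < k" "(a, b) \<in> I" for i j a b
    unfolding bracket_def
  proof (rule sum.neutral, rule ballI)
    fix l assume "l \<in> {a<..<b}"
    then show "fst (tuple_of k w z i) (a, l) * fst (tuple_of k w z j) (l, b)
        - fst (tuple_of k w z j) (a, l) * fst (tuple_of k w z i) (l, b) = 0"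
      using that by (cases "a = 0") (auto simp: tuple_of_def I_iff)
  qed
  moreover have "bracket (fst (tuple_of k w z i)) (fst (tuple_of k w z j)) 0 (n + 1) = B i j"
    if "i < k" "j < k" for i j
  proof -
    have "bracket (fst (tuple_of k w z i)) (fst (tuple_of k w z j)) 0 (n + 1) = om n (w i) (w j)"
      unfolding bracket_corner om_def using that
      by (intro sum.cong refl) (simp add: tuple_of_def I_iff mult.commute)
    then show ?thesis using w that by (simp add: gram_set_def)
  qed
  ultimately show ?thesis by (simp add: Zs_def)
qed

lemma shrink_bracket:
  assumes "i < k" "j < k" "(a, b) \<in> I"
  shows "\<exists>c. bracket (fst (shrink k t y i)) (fst (shrink k t y j)) a b = c * bracket (fst (y i)) (fst (y j)) a b"
proof -
  \<comment> \<open>In a bracket in the first row or last column exactly one factor of each product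
    lies in the middle block; in the middle block both do. The vanishing of the brackets thus
    survives, also at t = 0.\<close>
  let ?c = "if a = 0 \<or> b = n + 1 then of_real t else of_real t * of_real t :: 'a"
  have "bracket (fst (shrink k t y i)) (fst (shrink k t y j)) a b = ?c * bracket (fst (y i)) (fst (y j)) a b"
    unfolding bracket_def sum_distrib_left
  proof (rule sum.cong[OF refl])
    fix l assume l: "l \<in> {a<..<b}"
    then have "(a, l) \<in> I" "(l, b) \<in> I" using assms(3) by (auto simp: I_iff)
    then show "fst (shrink k t y i) (a, l) * fst (shrink k t y j) (l, b)
        - fst (shrink k t y j) (a, l) * fst (shrink k t y i) (l, b)
      = ?c * (fst (y i) (a, l) * fst (y j) (l, b) - fst (y j) (a, l) * fst (y i) (l, b))"
      using assms l by (auto simp: shrink_def I_iff algebra_simps)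
  qed
  then show ?thesis by blast
qed

lemma shrink_in:
  assumes y: "y \<in> Zs k B"
  shows "shrink k t y \<in> Zs k B"
proof -
  have "shrink k t y \<in> topspace (PY k)"
    using y by (auto simp: Zs_def topspace_PY shrink_def)
  moreover have "bracket (fst (shrink k t y i)) (fst (shrink k t y j)) a b = 0"
    if "i < k" "j < k" "(a, b) \<in> I" for i j a b
    using shrink_bracket[OF that, of t y] y that by (auto simp: Zs_def)
  moreover have "bracket (fst (shrink k t y i)) (fst (shrink k t y j)) 0 (n + 1) = B i j" if "i < k" "j < k" for i j
  proof -
    have "bracket (fst (shrink k t y i)) (fst (shrink k t y j)) 0 (n + 1) = bracket (fst (y i)) (fst (y j)) 0 (n + 1)"
      unfolding bracket_corner using that by (intro sum.cong refl) (simp add: shrink_def I_iff)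
    then show ?thesis using y that by (simp add: Zs_def)
  qed
  ultimately show ?thesis by (simp add: Zs_def)
qed

lemma shrink_0:
  assumes y: "y \<in> topspace (PY k)"
  shows "shrink k 0 y = tuple_of k (border k y) (angles k y)"
proof
  fix i
  show "shrink k 0 y i = tuple_of k (border k y) (angles k y) i"
  proof (cases "i < k")
    case True
    have "fst (shrink k 0 y i) p = fst (tuple_of k (border k y) (angles k y) i) p" for p
      using True by (cases p) (auto simp: shrink_def tuple_of_def border_def I_iff)
    moreover have "snd (shrink k 0 y i) s = snd (tuple_of k (border k y) (angles k y) i) s" for s
      using True y block_lt[OF True, of s]
      by (auto simp: shrink_def tuple_of_def angles_def topspace_PY topspace_torus PiE_iff extensional_def)
    ultimately show ?thesis by (simp add: prod_eq_iff fun_eq_iff)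
  qed (simp add: shrink_def tuple_of_def)
qed

lemma shrink_1:
  assumes y: "y \<in> topspace (PY k)"
  shows "shrink k 1 y = y"
proof
  fix i
  show "shrink k 1 y i = y i"
  proof (cases "i < k")
    case True
    have "fst (shrink k 1 y i) p = fst (y i) p" for p
      using True y by (cases p) (auto simp: shrink_def topspace_PY extensional_def)
    then show ?thesis using True by (simp add: shrink_def prod_eq_iff fun_eq_iff)
  qed (use y in \<open>auto simp: shrink_def topspace_PY extensional_def\<close>)
qed

text \<open>What remains of a tuple of vectors after passing to matrices and back.\<close>

definition truncate :: "nat \<Rightarrow> (nat \<Rightarrow> nat \<Rightarrow> 'a) \<Rightarrow> nat \<Rightarrow> nat \<Rightarrow> 'a" where
  "truncate k w = (\<lambda>i l. if i < k \<and> l < 2 * n then w i l else 0)"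

lemma border_tuple_of: "border k (tuple_of k w z) = truncate k w"
  by (auto simp: border_def tuple_of_def truncate_def I_iff fun_eq_iff)

lemma angles_tuple_of:
  assumes "z \<in> topspace (torus (k * d))"
  shows "angles k (tuple_of k w z) = z"
proof
  fix e show "angles k (tuple_of k w z) e = z e"
    using assms div_mod_lt[of e k d]
    by (cases "e < k * d") (auto simp: angles_def tuple_of_def topspace_torus PiE_iff extensional_def)
qed

lemma continuous_map_PY_entry:
  "i < k \<Longrightarrow> p \<in> I \<Longrightarrow> continuous_map (PY k) euclidean (\<lambda>y. fst (y i) p)"
proof -
  assume ip: "i < k" "p \<in> I"
  have "continuous_map (PY k) Y (\<lambda>y. y i)"
    unfolding PY_def by (rule continuous_map_product_projection) (use ip in simp)
  from continuous_map_compose[OF continuous_map_compose[OF this[unfolded Y_def] continuous_map_fst]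
      continuous_map_product_projection[of p I "\<lambda>_. euclidean :: 'a topology", folded Off_def]] ip
  show ?thesis by (simp add: o_def)
qed

lemma continuous_map_PY_snd: "i < k \<Longrightarrow> continuous_map (PY k) (torus d) (\<lambda>y. snd (y i))"
proof -
  assume i: "i < k"
  have "continuous_map (PY k) Y (\<lambda>y. y i)"
    unfolding PY_def by (rule continuous_map_product_projection) (use i in simp)
  from continuous_map_compose[OF this[unfolded Y_def] continuous_map_snd]
  show ?thesis by (simp add: o_def)
qed

lemma continuous_map_border: "continuous_map (PY k) euclidean (border k)"
proof (rule continuous_map_fun2I)
  fix i l
  have "continuous_map (PY k) euclidean (\<lambda>y. fst (y i) (0, l + 1))" if "i < k" "l < n"
    using that by (intro continuous_map_PY_entry) (auto simp: I_iff)
  moreover have "continuous_map (PY k) euclidean (\<lambda>y. fst (y i) (l - n + 1, n + 1))" if "i < k" "\<not> l < n" "l < 2 * n"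
    using that by (intro continuous_map_PY_entry) (auto simp: I_iff)
  ultimately show "continuous_map (PY k) euclidean (\<lambda>y. border k y i l)"
    unfolding border_def by (cases "i < k"; cases "l < n"; cases "l < 2 * n") simp_all
qed

lemma continuous_map_angles: "continuous_map (PY k) (torus (k * d)) (angles k)"
  unfolding torus_def[of "k * d"] continuous_map_componentwise
proof (intro conjI ballI)
  fix e assume e: "e \<in> {..<k * d}"
  then have lt: "e div d < k" "e mod d < d" using div_mod_lt by auto
  have "continuous_map (PY k) (top_of_set (sphere 0 1)) ((\<lambda>f. f (e mod d)) \<circ> (\<lambda>y. snd (y (e div d))))"
    by (rule continuous_map_compose[OF continuous_map_PY_snd[OF lt(1), unfolded torus_def]])
      (rule continuous_map_product_projection, use lt in simp)
  then show "continuous_map (PY k) (top_of_set (sphere 0 1)) (\<lambda>y. angles k y e)"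
    using e by (simp add: angles_def o_def)
qed (auto simp: angles_def)

lemma continuous_map_tuple_of:
  "continuous_map (prod_topology euclidean (torus (k * d))) (PY k) (\<lambda>x. tuple_of k (fst x) (snd x))"
  unfolding PY_def continuous_map_componentwise
proof (intro conjI ballI)
  let ?D = "prod_topology (euclidean :: (nat \<Rightarrow> nat \<Rightarrow> 'a) topology) (torus (k * d))"
  fix i assume i: "i \<in> {..<k}"
  have w: "continuous_map ?D euclidean (\<lambda>x. fst x i l)" for l
  proof -
    have "continuous_map euclidean euclidean (\<lambda>w :: nat \<Rightarrow> nat \<Rightarrow> 'a. w i l)"
      using continuous_on_coord2[OF continuous_on_id] by auto
    from continuous_map_compose[OF continuous_map_fst this] show ?thesis by (simp add: o_def)
  qed
  have z: "continuous_map ?D (top_of_set (sphere 0 1)) (\<lambda>x. snd x (i * d + s))" if "s < d" for s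
  proof -
    have "continuous_map (torus (k * d)) (top_of_set (sphere 0 1)) (\<lambda>z. z (i * d + s))"
      unfolding torus_def by (rule continuous_map_product_projection) (use i block_lt that in auto)
    from continuous_map_compose[OF continuous_map_snd this] show ?thesis by (simp add: o_def)
  qed
  have "continuous_map ?D Off (\<lambda>x. \<lambda>p\<in>I. if fst p = 0 then fst x i (snd p - 1)
      else if snd p = n + 1 then fst x i (n + fst p - 1) else 0)"
    unfolding Off_def continuous_map_componentwise
    using w by auto
  moreover have "continuous_map ?D (torus d) (\<lambda>x. \<lambda>s\<in>{..<d}. snd x (i * d + s))"
    unfolding torus_def[of d] continuous_map_componentwise using z by auto
  ultimately show "continuous_map ?D Y (\<lambda>x. tuple_of k (fst x) (snd x) i)"
    unfolding Y_def tuple_of_def using i by (simp add: continuous_map_pairedI)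
qed (auto simp: tuple_of_def)

lemma continuous_map_shrink:
  "continuous_map (prod_topology (top_of_set {0..1}) (PY k)) (PY k) (\<lambda>x. shrink k (fst x) (snd x))"
  unfolding PY_def[of k] continuous_map_componentwise
  unfolding PY_def[symmetric]
proof (intro conjI ballI)
  let ?D = "prod_topology (top_of_set {0..1::real}) (PY k)"
  fix i assume i: "i \<in> {..<k}"
  have t: "continuous_map ?D euclidean (\<lambda>x. of_real (fst x) :: 'a)"
  proof -
    have "continuous_map (top_of_set {0..1::real}) euclidean (of_real :: real \<Rightarrow> 'a)"
      by (auto intro!: continuous_intros)
    from continuous_map_compose[OF continuous_map_fst this] show ?thesis by (simp add: o_def)
  qed
  have e: "continuous_map ?D euclidean (\<lambda>x. fst (snd x i) p)" if "p \<in> I" for p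
    using continuous_map_compose[OF continuous_map_snd continuous_map_PY_entry[OF _ that, of i k]] i
    by (simp add: o_def)
  have "continuous_map ?D Off (\<lambda>x. \<lambda>p\<in>I. if fst p = 0 \<or> snd p = n + 1 then fst (snd x i) p
      else of_real (fst x) * fst (snd x i) p)"
    unfolding Off_def continuous_map_componentwise
  proof (intro conjI ballI)
    fix p assume "p \<in> I"
    then show "continuous_map ?D euclidean (\<lambda>x. (\<lambda>p\<in>I. if fst p = 0 \<or> snd p = n + 1 then fst (snd x i) p
      else of_real (fst x) * fst (snd x i) p) p)"
      using e continuous_map_euclidean_mult[OF t e]
      by (cases "fst p = 0 \<or> snd p = n + 1") (simp_all del: disj_not1)
  qed auto
  moreover have "continuous_map ?D (torus d) (\<lambda>x. snd (snd x i))"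
    using continuous_map_compose[OF continuous_map_snd continuous_map_PY_snd[of i k]] i by (simp add: o_def)
  ultimately show "continuous_map ?D Y (\<lambda>x. shrink k (fst x) (snd x) i)"
    unfolding Y_def shrink_def using i by (simp add: continuous_map_pairedI)
qed (auto simp: shrink_def)

text \<open>On the fibre the homotopy is \<open>shrink\<close>, which at t = 0 leaves exactly what
  \<open>tuple_of\<close> reconstructs. On the other side \<open>truncate\<close> is joined to the
  identity by a line that moves only unconstrained values.\<close>

lemma Zs_homotopy_equivalent:
  "subtopology (PY k) (Zs k B) homotopy_equivalent_space
     prod_topology (top_of_set (gram_set k n B)) (torus (k * d))"
proof (rule homotopy_equivalent_spaceI[where f = "\<lambda>y. (border k y, angles k y)"
      and g = "\<lambda>x. tuple_of k (fst x) (snd x)" and H = "\<lambda>x. shrink k (fst x) (snd x)"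
      and K = "\<lambda>x. (lin_path (fst x) (truncate k (fst (snd x))) (fst (snd x)), snd (snd x))"])
  let ?Z = "subtopology (PY k) (Zs k B)" and ?G = "top_of_set (gram_set k n B)"
  have tZ: "topspace ?Z = Zs k B" by (auto simp: Zs_def)
  show "continuous_map ?Z (prod_topology ?G (torus (k * d))) (\<lambda>y. (border k y, angles k y))"
  proof (rule continuous_map_pairedI)
    show "continuous_map ?Z ?G (border k)"
      using continuous_map_from_subtopology[OF continuous_map_border] border_in tZ
      by (auto simp: continuous_map_in_subtopology)
    show "continuous_map ?Z (torus (k * d)) (angles k)"
      by (rule continuous_map_from_subtopology[OF continuous_map_angles])
  qed
  have "continuous_map (prod_topology ?G (torus (k * d))) (PY k) (\<lambda>x. tuple_of k (fst x) (snd x))"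
    using continuous_map_from_subtopology[OF continuous_map_tuple_of, of k "gram_set k n B \<times> topspace (torus (k * d))"]
    by (simp add: prod_topology_subtopology(1)[symmetric] subtopology_Times subtopology_topspace)
  then show "continuous_map (prod_topology ?G (torus (k * d))) ?Z (\<lambda>x. tuple_of k (fst x) (snd x))"
    using tuple_of_in by (auto simp: continuous_map_in_subtopology)
  have "continuous_map (prod_topology (top_of_set {0..1}) ?Z) (PY k) (\<lambda>x. shrink k (fst x) (snd x))"
    using continuous_map_from_subtopology[OF continuous_map_shrink, of k "UNIV \<times> Zs k B"]
    by (simp add: subtopology_Times)
  then show "continuous_map (prod_topology (top_of_set {0..1}) ?Z) ?Z (\<lambda>x. shrink k (fst x) (snd x))"
    using shrink_in tZ by (auto simp: continuous_map_in_subtopology)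
  show "continuous_map (prod_topology (top_of_set {0..1}) (prod_topology ?G (torus (k * d))))
     (prod_topology ?G (torus (k * d)))
     (\<lambda>x. (lin_path (fst x) (truncate k (fst (snd x))) (fst (snd x)), snd (snd x)))"
  proof (rule continuous_map_pairedI)
    let ?D = "prod_topology (top_of_set {0..1::real}) (prod_topology ?G (torus (k * d)))"
    have p: "continuous_map ?D (prod_topology (top_of_set {0..1::real}) ?G) (\<lambda>x. (fst x, fst (snd x)))"
      using continuous_map_compose[OF continuous_map_snd[of "top_of_set {0..1::real}"] continuous_map_fst[of ?G "torus (k * d)"]]
      by (intro continuous_map_pairedI continuous_map_fst) (simp add: o_def)
    have tr: "continuous_on UNIV (truncate k)"
      unfolding truncate_def
    proof (rule continuous_on_fun2I)
      fix i l show "continuous_on UNIV (\<lambda>w :: nat \<Rightarrow> nat \<Rightarrow> 'a. if i < k \<and> l < 2 * n then w i l else 0)"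
        by (cases "i < k \<and> l < 2 * n") (auto intro: continuous_on_coord2[OF continuous_on_id])
    qed
    have lp: "lin_path t (truncate k w) w \<in> gram_set k n B" if "w \<in> gram_set k n B" for t w
    proof -
      have eq: "lin_path t (truncate k w) w i l = w i l" if "i < k" "l < 2 * n" for i l
        using that by (simp add: lin_path_def truncate_def algebra_simps)
      have "om n (lin_path t (truncate k w) w i) (lin_path t (truncate k w) w j) = om n (w i) (w j)" if "i < k" "j < k" for i j
        using that by (intro om_cong) (simp_all add: eq)
      then show ?thesis using that by (simp add: gram_set_def)
    qed
    have "continuous_on ({0..1} \<times> gram_set k n B) (\<lambda>z. lin_path (fst z) (truncate k (snd z)) (snd z))"
      by (intro continuous_on_lin_path continuous_on_compose2[OF tr] continuous_on_fst continuous_on_snd continuous_on_id) auto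
    then have "continuous_map (prod_topology (top_of_set {0..1::real}) ?G) ?G (\<lambda>z. lin_path (fst z) (truncate k (snd z)) (snd z))"
      using lp by (auto simp: continuous_map_in_subtopology)
    from continuous_map_compose[OF p this]
    show "continuous_map ?D ?G (\<lambda>x. lin_path (fst x) (truncate k (fst (snd x))) (fst (snd x)))"
      by (simp add: o_def)
    show "continuous_map ?D (torus (k * d)) (\<lambda>x. snd (snd x))"
      using continuous_map_compose[OF continuous_map_snd[of "top_of_set {0..1::real}"] continuous_map_snd[of ?G "torus (k * d)"]]
      by (simp add: o_def)
  qed
qed (auto simp: Zs_def shrink_0 shrink_1 border_tuple_of angles_tuple_of)

end

section \<open>Path components\<close>

lemma connected_discrete_singleton:
  fixes A :: "'a::real_normed_vector set"
  assumes conn: "connected A" and disc: "\<And>x y. x \<in> A \<Longrightarrow> y \<in> A \<Longrightarrow> norm (x - y) < 1 \<Longrightarrow> x = y"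
    and xy: "x \<in> A" "y \<in> A"
  shows "x = y"
proof -
  have eq: "{x} = A \<inter> ball x 1" using xy(1) by (auto simp: dist_norm dest: disc[OF xy(1)])
  have "openin (top_of_set A) {x}" unfolding eq by (rule openin_open_Int) simp
  moreover have "closedin (top_of_set A) {x}" using xy(1) by (simp add: closed_subset)
  ultimately have "{x} = A" using conn unfolding connected_clopen by blast
  then show ?thesis using xy(2) by blast
qed

context unitri_flat
begin

abbreviation "ff k \<equiv> forget_flat k m :: ((nat \<Rightarrow> int) \<Rightarrow> 'a mat set) \<Rightarrow> 'a mat"

definition comp :: "nat \<Rightarrow> 'a mat \<Rightarrow> ((nat \<Rightarrow> int) \<Rightarrow> 'a mat set) set" where
  "comp k \<beta> = {\<rho> \<in> topspace (Xs k). ff k \<rho> = \<beta>}"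

lemma m1: "m - 1 = n + 1" using m_eq by simp

lemma bracket_antisym: "bracket N M a b = - bracket M N a b"
  by (simp add: bracket_def sum_negf[symmetric])

lemma antisym_mats_iff:
  "\<beta> \<in> antisym_mats k S \<longleftrightarrow> \<beta> \<in> carrier_mat k k \<and> (\<forall>i<k. \<forall>j<k. \<beta> $$ (i, j) \<in> S \<and> \<beta> $$ (j, i) = - \<beta> $$ (i, j))"
proof
  assume b: "\<beta> \<in> antisym_mats k S"
  then have c: "\<beta> \<in> carrier_mat k k" and e: "elements_mat \<beta> \<subseteq> S" and t: "transpose_mat \<beta> = - \<beta>"
    by (auto simp: antisym_mats_def)
  have "\<beta> $$ (i, j) \<in> S \<and> \<beta> $$ (j, i) = - \<beta> $$ (i, j)" if "i < k" "j < k" for i j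
  proof -
    have "transpose_mat \<beta> $$ (i, j) = (- \<beta>) $$ (i, j)" using t by simp
    then show ?thesis using c e that by auto
  qed
  then show "\<beta> \<in> carrier_mat k k \<and> (\<forall>i<k. \<forall>j<k. \<beta> $$ (i, j) \<in> S \<and> \<beta> $$ (j, i) = - \<beta> $$ (i, j))"
    using c by blast
next
  assume b: "\<beta> \<in> carrier_mat k k \<and> (\<forall>i<k. \<forall>j<k. \<beta> $$ (i, j) \<in> S \<and> \<beta> $$ (j, i) = - \<beta> $$ (i, j))"
  then have c: "\<beta> \<in> carrier_mat k k" by blast
  have "transpose_mat \<beta> = - \<beta>"
  proof (rule eq_matI)
    fix i j assume "i < dim_row (- \<beta>)" "j < dim_col (- \<beta>)"
    then have ij: "i < k" "j < k" using c by auto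
    then have "\<beta> $$ (j, i) = - \<beta> $$ (i, j)" using b by blast
    then show "transpose_mat \<beta> $$ (i, j) = (- \<beta>) $$ (i, j)" using c ij by simp
  qed (use c in auto)
  moreover have "elements_mat \<beta> \<subseteq> S"
  proof
    fix a assume "a \<in> elements_mat \<beta>"
    then obtain i j where "i < k" "j < k" "a = \<beta> $$ (i, j)" using c by (auto dest!: elements_matD)
    then show "a \<in> S" using b by blast
  qed
  ultimately show "\<beta> \<in> antisym_mats k S" using c by (simp add: antisym_mats_def)
qed

lemma antisym_mats_carrier: "\<beta> \<in> antisym_mats k S \<Longrightarrow> \<beta> \<in> carrier_mat k k"
  by (simp add: antisym_mats_def)

lemma ff_entry:
  "\<rho> \<in> topspace (Xs k) \<Longrightarrow> i < k \<Longrightarrow> j < k \<Longrightarrow>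
    ff k \<rho> $$ (i, j) = bracket (fst (\<Phi> k \<rho> i)) (fst (\<Phi> k \<rho> j)) 0 (m - 1)"
  by (simp add: forget_flat_eq)

lemma ff_in_antisym_mats: "\<rho> \<in> topspace (Xs k) \<Longrightarrow> ff k \<rho> \<in> antisym_mats k S"
proof -
  assume \<rho>: "\<rho> \<in> topspace (Xs k)"
  have "ff k \<rho> $$ (i, j) \<in> S \<and> ff k \<rho> $$ (j, i) = - ff k \<rho> $$ (i, j)" if ij: "i < k" "j < k" for i j
    unfolding ff_entry[OF \<rho> ij] ff_entry[OF \<rho> ij(2,1)]
    using \<Phi>_in[OF \<rho>] ij by (intro conjI bracket_antisym) (simp add: comm_tuples_def)
  moreover have "ff k \<rho> \<in> carrier_mat k k" by (simp add: forget_flat_eq[OF \<rho>])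
  ultimately show ?thesis unfolding antisym_mats_iff by blast
qed

lemma comp_homeomorphic:
  assumes \<beta>: "\<beta> \<in> antisym_mats k S"
  shows "subtopology (Xs k) (comp k \<beta>) homeomorphic_space subtopology (PY k) (Zs k (\<lambda>i j. \<beta> $$ (i, j)))"
proof -
  let ?Z = "Zs k (\<lambda>i j. \<beta> $$ (i, j))"
  have sub: "?Z \<subseteq> comm_tuples k"
  proof -
    have "\<beta> $$ (i, j) \<in> S" if "i < k" "j < k" for i j
      using \<beta> that unfolding antisym_mats_iff by blast
    then show ?thesis unfolding Zs_def comm_tuples_def m1 by auto
  qed
  have tc: "topspace (subtopology (PY k) (comm_tuples k)) = comm_tuples k" by (auto simp: comm_tuples_def)
  have iff: "\<rho> \<in> comp k \<beta> \<longleftrightarrow> \<Phi> k \<rho> \<in> ?Z" if \<rho>: "\<rho> \<in> topspace (Xs k)" for \<rho>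
  proof -
    have b: "bracket (fst (\<Phi> k \<rho> i)) (fst (\<Phi> k \<rho> j)) 0 (n + 1) = ff k \<rho> $$ (i, j)" if "i < k" "j < k" for i j
      using ff_entry[OF \<rho> that] unfolding m1 by simp
    have c: "ff k \<rho> \<in> carrier_mat k k" "\<beta> \<in> carrier_mat k k"
      using ff_in_antisym_mats[OF \<rho>] \<beta> by (auto intro: antisym_mats_carrier)
    have "ff k \<rho> = \<beta> \<longleftrightarrow> (\<forall>i<k. \<forall>j<k. ff k \<rho> $$ (i, j) = \<beta> $$ (i, j))"
      using c by (auto intro!: eq_matI)
    moreover have "\<Phi> k \<rho> \<in> topspace (PY k)" using \<Phi>_in[OF \<rho>] by (simp add: comm_tuples_def)
    moreover have "bracket (fst (\<Phi> k \<rho> i)) (fst (\<Phi> k \<rho> j)) a b = 0" if "i < k" "j < k" "(a, b) \<in> I" for i j a b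
      using \<Phi>_in[OF \<rho>] that unfolding comm_tuples_def by blast
    ultimately show ?thesis using \<rho> b by (simp add: comp_def Zs_def)
  qed
  have "homeomorphic_map (Xs k) (subtopology (PY k) (comm_tuples k)) (\<Phi> k)"
    using homeomorphic_maps_\<Phi> homeomorphic_map_maps by blast
  then have "homeomorphic_map (subtopology (Xs k) (comp k \<beta>))
      (subtopology (subtopology (PY k) (comm_tuples k)) ?Z) (\<Phi> k)"
    by (rule homeomorphic_map_subtopologies_alt) (simp add: iff)
  moreover have "comm_tuples k \<inter> ?Z = ?Z" using sub by blast
  ultimately show ?thesis
    by (metis homeomorphic_map_imp_homeomorphic_space subtopology_subtopology)
qed

lemma comp_homotopy_equivalent_frames:
  assumes \<beta>: "\<beta> \<in> antisym_mats k S" and red: "symp_reduction k (\<lambda>i j. \<beta> $$ (i, j)) r \<xi> \<eta>"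
  shows "subtopology (Xs k) (comp k \<beta>) homotopy_equivalent_space
    prod_topology (top_of_set (frames n r :: 'a frame set)) (torus (k * d))"
proof -
  have anti: "\<beta> $$ (b, a) = - \<beta> $$ (a, b)" if "a < k" "b < k" for a b
    using \<beta> that unfolding antisym_mats_iff by blast
  note homeomorphic_imp_homotopy_equivalent_space[OF comp_homeomorphic[OF \<beta>]]
  also note Zs_homotopy_equivalent
  also note homotopy_equivalent_space_prod_left[OF gram_set_homotopy_equivalent_frames[OF anti red]]
  finally show ?thesis .
qed

lemma path_connected_comp:
  assumes \<beta>: "\<beta> \<in> antisym_mats k S"
  shows "path_connectedin (Xs k) (comp k \<beta>)"
proof -
  have anti: "\<beta> $$ (b, a) = - \<beta> $$ (a, b)" if "a < k" "b < k" for a b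
    using \<beta> that unfolding antisym_mats_iff by blast
  obtain r \<xi> \<eta> where red: "symp_reduction k (\<lambda>i j. \<beta> $$ (i, j)) r \<xi> \<eta>"
    using ex_symp_reduction[of k "\<lambda>i j. \<beta> $$ (i, j)"] anti by blast
  have "path_connected_space (top_of_set (frames n r :: 'a frame set))"
    using path_connected_frames by simp
  then have "path_connected_space (prod_topology (top_of_set (frames n r :: 'a frame set)) (torus (k * d)))"
    using path_connected_space_torus by (simp add: path_connected_space_prod_topology)
  then have "path_connected_space (subtopology (Xs k) (comp k \<beta>))"
    by (rule path_connected_space_homotopy_equivalent[OF comp_homotopy_equivalent_frames[OF \<beta> red]])
  then show ?thesis by (auto simp: path_connectedin_def comp_def)
qed

lemma continuous_map_ff_entry:
  assumes "i < k" "j < k"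
  shows "continuous_map (Xs k) euclidean (\<lambda>\<rho>. bracket (fst (\<Phi> k \<rho> i)) (fst (\<Phi> k \<rho> j)) 0 (m - 1))"
proof -
  have c: "continuous_map (Xs k) (PY k) (\<Phi> k)"
    using homeomorphic_maps_\<Phi> by (auto simp: homeomorphic_maps_def continuous_map_in_subtopology)
  have e: "continuous_map (Xs k) euclidean (\<lambda>\<rho>. fst (\<Phi> k \<rho> s) p)" if "s < k" "p \<in> I" for s p
    using continuous_map_compose[OF c continuous_map_PY_entry[OF that]] by (simp add: o_def)
  show ?thesis
    unfolding m1 bracket_corner
    by (intro continuous_map_sum continuous_map_diff continuous_map_euclidean_mult e assms) (auto simp: I_iff)
qed

text \<open>Each entry of the class is a continuous function with values in \<open>S\<close>,
  distinct elements of which have distance at least 1; its image of a path-connected set is a single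
  point.\<close>

lemma ff_constant:
  assumes K: "path_connectedin (Xs k) K" and \<rho>: "\<rho> \<in> K" "\<rho>' \<in> K"
  shows "ff k \<rho> = ff k \<rho>'"
proof -
  have sub: "K \<subseteq> topspace (Xs k)" using K by (simp add: path_connectedin_def)
  have "ff k \<rho> $$ (i, j) = ff k \<rho>' $$ (i, j)" if ij: "i < k" "j < k" for i j
  proof -
    define c where "c \<sigma> = bracket (fst (\<Phi> k \<sigma> i)) (fst (\<Phi> k \<sigma> j)) 0 (m - 1)" for \<sigma>
    have "path_connectedin euclidean (c ` K)"
      using continuous_map_ff_entry[OF ij] K unfolding c_def by (rule path_connectedin_continuous_map_image)
    then have conn: "connected (c ` K)" by (simp add: path_connected_imp_connected)
    have cS: "c \<sigma> \<in> S" if "\<sigma> \<in> K" for \<sigma>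
      using \<Phi>_in[of \<sigma> k] that sub ij by (auto simp: c_def comm_tuples_def)
    have disc: "x = y" if "x \<in> c ` K" "y \<in> c ` K" "norm (x - y) < 1" for x y
      using discrete[of "x - y"] diff_in[of x y] that cS by auto
    have "c \<rho> = c \<rho>'"
      by (rule connected_discrete_singleton[OF conn disc]) (use \<rho> in auto)
    then show ?thesis using ff_entry ij \<rho> sub by (simp add: c_def subset_iff)
  qed
  then show ?thesis
    using sub \<rho> by (intro eq_matI) (auto simp: subset_iff forget_flat_eq)
qed

text \<open>Constancy of the class puts the component inside its fibre; the fibre is path-connected
  and meets the component, so it is contained in it.\<close>

lemma path_component_eq_comp:
  assumes K: "K \<in> path_components_of (Xs k)" and \<rho>: "\<rho> \<in> K"
  shows "K = comp k (ff k \<rho>)"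
proof -
  have sub: "K \<subseteq> topspace (Xs k)" using path_components_of_subset[OF K] .
  have pc: "path_connectedin (Xs k) K" by (rule path_connectedin_path_components_of[OF K])
  have "K \<subseteq> comp k (ff k \<rho>)" using ff_constant[OF pc _ \<rho>] sub by (auto simp: comp_def)
  moreover have "comp k (ff k \<rho>) \<subseteq> K"
  proof (rule path_components_of_maximal[OF K])
    show "path_connectedin (Xs k) (comp k (ff k \<rho>))"
      by (rule path_connected_comp[OF ff_in_antisym_mats]) (use \<rho> sub in blast)
    show "\<not> disjnt K (comp k (ff k \<rho>))" using \<rho> sub by (auto simp: disjnt_iff comp_def)
  qed
  ultimately show ?thesis by blast
qed

text \<open>Homotopy equivalent spaces are empty together, and the torus is never empty, so only the
  existence of frames matters.\<close>

lemma comp_nonempty_iff: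
  assumes \<beta>: "\<beta> \<in> antisym_mats k S" and red: "symp_reduction k (\<lambda>i j. \<beta> $$ (i, j)) r \<xi> \<eta>"
  shows "comp k \<beta> \<noteq> {} \<longleftrightarrow> r \<le> n"
proof -
  let ?F = "frames n r :: 'a frame set"
  have t: "topspace (subtopology (Xs k) (comp k \<beta>)) = comp k \<beta>" by (auto simp: comp_def)
  have "comp k \<beta> = {} \<longleftrightarrow> topspace (prod_topology (top_of_set ?F) (torus (k * d))) = {}"
    using homotopy_equivalent_space_empty[OF comp_homotopy_equivalent_frames[OF \<beta> red]] unfolding t .
  also have "\<dots> \<longleftrightarrow> ?F = {}"
    using topspace_torus_nonempty[of "k * d"] unfolding topspace_prod_topology by auto
  finally show ?thesis using frames_bound std_frame_in_frames by fastforce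
qed

text \<open>Pairs index \<open>i\<close> with \<open>k div 2 + i\<close>; for odd \<open>k\<close>
  the last row and column are zero.\<close>

definition std_form :: "nat \<Rightarrow> 'a mat" where
  "std_form k = Matrix.mat k k (\<lambda>(i, j). if i < k div 2 \<and> j = k div 2 + i then 1
     else if j < k div 2 \<and> i = k div 2 + j then - 1 else 0)"

lemma std_form_in: "std_form k \<in> antisym_mats k S"
  unfolding antisym_mats_iff using zero_in one_in uminus_in[OF one_in] by (auto simp: std_form_def)

text \<open>Vectors with this Gram matrix are themselves a frame of \<open>k div 2\<close> pairs, so
  the bound for frames applies.\<close>

lemma comp_std_form: "comp k (std_form k) \<noteq> {} \<Longrightarrow> k div 2 \<le> n"
proof -
  let ?r = "k div 2"
  assume "comp k (std_form k) \<noteq> {}"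
  moreover have "topspace (subtopology (Xs k) (comp k (std_form k))) = comp k (std_form k)" by (auto simp: comp_def)
  ultimately have "topspace (prod_topology (top_of_set (gram_set k n (\<lambda>i j. std_form k $$ (i, j)))) (torus (k * d))) \<noteq> {}"
    using homotopy_equivalent_space_empty[OF homotopy_eqv_trans[OF
        homeomorphic_imp_homotopy_equivalent_space[OF comp_homeomorphic[OF std_form_in]] Zs_homotopy_equivalent]] by metis
  then obtain w where w: "w \<in> gram_set k n (\<lambda>i j. std_form k $$ (i, j))" by auto
  have g: "om n (w i) (w j) = std_form k $$ (i, j)" if "i < k" "j < k" for i j
    using w that by (simp add: gram_set_def)
  have "(w, \<lambda>s. w (?r + s)) \<in> frames n ?r"
    unfolding frames_def symp_family_def
  proof (intro CollectI case_prodI allI impI)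
    fix s t assume st: "s < ?r" "t < ?r"
    then have lt: "s < k" "t < k" "?r + s < k" "?r + t < k" by auto
    show "om n (w s) (w (?r + t)) = (if s = t then 1 else 0) \<and> om n (w s) (w t) = 0 \<and> om n (w (?r + s)) (w (?r + t)) = 0"
      using st lt by (auto simp: g std_form_def)
  qed
  then show ?thesis by (rule frames_bound)
qed

text \<open>The Stiefel manifolds are a parameter \<open>V\<close>, replaced by those over the
  complex numbers or the quaternions at the end.\<close>

theorem components:
  fixes V :: "nat \<Rightarrow> 'v topology"
  assumes V: "\<And>r. top_of_set (isotropic_frames n r) homotopy_equivalent_space V r"
  shows "let X = unitri_flat_space k m S; H2 = antisym_mats k S; f = forget_flat k m; \<phi> = induced_on_component f
      in (\<forall>K \<in> path_components_of X. f ` K = {\<phi> K} \<and> \<phi> K \<in> H2)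
       \<and> inj_on \<phi> (path_components_of X)
       \<and> (\<phi> ` path_components_of X = H2 \<longleftrightarrow> k div 2 \<le> n)
       \<and> (\<forall>\<beta> \<in> H2. \<forall>K \<in> path_components_of X. \<phi> K = \<beta> \<longrightarrow>
            (\<exists>r. 2 * r = vec_space.rank k \<beta> \<and>
              subtopology X K homotopy_equivalent_space prod_topology (V r) (torus (k * d))))"
proof -
  define X where "X = Xs k"
  define \<phi> where "\<phi> = induced_on_component (ff k)"
  have Xeq: "unitri_flat_space k m S = X" by (simp add: X_def Xs_def)
  have comp: "K = comp k (\<phi> K) \<and> ff k ` K = {\<phi> K} \<and> \<phi> K \<in> antisym_mats k S" if K: "K \<in> path_components_of X" for K
  proof -
    obtain \<rho> where \<rho>: "\<rho> \<in> K" using nonempty_path_components_of[OF K] by blast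
    have Ceq: "K = comp k (ff k \<rho>)" using path_component_eq_comp K \<rho> unfolding X_def by blast
    have "\<rho> \<in> topspace (Xs k)" using path_components_of_subset[OF K] \<rho> unfolding X_def by blast
    moreover have "ff k ` K = {ff k \<rho>}" using \<rho> by (subst Ceq) (auto simp: comp_def Ceq)
    moreover from this have "\<phi> K = ff k \<rho>" by (simp add: \<phi>_def induced_on_component_def)
    ultimately show ?thesis using Ceq ff_in_antisym_mats by simp
  qed
  have anti: "\<beta> $$ (b, a) = - \<beta> $$ (a, b)" if "\<beta> \<in> antisym_mats k S" "a < k" "b < k" for \<beta> a b
    using that unfolding antisym_mats_iff by blast
  have red_ex: "\<exists>r \<xi> \<eta>. symp_reduction k (\<lambda>i j. \<beta> $$ (i, j)) r \<xi> \<eta>" if "\<beta> \<in> antisym_mats k S" for \<beta>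
    by (rule ex_symp_reduction) (rule anti[OF that])
  have image: "\<beta> \<in> \<phi> ` path_components_of X \<longleftrightarrow> comp k \<beta> \<noteq> {}" if \<beta>: "\<beta> \<in> antisym_mats k S" for \<beta>
  proof
    assume "\<beta> \<in> \<phi> ` path_components_of X"
    then show "comp k \<beta> \<noteq> {}" using comp nonempty_path_components_of by fastforce
  next
    assume "comp k \<beta> \<noteq> {}"
    then obtain \<rho> where \<rho>: "\<rho> \<in> topspace X" "ff k \<rho> = \<beta>" by (auto simp: comp_def X_def)
    then obtain K where K: "K \<in> path_components_of X" "\<rho> \<in> K" using Union_path_components_of[of X] by blast
    then have "\<phi> K = \<beta>" using comp[OF K(1)] \<rho>(2) by (metis imageI singletonD)
    then show "\<beta> \<in> \<phi> ` path_components_of X" using K(1) by blast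
  qed
  have part1: "\<forall>K \<in> path_components_of X. ff k ` K = {\<phi> K} \<and> \<phi> K \<in> antisym_mats k S" using comp by blast
  have part2: "inj_on \<phi> (path_components_of X)" using comp by (metis inj_onI)
  have part3: "\<phi> ` path_components_of X = antisym_mats k S \<longleftrightarrow> k div 2 \<le> n"
  proof
    assume "\<phi> ` path_components_of X = antisym_mats k S"
    then show "k div 2 \<le> n" using std_form_in image comp_std_form by blast
  next
    assume kn: "k div 2 \<le> n"
    have "\<beta> \<in> \<phi> ` path_components_of X" if \<beta>: "\<beta> \<in> antisym_mats k S" for \<beta>
    proof -
      obtain r \<xi> \<eta> where red: "symp_reduction k (\<lambda>i j. \<beta> $$ (i, j)) r \<xi> \<eta>" using red_ex[OF \<beta>] by blast
      have "2 * r \<le> k"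
      proof (rule symp_family_dim_bound)
        show "symp_family (bform k (\<lambda>i j. \<beta> $$ (i, j))) r \<xi> \<eta>" using red by (simp add: symp_reduction_def)
      qed (rule anti[OF \<beta>])
      then show ?thesis using image[OF \<beta>] comp_nonempty_iff[OF \<beta> red] kn by linarith
    qed
    then show "\<phi> ` path_components_of X = antisym_mats k S" using part1 by blast
  qed
  have part4: "\<exists>r. 2 * r = vec_space.rank k \<beta> \<and>
      subtopology X K homotopy_equivalent_space prod_topology (V r) (torus (k * d))"
    if \<beta>: "\<beta> \<in> antisym_mats k S" and K: "K \<in> path_components_of X" and "\<phi> K = \<beta>" for \<beta> K
  proof -
    obtain r \<xi> \<eta> where red: "symp_reduction k (\<lambda>i j. \<beta> $$ (i, j)) r \<xi> \<eta>" using red_ex[OF \<beta>] by blast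
    have "\<beta> \<in> carrier_mat k k" using \<beta> by (rule antisym_mats_carrier)
    then have "vec_space.rank k \<beta> = 2 * r" by (rule symp_reduction_rank[OF _ anti[OF \<beta>] red])
    moreover have "subtopology X K homotopy_equivalent_space prod_topology (V r) (torus (k * d))"
    proof -
      have Ceq: "K = comp k \<beta>" using comp[OF K] \<open>\<phi> K = \<beta>\<close> by simp
      have "subtopology X K homotopy_equivalent_space
          prod_topology (top_of_set (frames n r :: 'a frame set)) (torus (k * d))"
        unfolding Ceq X_def by (rule comp_homotopy_equivalent_frames[OF \<beta> red])
      also have "\<dots> homotopy_equivalent_space prod_topology (V r) (torus (k * d))"
        by (rule homotopy_equivalent_space_prod_left, rule homotopy_eqv_trans[OF frames_homotopy_equivalent_isotropic_frames V])
      finally show ?thesis .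
    qed
    ultimately show ?thesis by metis
  qed
  show ?thesis
    unfolding Let_def Xeq \<phi>_def[symmetric] using part1 part2 part3 part4 by blast
qed

end

section \<open>The circle group\<close>

lemma cis_2pi_eq_iff: "cis (2 * pi * x) = cis (2 * pi * y) \<longleftrightarrow> x - y \<in> \<int>"
proof -
  have "cis (2 * pi * x) = cis (2 * pi * y) \<longleftrightarrow> (\<exists>n::int. 2 * pi * x = 2 * pi * y + 2 * pi * of_int n)"
    using sin_cos_eq_iff[of "2 * pi * x" "2 * pi * y"] by (auto simp: complex_eq_iff)
  also have "\<dots> \<longleftrightarrow> (\<exists>n::int. x - y = of_int n)"
  proof -
    have "2 * pi * x = 2 * pi * y + 2 * pi * of_int n \<longleftrightarrow> x - y = of_int n" for n :: int
    proof -
      have "2 * pi * x = 2 * pi * y + 2 * pi * of_int n \<longleftrightarrow> 2 * pi * (x - y) = 2 * pi * of_int n"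
        by (simp add: algebra_simps)
      then show ?thesis by simp
    qed
    then show ?thesis by simp
  qed
  finally show ?thesis by (auto simp: Ints_def)
qed

text \<open>The bound 1/2 places the angle between -pi and pi, where the cosine is monotone in the
  absolute value.\<close>

lemma sphere_cis:
  fixes z :: complex
  assumes "z \<in> sphere 0 1"
  obtains x where "z = cis (2 * pi * x)" "\<bar>x\<bar> \<le> 1 / 2"
proof -
  have "z = cis (Arg z)" using assms cis_Arg[of z] by (cases "z = 0") (auto simp: sgn_div_norm)
  moreover have "\<bar>Arg z\<bar> \<le> pi" using Arg_bounded[of z] by auto
  ultimately show thesis by (intro that[of "Arg z / (2 * pi)"]) (auto simp: field_simps abs_mult)
qed

lemma open_map_cis_2pi: "open_map euclidean (top_of_set (sphere 0 1)) (\<lambda>x::real. cis (2 * pi * x))"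
  unfolding open_map_def
proof (intro allI impI)
  fix W :: "real set" assume "openin euclidean W"
  then have W: "open W" by simp
  let ?e = "\<lambda>x::real. cis (2 * pi * x)"
  show "openin (top_of_set (sphere 0 1)) (?e ` W)"
  proof (subst openin_subopen, intro ballI)
    fix z assume "z \<in> ?e ` W"
    then obtain x where x: "x \<in> W" "z = ?e x" by blast
    obtain \<delta>0 where "\<delta>0 > 0" "ball x \<delta>0 \<subseteq> W" using W x(1) openE by blast
    \<comment> \<open>With \<delta> below 1/2 the angle 2 pi \<delta> stays below pi, in the range
      where the cosine decreases.\<close>
    then obtain \<delta> where \<delta>: "\<delta> > 0" "\<delta> < 1 / 2" "ball x \<delta> \<subseteq> W"
      by (metis (no_types, opaque_lifting) field_lbound_gt_zero half_gt_zero_iff less_numeral_extra(1)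
          order_trans subset_ball less_eq_real_def)
    \<comment> \<open>The open arc around \<open>z\<close> of angular radius 2 pi \<delta>: v times
      the conjugate of z is the rotation from \<open>z\<close> to \<open>v\<close>, and its real
      part is the cosine of the angle.\<close>
    let ?N = "sphere 0 1 \<inter> {v. Re (v * cnj z) > cos (2 * pi * \<delta>)}"
    have "open {v. Re (v * cnj z) > cos (2 * pi * \<delta>)}"
      by (intro open_Collect_less continuous_intros)
    then have "openin (top_of_set (sphere 0 1)) ?N" by (rule openin_open_Int)
    moreover have "z \<in> ?N"
    proof -
      have "z * cnj z = 1" using x(2) by (simp add: cis_cnj cis_mult)
      moreover have "cos (2 * pi * \<delta>) < cos 0"
        by (rule cos_monotone_0_pi) (use \<delta> in auto)
      ultimately show ?thesis using x(2) by simp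
    qed
    moreover have "?N \<subseteq> ?e ` W"
    proof
      fix v assume v: "v \<in> ?N"
      then have "v * cnj z \<in> sphere 0 1" using x(2) by (simp add: norm_mult)
      then obtain y where y: "v * cnj z = ?e y" "\<bar>y\<bar> \<le> 1 / 2" by (rule sphere_cis)
      have "\<bar>y\<bar> < \<delta>"
      proof (rule ccontr)
        assume "\<not> ?thesis"
        then have "cos (2 * pi * \<bar>y\<bar>) \<le> cos (2 * pi * \<delta>)"
          using y(2) \<delta> by (intro cos_monotone_0_pi_le) auto
        moreover have "cos (2 * pi * \<bar>y\<bar>) = Re (v * cnj z)"
          unfolding y(1) by (cases "y \<ge> 0") auto
        ultimately show False using v by simp
      qed
      then have "x + y \<in> W" using \<delta>(3) by (auto simp: dist_real_def)
      moreover have "v = ?e (x + y)"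
      proof -
        have "cnj z * z = 1" using x(2) by (simp add: cis_cnj cis_mult)
        then have "v = (v * cnj z) * z" by (simp add: mult.assoc)
        also have "\<dots> = ?e y * z" by (simp only: y(1))
        also have "\<dots> = ?e (x + y)" unfolding x(2) by (simp add: cis_mult algebra_simps)
        finally show ?thesis .
      qed
      ultimately show "v \<in> ?e ` W" by blast
    qed
    ultimately show "\<exists>T. openin (top_of_set (sphere 0 1)) T \<and> z \<in> T \<and> T \<subseteq> ?e ` W" by blast
  qed
qed

text \<open>Here \<open>co\<close> gives the real coordinates of the field. Hypothesis
  \<open>box\<close> says that every neighbourhood contains a box in these coordinates; with the
  openness of the circle map in each coordinate this makes \<open>e\<close> open.\<close>

lemma torus_map:
  fixes co :: "'a::topological_space \<Rightarrow> nat \<Rightarrow> real" and e :: "'a \<Rightarrow> nat \<Rightarrow> complex"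
  assumes e_def: "\<And>c. e c = (\<lambda>s\<in>{..<d}. cis (2 * pi * co c s))"
    and cont: "\<And>s. s < d \<Longrightarrow> continuous_on UNIV (\<lambda>c. co c s)"
    and surj: "\<And>v. \<exists>c. \<forall>s<d. co c s = v s"
    and box: "\<And>W c. open W \<Longrightarrow> c \<in> W \<Longrightarrow> \<exists>A. (\<forall>s<d. open (A s) \<and> co c s \<in> A s) \<and>
        (\<forall>v. (\<forall>s<d. v s \<in> A s) \<longrightarrow> (\<exists>c'\<in>W. \<forall>s<d. co c' s = v s))"
  shows "continuous_map euclidean (torus d) e" "open_map euclidean (torus d) e" "range e = topspace (torus d)"
    and "e c = e c' \<longleftrightarrow> (\<forall>s<d. co c s - co c' s \<in> \<int>)"
proof -
  show "continuous_map euclidean (torus d) e"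
    unfolding torus_def continuous_map_componentwise e_def
    using cont by (auto intro!: continuous_intros simp: continuous_map_in_subtopology)
  show "open_map euclidean (torus d) e"
    unfolding open_map_def
  proof (intro allI impI)
    fix W :: "'a set" assume W: "openin euclidean W"
    show "openin (torus d) (e ` W)"
    proof (subst openin_subopen, intro ballI)
      fix z assume "z \<in> e ` W"
      then obtain c where c: "c \<in> W" "z = e c" by blast
      obtain A where A: "\<And>s. s < d \<Longrightarrow> open (A s)" "\<And>s. s < d \<Longrightarrow> co c s \<in> A s"
        and AW: "\<And>v. (\<forall>s<d. v s \<in> A s) \<Longrightarrow> \<exists>c'\<in>W. \<forall>s<d. co c' s = v s"
        using box[of W c] W c(1) by (simp del: open_openin) blast
      let ?T = "\<Pi>\<^sub>E s\<in>{..<d}. (\<lambda>x. cis (2 * pi * x)) ` A s"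
      have "openin (torus d) ?T"
        unfolding torus_def openin_PiE_gen using A(1) open_map_cis_2pi by (auto simp: open_map_def)
      moreover have "z \<in> ?T" using A(2) c(2) by (auto simp: e_def)
      moreover have "?T \<subseteq> e ` W"
      proof
        fix y assume y: "y \<in> ?T"
        then have "\<forall>s. \<exists>x. s < d \<longrightarrow> x \<in> A s \<and> y s = cis (2 * pi * x)" by (auto simp: PiE_iff)
        then obtain v where v: "\<And>s. s < d \<Longrightarrow> v s \<in> A s \<and> y s = cis (2 * pi * v s)" by metis
        then obtain c' where "c' \<in> W" "\<forall>s<d. co c' s = v s" using AW by blast
        moreover from this have "e c' = y" using v y by (auto simp: e_def fun_eq_iff PiE_iff extensional_def)
        ultimately show "y \<in> e ` W" by blast
      qed
      ultimately show "\<exists>T. openin (torus d) T \<and> z \<in> T \<and> T \<subseteq> e ` W" by blast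
    qed
  qed
  show "range e = topspace (torus d)"
  proof
    show "range e \<subseteq> topspace (torus d)" by (simp add: image_subset_iff e_def topspace_torus restrict_PiE_iff)
    show "topspace (torus d) \<subseteq> range e"
    proof
      fix y assume y: "y \<in> topspace (torus d)"
      then have "\<forall>s. \<exists>x. s < d \<longrightarrow> y s = cis (2 * pi * x)"
        by (metis PiE_mem lessThan_iff sphere_cis topspace_torus)
      then obtain v where v: "\<And>s. s < d \<Longrightarrow> y s = cis (2 * pi * v s)" by metis
      obtain c where "\<forall>s<d. co c s = v s" using surj by blast
      then have "e c = y" using v y by (auto simp: e_def fun_eq_iff topspace_torus PiE_iff extensional_def)
      then show "y \<in> range e" by blast
    qed
  qed
  show "e c = e c' \<longleftrightarrow> (\<forall>s<d. co c s - co c' s \<in> \<int>)"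
    by (auto simp: e_def fun_eq_iff restrict_def cis_2pi_eq_iff)
qed

section \<open>The two fields as instances\<close>

definition real_circle :: "real \<Rightarrow> nat \<Rightarrow> complex" where
  "real_circle c = (\<lambda>s\<in>{..<1}. cis (2 * pi * c))"

definition complex_circle :: "complex \<Rightarrow> nat \<Rightarrow> complex" where
  "complex_circle c = (\<lambda>s\<in>{..<2}. cis (2 * pi * (if s = 0 then Re c else Im c)))"

lemma real_unitri_flat: "unitri_flat id \<int> (n + 2) 1 real_circle n"
proof -
  have box: "\<exists>A. (\<forall>s<1::nat. open (A s) \<and> c \<in> A s) \<and> (\<forall>v. (\<forall>s<1. v s \<in> A s) \<longrightarrow> (\<exists>c'\<in>W. \<forall>s<1. c' = v s))"
    if "open W" "c \<in> W" for W and c :: real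
  proof (intro exI[of _ "\<lambda>_. W"] conjI allI impI)
    show "\<exists>c'\<in>W. \<forall>s<1. c' = v s" if "\<forall>s<1. v s \<in> W" for v :: "nat \<Rightarrow> real"
      using that by (intro bexI[of _ "v 0"]) auto
  qed (use that in auto)
  note e = torus_map[where co = "\<lambda>c _. c" and d = 1 and e = real_circle, OF real_circle_def _ _ box]
  show ?thesis
  proof (unfold_locales)
    show "continuous_map euclidean (torus 1) real_circle" by (rule e) auto
    show "open_map euclidean (torus 1) real_circle" by (rule e) auto
    show "range real_circle = topspace (torus 1)" by (rule e) auto
    show "real_circle x = real_circle y \<longleftrightarrow> x - y \<in> \<int>" for x y
      using e(4)[of x y] by auto
    show "x = 0" if "x \<in> \<int>" "norm x < 1" for x :: real
      using that by (auto simp: Ints_def)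
  qed auto
qed

lemma gaussian_ints_iff: "z \<in> gaussian_ints \<longleftrightarrow> Re z \<in> \<int> \<and> Im z \<in> \<int>"
  by (simp add: gaussian_ints_def)

lemma complex_unitri_flat: "unitri_flat cnj gaussian_ints (n + 2) 2 complex_circle n"
proof -
  define co where "co c s = (if s = 0 then Re c else Im c)" for c and s :: nat
  have all2: "(\<forall>s<2. P s) \<longleftrightarrow> P 0 \<and> P (Suc 0)" for P by (auto simp: less_2_cases_iff)
  have box: "\<exists>A. (\<forall>s<2. open (A s) \<and> co c s \<in> A s) \<and> (\<forall>v. (\<forall>s<2. v s \<in> A s) \<longrightarrow> (\<exists>c'\<in>W. \<forall>s<2. co c' s = v s))"
    if W: "open W" "c \<in> W" for W c
  proof -
    have "open ((\<lambda>z. Complex (fst z) (snd z)) -` W)"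
      by (rule open_vimage[OF W(1)]) (unfold Complex_eq, intro continuous_intros)
    moreover have "(Re c, Im c) \<in> (\<lambda>z. Complex (fst z) (snd z)) -` W" using W(2) by simp
    ultimately obtain A B where AB: "open A" "open B" "Re c \<in> A" "Im c \<in> B"
      "A \<times> B \<subseteq> (\<lambda>z. Complex (fst z) (snd z)) -` W"
      by (rule open_prod_elim) auto
    have "\<exists>c'\<in>W. \<forall>s<2. co c' s = v s" if "\<forall>s<2. v s \<in> (if s = 0 then A else B)" for v
    proof -
      have "Complex (v 0) (v (Suc 0)) \<in> W" using AB(5) that unfolding all2 by auto
      then show ?thesis by (rule bexI[rotated]) (simp add: all2 co_def)
    qed
    then show ?thesis using AB by (intro exI[of _ "\<lambda>s. if s = 0 then A else B"]) (auto simp: all2 co_def)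
  qed
  have surj: "\<exists>c. \<forall>s<2. co c s = v s" for v
    by (rule exI[of _ "Complex (v 0) (v (Suc 0))"]) (simp add: all2 co_def)
  have cont: "continuous_on UNIV (\<lambda>c. co c s)" for s
    unfolding co_def by (cases "s = 0") (auto intro: continuous_intros)
  have circ: "complex_circle c = (\<lambda>s\<in>{..<2}. cis (2 * pi * co c s))" for c
    by (simp add: complex_circle_def co_def)
  note e = torus_map[where co = co and d = 2 and e = complex_circle, OF circ cont surj box]
  show ?thesis
  proof (unfold_locales)
    show "continuous_map euclidean (torus 2) complex_circle" by (rule e)
    show "open_map euclidean (torus 2) complex_circle" by (rule e)
    show "range complex_circle = topspace (torus 2)" by (rule e)
    show "complex_circle x = complex_circle y \<longleftrightarrow> x - y \<in> gaussian_ints" for x y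
      using e(4)[of x y] by (simp add: all2 co_def gaussian_ints_iff)
    show "x = 0" if x: "x \<in> gaussian_ints" "norm x < 1" for x :: complex
    proof -
      have "\<bar>Re x\<bar> < 1" "\<bar>Im x\<bar> < 1"
        using abs_Re_le_cmod[of x] abs_Im_le_cmod[of x] x(2) by linarith+
      then show ?thesis using x(1) by (auto simp: gaussian_ints_iff Ints_def complex_eq_iff)
    qed
  qed (auto simp: gaussian_ints_iff)
qed

theorem theorem1:
  fixes k n :: nat
  assumes "k \<ge> 1" and "n \<ge> 1"
  shows
    "(let X = unitri_flat_space k (n + 2) (\<int> :: real set);
          H2 = antisym_mats k (\<int> :: real set);
          f = forget_flat k (n + 2);
          \<phi> = induced_on_component f
      in (\<forall>C \<in> path_components_of X. f ` C = {\<phi> C} \<and> \<phi> C \<in> H2)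
       \<and> (k \<ge> 2 \<longrightarrow> inj_on \<phi> (path_components_of X))
       \<and> (\<phi> ` path_components_of X = H2 \<longleftrightarrow> k div 2 \<le> n)
       \<and> (\<forall>\<beta> \<in> H2. \<forall>C \<in> path_components_of X. \<phi> C = \<beta> \<longrightarrow>
            (\<exists>r. 2 * r = vec_space.rank k \<beta> \<and>
              subtopology X C homotopy_equivalent_space
                prod_topology (stiefel cnj r n) (torus (k * DIM(real))))))
     \<and>
     (let X = unitri_flat_space k (n + 2) gaussian_ints;
          H2 = antisym_mats k gaussian_ints;
          f = forget_flat k (n + 2);
          \<phi> = induced_on_component f
      in (\<forall>C \<in> path_components_of X. f ` C = {\<phi> C} \<and> \<phi> C \<in> H2)
       \<and> (k \<ge> 2 \<longrightarrow> inj_on \<phi> (path_components_of X))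
       \<and> (\<phi> ` path_components_of X = H2 \<longleftrightarrow> k div 2 \<le> n)
       \<and> (\<forall>\<beta> \<in> H2. \<forall>C \<in> path_components_of X. \<phi> C = \<beta> \<longrightarrow>
            (\<exists>r. 2 * r = vec_space.rank k \<beta> \<and>
              subtopology X C homotopy_equivalent_space
                prod_topology (stiefel qcnj r n) (torus (k * DIM(complex))))))"
proof (rule conjI, goal_cases)
  case 1
  note * = unitri_flat.components[OF real_unitri_flat, where k = k and V = "\<lambda>r. stiefel cnj r n", OF real_isotropic_frames_stiefel]
  show ?case unfolding Let_def by (insert *[unfolded Let_def], elim conjE, intro conjI impI, simp_all only: DIM_real)
next
  case 2
  note * = unitri_flat.components[OF complex_unitri_flat, where k = k and V = "\<lambda>r. stiefel qcnj r n", OF complex_isotropic_frames_stiefel]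
  show ?case unfolding Let_def by (insert *[unfolded Let_def], elim conjE, intro conjI impI, simp_all only: DIM_complex)
qed

end
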